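(* (i) The identity $\beta_1(e,-1)=\beta_2(-e,-1)$ holds for all $e\in(-1,1)$. For fixed $\omega\in\mathbf U\setminus\{-1\}$ and $i=1,2$, the function $\beta_i(e,\omega)$ is even in $e\in(-1,1)$. (ii) The function $\beta_k(e)$, $e\in(-1,1)$, is even in $e$, i.e. $\beta_k(-e)=\beta_k(e)$ for all $e\in(-1,1)$. Consequently the curve $\Gamma_k=\{(\beta_k(e),e):e\in[0,1)\}$ can be continuously extended to the region $[0,9]\times(-1,1)$ as a curve symmetric with respect to the segment $[0,9]\times\{0\}$.
   Context: $\mathbf U$ is the unit circle in $\mathbb C$, $\sigma(M)$ the spectrum of $M$. Let $J=\begin{pmatrix}0&-I_2\\ I_2&0\end{pmatrix}$ and $\mathrm{Sp}(4)=\{M\in \mathrm{GL}(4,\mathbb R): M^TJM=J\}$. For $(\beta,e)\in[0,9]\times(-1,1)$ let $\gamma_{\beta,e}:[0,2\pi]\to\mathrm{Sp}(4)$ be the solution of $\dot\gamma(t)=JB(t)\gamma(t)$, $\gamma(0)=I_4$, where $$B(t)=\begin{pmatrix}1&0&0&1\\0&1&-1&0\\0&-1&\frac{2e\cos t-1-\sqrt{9-\beta}}{2(1+e\cos t)}&0\\1&0&0&\frac{2e\cos t-1+\sqrt{9-\beta}}{2(1+e\cos t)}\end{pmatrix}.$$ (For $e\ge0$ it is the essential part of the fundamental solution of the linearized system along the elliptic Lagrangian solution of the planar three-body problem with eccentricity $e$ and mass parameter $\beta$; it is extended to $e<0$ by the same formula.) For $\omega\in\mathbf U\setminus\{1\}$,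 $\beta_1(\cdot,\omega),\beta_2(\cdot,\omega):(-1,1)\to(0,9)$ denote the two real analytic functions such that, for each $e\in(-1,1)$, the values $\beta\in[0,9]$ for which $\omega\in\sigma(\gamma_{\beta,e}(2\pi))$, counted with multiplicity $\dim_{\mathbb C}\ker_{\mathbb C}(\gamma_{\beta,e}(2\pi)-\omega I_4)$, are exactly $\beta_1(e,\omega),\beta_2(e,\omega)$ (the $\omega$-degeneracy curves). For $\omega=1$, $\beta_1(e,1)=\beta_2(e,1)\equiv0$. For $e\in(-1,1)$, $\beta_k(e)=\sup\{\beta'\in[0,9]:\sigma(\gamma_{\beta,e}(2\pi))\cap\mathbf U\neq\emptyset\ \ \forall\beta\in[0,\beta']\}$. *)

theory Defs
  imports "HOL-Analysis.Analysis"
begin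

text \<open>The library type \<^typ>\<open>4\<close> has the elements 1, 2, 3 and 4 = 0; \<^const>\<open>vector\<close> fills the
  components in the order 1, 2, 3, 4.\<close>

lemma forall_4: "(\<forall>i::4. P i) \<longleftrightarrow> P 1 \<and> P 2 \<and> P 3 \<and> P 4"
  by (metis exhaust_4)

lemma vector_4 [simp]:
  "(vector [w, x, y, z] :: 'a::zero ^ 4) $ 1 = w"
  "(vector [w, x, y, z] :: 'a::zero ^ 4) $ 2 = x"
  "(vector [w, x, y, z] :: 'a::zero ^ 4) $ 3 = y"
  "(vector [w, x, y, z] :: 'a::zero ^ 4) $ 4 = z"
  unfolding vector_def by simp_all

definition Jmat :: "real ^ 4 ^ 4" where
  "Jmat = vector
     [vector [0, 0, -1,  0],
      vector [0, 0,  0, -1],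
      vector [1, 0,  0,  0],
      vector [0, 1,  0,  0]]"

definition Sp4 :: "(real ^ 4 ^ 4) set" where
  "Sp4 = {M. invertible M \<and> transpose M ** Jmat ** M = Jmat}"

definition Bmat :: "real \<Rightarrow> real \<Rightarrow> real \<Rightarrow> real ^ 4 ^ 4" where
  "Bmat \<beta> e t = vector
     [vector [1,  0,  0, 1],
      vector [0,  1, -1, 0],
      vector [0, -1, (2 * e * cos t - 1 - sqrt (9 - \<beta>)) / (2 * (1 + e * cos t)), 0],
      vector [1,  0,  0, (2 * e * cos t - 1 + sqrt (9 - \<beta>)) / (2 * (1 + e * cos t))]]"

definition is_fundamental_solution :: "real \<Rightarrow> real \<Rightarrow> (real \<Rightarrow> real ^ 4 ^ 4) \<Rightarrow> bool" where
  "is_fundamental_solution \<beta> e g \<longleftrightarrow>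
     g 0 = mat 1 \<and> g \<in> {0..2 * pi} \<rightarrow> Sp4 \<and>
     (\<forall>t\<in>{0..2 * pi}.
        (g has_vector_derivative (Jmat ** Bmat \<beta> e t ** g t)) (at t within {0..2 * pi}))"

text \<open>The solution is unique on \<open>[0, 2\<pi>]\<close>, so for \<open>\<beta> \<in> [0, 9]\<close> and \<open>e \<in> (-1, 1)\<close> the choice
  operator only fixes irrelevant values outside this interval.\<close>

definition gamma :: "real \<Rightarrow> real \<Rightarrow> real \<Rightarrow> real ^ 4 ^ 4" where
  "gamma \<beta> e = (SOME g. is_fundamental_solution \<beta> e g)"

abbreviation complex_matrix :: "real ^ 'n ^ 'n \<Rightarrow> complex ^ 'n ^ 'n" where
  "complex_matrix M \<equiv> map_matrix complex_of_real M"

definition cspectrum :: "real ^ 'n ^ 'n \<Rightarrow> complex set" where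
  "cspectrum M = {\<mu>. \<exists>v. v \<noteq> 0 \<and> complex_matrix M *v v = \<mu> *s v}"

text \<open>\<^const>\<open>vec.dim\<close> is the dimension over the field of scalars, here the complex numbers
  (unlike \<^const>\<open>dim\<close>, which is the real dimension). It vanishes iff \<open>\<mu>\<close> is not in the spectrum.\<close>

definition eigen_dim :: "real ^ 'n ^ 'n \<Rightarrow> complex \<Rightarrow> nat" where
  "eigen_dim M \<mu> = vec.dim {v :: complex ^ 'n. (complex_matrix M - mat \<mu>) *v v = 0}"

definition real_analytic_on :: "(real \<Rightarrow> real) \<Rightarrow> real set \<Rightarrow> bool" where
  "real_analytic_on f S \<longleftrightarrow> (\<forall>x\<in>S. \<exists>F. (\<lambda>h. f (x + h)) has_fps_expansion F)"

text \<open>The second clause says that, for \<open>\<omega> \<noteq> 1\<close>, the parameters \<open>\<beta> \<in> [0, 9]\<close> with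
  \<open>\<omega> \<in> \<sigma>(\<gamma>\<^bsub>\<beta>,e\<^esub>(2\<pi>))\<close>, each repeated according to the complex dimension of the kernel, form the
  multiset of \<open>b1 e \<omega>\<close> and \<open>b2 e \<omega>\<close>. The two functions are not ordered by size (the curves may
  cross), so the labelling is arbitrary.\<close>

definition degeneracy_curves ::
    "(real \<Rightarrow> complex \<Rightarrow> real) \<Rightarrow> (real \<Rightarrow> complex \<Rightarrow> real) \<Rightarrow> bool" where
  "degeneracy_curves b1 b2 \<longleftrightarrow>
     (\<forall>\<omega>\<in>sphere 0 1 - {1}. \<forall>b\<in>{b1, b2}.
        real_analytic_on (\<lambda>e. b e \<omega>) {-1<..<1} \<and> (\<lambda>e. b e \<omega>) \<in> {-1<..<1} \<rightarrow> {0<..<9}) \<and>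
     (\<forall>\<omega>\<in>sphere 0 1 - {1}. \<forall>e\<in>{-1<..<1}. \<forall>\<beta>\<in>{0..9}.
        eigen_dim (gamma \<beta> e (2 * pi)) \<omega> = of_bool (\<beta> = b1 e \<omega>) + of_bool (\<beta> = b2 e \<omega>)) \<and>
     (\<forall>e\<in>{-1<..<1}. b1 e 1 = 0 \<and> b2 e 1 = 0)"

definition beta_k :: "real \<Rightarrow> real" where
  "beta_k e = Sup {\<beta>'\<in>{0..9}. \<forall>\<beta>\<in>{0..\<beta>'}. cspectrum (gamma \<beta> e (2 * pi)) \<inter> sphere 0 1 \<noteq> {}}"

text \<open>The curve \<open>\<Gamma>\<^sub>k\<close> is the restriction of this map to \<open>[0, 1)\<close>.\<close>

definition Gamma_k :: "real \<Rightarrow> real \<times> real" where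
  "Gamma_k e = (beta_k e, e)"

end

(* Since B_e(t + pi) = B_{-e}(t), the monodromy matrices at e and -e factor as P'P and PP' and are
   conjugate, which gives the evenness of beta_k and, for each omega, of the unordered pair of
   degenerate parameters. By analyticity in e the two curves are then either both even or swapped by
   e -> -e. For nonreal omega a swap would force b1(0) = b2(0), but at e = 0 the system is autonomous
   and its eigenspaces for nonreal unit eigenvalues are one-dimensional. For omega = -1 evenness is
   excluded because the curves have nonzero slope at e = 0, by first order perturbation theory.

   For the continuity of beta_k, with q = (z3, z4), a unit eigenvalue makes the energy
   int |p|^2 - |q|^2 + ((3 + s)|q1|^2 + (3 - s)|q2|^2) / (2 rho) vanish, where rho = 1 + e cos t and
   s = sqrt(9 - beta). Its s-independent part is positive (Jacobi's completion of squares), so the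
   s-derivative is nonzero on every eigenvector: simple zeros of det(gamma - omega) in beta persist
   under perturbation of omega. For omega = 1 the energy is a convex combination of a positive form and of the
   second variation of the Kepler action at its elliptic orbits, which is nonnegative, so 1 is not an
   eigenvalue for beta > 0. Moving omega along the circle towards 1 then shows that all parameters above a
   hyperbolic one are hyperbolic, whence beta_k is the largest non-hyperbolic parameter; it is upper
   semicontinuous as the non-hyperbolic set is closed, and lower semicontinuous since the degeneracy curves are
   continuous. *)
theory Submission
  imports Defs
begin

section \<open>Linear ordinary differential equations\<close>

text \<open>The hypothesis makes the curves analytic in e for each fixed \<omega> and says nothing
  about how they depend on \<omega>. Whatever is claimed about moving \<omega> along the circle
  therefore has to come from the determinant of the monodromy matrix minus \<omega>. Two facts make
  this workable: divided by \<omega>^2 the determinant is real on the circle, so that sign changes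
  can be followed, and the coefficient matrix is affine in s, so that differences over two values of
  \<beta> are given by an exact integral formula. Where the two curves meet there need be no sign
  change, and that case is settled by counting degenerate parameters instead. The special role of -1
  comes from the circular case, where the exponents are the roots of x^4 + x^2 + \<beta> / 4: for
  given \<beta> > 0 a multiplier on the circle determines its exponent i y, except that y = 1/2 and
  y = -1/2 both give -1. This happens at \<beta> = 3/4, through which both curves of -1 pass at e =
  0; hence the constant 3/4 and the half angles t / 2 below.\<close>

lemma bounded_bilinear_path_bound:
  assumes pr: "bounded_bilinear (pr :: 'b::real_normed_vector \<Rightarrow> 'c::real_normed_vector
      \<Rightarrow> 'a::real_normed_vector)"
    and X: "continuous_on {a..b :: real} X"
  obtains K where "K > 0" "\<And>t y. t \<in> {a..b} \<Longrightarrow> norm (pr (X t) y) \<le> K * norm y"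
proof -
  interpret bounded_bilinear pr by (rule pr)
  obtain C where C: "C > 0" "\<And>a b. norm (pr a b) \<le> norm a * norm b * C"
    using pos_bounded by blast
  obtain KX where KX: "KX > 0" "\<And>t. t \<in> {a..b} \<Longrightarrow> norm (X t) \<le> KX"
    using compact_imp_bounded[OF compact_continuous_image[OF X compact_Icc]]
    by (metis bounded_pos imageI)
  have "norm (pr (X t) y) \<le> (KX * C) * norm y" if "t \<in> {a..b}" for t y
  proof -
    have "norm (X t) * norm y * C \<le> KX * norm y * C"
      using KX(2)[OF that] C by (intro mult_right_mono) auto
    then show ?thesis using C(2)[of "X t" y] by (simp add: mult_ac)
  qed
  then show thesis using that[of "KX * C"] C KX by simp
qed

text \<open>The solution is the Peano-Baker series, summed by the Weierstrass test and
  differentiated term by term. The product \<open>pr\<close> is left abstract because the lemmas on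
  linear equations are applied to matrices, to real vectors and to complex vectors moved by a real
  matrix.\<close>

lemma linear_ode_exists:
  fixes pr :: "'b::real_normed_vector \<Rightarrow> 'a::banach \<Rightarrow> 'a"
      and X :: "real \<Rightarrow> 'b"
  assumes pr: "bounded_bilinear pr" and X: "continuous_on {0..T} X"
  shows "\<exists>y. y 0 = y0 \<and> (\<forall>t\<in>{0..T}. (y has_vector_derivative pr (X t) (y t))
      (at t within {0..T}))"
proof (cases "T \<ge> 0")
  case True
  interpret bounded_bilinear pr by (rule pr)
  obtain K where K0: "K > 0" and K: "\<And>t b. t \<in> {0..T} \<Longrightarrow> norm (pr (X t) b)
      \<le> K * norm b"
    using bounded_bilinear_path_bound[OF pr X] by blast
  \<comment> \<open>\<open>y n\<close> is the n-fold iterated integral of the coefficient, so its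
    norm has the bound (K t)^n / n! of an exponential series.\<close>
  define y :: "nat \<Rightarrow> real \<Rightarrow> 'a" where
    "y = rec_nat (\<lambda>t. y0) (\<lambda>n f t. integral {0..t} (\<lambda>s. pr (X s) (f s)))"
  have y_0: "y 0 = (\<lambda>t. y0)" and y_Suc: "y (Suc n)
      = (\<lambda>t. integral {0..t} (\<lambda>s. pr (X s) (y n s)))" for n
    by (simp_all add: y_def)
  have y_cont: "continuous_on {0..T} (y n)" for n
  proof (induction n)
    case (Suc n)
    have "continuous_on {0..T} (\<lambda>s. pr (X s) (y n s))"
      by (intro continuous_on X Suc)
    then show ?case unfolding y_Suc
      by (intro indefinite_integral_continuous_1 integrable_continuous_real)
  qed (simp add: y_0)
  have pc: "continuous_on {0..T} (\<lambda>s. pr (X s) (y n s))" for n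
    by (intro continuous_on X y_cont)
  have y_deriv: "(y (Suc n) has_vector_derivative pr (X t) (y n t)) (at t within {0..T})"
    if "t \<in> {0..T}" for n t
    unfolding y_Suc by (rule integral_has_vector_derivative[OF pc that])
  have y_bound: "norm (y n t) \<le> norm y0 * (K * t) ^ n / fact n" if "t \<in> {0..T}" for n t
    using that
  proof (induction n arbitrary: t)
    case (Suc n)
    have sub: "{0..t} \<subseteq> {0..T}" using Suc.prems by auto
    have I: "((\<lambda>s. K * (norm y0 * (K * s) ^ n / fact n)) has_integral
         norm y0 * (K * t) ^ Suc n / fact (Suc n) - norm y0 * (K * 0) ^ Suc n / fact (Suc n)) {0..t}"
    proof (rule fundamental_theorem_of_calculus)
      fix s
      have "((\<lambda>s. norm y0 / fact (Suc n) * (K * s) ^ Suc n) has_real_derivative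
          norm y0 / fact (Suc n) * (real (Suc n) * (K * s) ^ n * K)) (at s within {0..t})"
        by (rule derivative_eq_intros refl | simp del: power_Suc fact_Suc)+
      moreover have "norm y0 / fact (Suc n) * (real (Suc n) * (K * s) ^ n * K) =
          K * (norm y0 * (K * s) ^ n / fact n)"
        by (simp del: of_nat_Suc)
      moreover have "(\<lambda>s. norm y0 / fact (Suc n) * (K * s) ^ Suc n) =
          (\<lambda>s. norm y0 * (K * s) ^ Suc n / fact (Suc n))"
        by (simp only: times_divide_eq_left)
      ultimately show "((\<lambda>s. norm y0 * (K * s) ^ Suc n / fact (Suc n)) has_vector_derivative
          K * (norm y0 * (K * s) ^ n / fact n)) (at s within {0..t})"
        by (simp only: has_real_derivative_iff_has_vector_derivative)
    qed (use Suc.prems in auto)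
    have "norm (integral {0..t} (\<lambda>s. pr (X s) (y n s)))
       \<le> integral {0..t} (\<lambda>s. K * (norm y0 * (K * s) ^ n / fact n))"
    proof (rule integral_norm_bound_integral)
      show "(\<lambda>s. pr (X s) (y n s)) integrable_on {0..t}"
        using continuous_on_subset[OF pc sub] by (intro integrable_continuous_real)
      show "(\<lambda>s. K * (norm y0 * (K * s) ^ n / fact n)) integrable_on {0..t}"
        using I by blast
      fix s assume s: "s \<in> {0..t}"
      then have "norm (pr (X s) (y n s)) \<le> K * norm (y n s)" using sub by (intro K) auto
      also have "\<dots> \<le> K * (norm y0 * (K * s) ^ n / fact n)"
        using Suc.IH[of s] s sub K0 by (intro mult_left_mono) auto
      finally show "norm (pr (X s) (y n s)) \<le> K * (norm y0 * (K * s) ^ n / fact n)" .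
    qed
    also have "\<dots> = norm y0 * (K * t) ^ Suc n / fact (Suc n)"
      using integral_unique[OF I] by simp
    finally show ?case by (simp add: y_Suc)
  qed (simp add: y_0)
  define Y where "Y t = (\<Sum>n. y n t)" for t
  have summ: "summable (\<lambda>n. norm y0 * (K * T) ^ n / fact n)"
    using summable_mult[OF summable_exp[of "K * T"], of "norm y0"] by (simp add: field_simps)
  have bnd: "norm (y n t) \<le> norm y0 * (K * T) ^ n / fact n" if "t \<in> {0..T}" for n t
    using that K0 True
    by (intro order.trans[OF y_bound[OF that]] divide_right_mono mult_left_mono power_mono) auto
  have unif: "uniform_limit {0..T} (\<lambda>n t. \<Sum>i<n. y i t) Y sequentially"
    unfolding Y_def by (rule Weierstrass_m_test[OF _ summ]) (use bnd in auto)
  have sums: "(\<lambda>n. y n t) sums Y t" if "t \<in> {0..T}" for t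
    using tendsto_uniform_limitI[OF unif that] by (simp add: sums_def)
  have "\<exists>g. \<forall>t\<in>{0..T}. (\<lambda>n. y n t) sums (g t) \<and>
      (g has_derivative (\<lambda>h. h *\<^sub>R pr (X t) (Y t))) (at t within {0..T})"
  proof (rule has_derivative_series)
    show "(y n has_derivative (\<lambda>h. h *\<^sub>R (case n of 0 \<Rightarrow> 0 | Suc m \<Rightarrow>
        pr (X t) (y m t))))
        (at t within {0..T})" if "t \<in> {0..T}" for n t
      using y_deriv[OF that] by (cases n) (auto simp: y_0 has_vector_derivative_def)
    show "(\<lambda>n. y n 0) sums Y 0" using sums True by simp
    show "0 \<in> {0..T}" using True by simp
    fix e :: real assume "e > 0"
    then have "\<forall>\<^sub>F n in sequentially. \<forall>t\<in>{0..T}. dist (\<Sum>i<n. y i t) (Y t)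
        < e / K"
      using K0 by (intro uniform_limitD[OF unif]) simp
    \<comment> \<open>The term \<open>y 0\<close> is constant, so the derivative of a partial sum of
      n terms involves only the first n - 1 of them; hence the shifted index.\<close>
    then have "\<forall>\<^sub>F n in sequentially. \<forall>t\<in>{0..T}. dist (\<Sum>i<n
        - 1. y i t) (Y t) < e / K"
      by (subst eventually_sequentially_Suc[symmetric]) simp
    then show "\<forall>\<^sub>F n in sequentially. \<forall>t\<in>{0..T}. \<forall>h. norm ((\<Sum>i<n.
        h *\<^sub>R
          (case i of 0 \<Rightarrow> 0 | Suc m \<Rightarrow> pr (X t) (y m t)))
              - h *\<^sub>R pr (X t) (Y t)) \<le> e * norm h"
      using eventually_gt_at_top[of 0]
    proof eventually_elim
      case (elim n)
      then obtain m where n: "n = Suc m" using gr0_implies_Suc by blast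
      show ?case
      proof (intro ballI allI)
        fix t h assume t: "t \<in> {0..T}"
        have "(\<Sum>i<n. h *\<^sub>R (case i of 0 \<Rightarrow> 0 | Suc m \<Rightarrow> pr (X t) (y m t))) =
              (\<Sum>i<m. h *\<^sub>R pr (X t) (y i t))"
          unfolding n by (subst sum.lessThan_Suc_shift) simp
        also have "\<dots> = h *\<^sub>R pr (X t) (\<Sum>i<m. y i t)"
          by (simp add: sum_right scaleR_sum_right)
        finally have "norm ((\<Sum>i<n. h *\<^sub>R (case i of 0 \<Rightarrow> 0 | Suc m \<Rightarrow> pr
            (X t) (y m t)))
            - h *\<^sub>R pr (X t) (Y t)) = \<bar>h\<bar> * norm (pr (X t) ((\<Sum>i<m. y i t) - Y t))"
          by (simp add: diff_right flip: scaleR_diff_right)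
        also have "\<dots> \<le> \<bar>h\<bar> * (K * norm ((\<Sum>i<m. y i t) - Y t))"
          by (intro mult_left_mono K t) simp
        also have "\<dots> \<le> \<bar>h\<bar> * (K * (e / K))"
          using elim(1) t K0 unfolding n dist_norm
          by (intro mult_left_mono) (auto intro: less_imp_le)
        finally show "norm ((\<Sum>i<n. h *\<^sub>R (case i of 0 \<Rightarrow> 0 | Suc m \<Rightarrow> pr
            (X t) (y m t)))
            - h *\<^sub>R pr (X t) (Y t)) \<le> e * norm h"
          using K0 by (simp add: mult.commute)
      qed
    qed
  qed simp
  then obtain g where g: "\<And>t. t \<in> {0..T} \<Longrightarrow> (\<lambda>n. y n t) sums (g t)"
    "\<And>t. t \<in> {0..T} \<Longrightarrow> (g has_derivative (\<lambda>h. h *\<^sub>R pr (X t) (Y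
        t))) (at t within {0..T})"
    by blast
  have gY: "g t = Y t" if "t \<in> {0..T}" for t
    using sums_unique2[OF g(1) sums] that by blast
  have "y (Suc n) 0 = 0" for n by (simp add: y_Suc)
  then have "(\<lambda>n. y n 0) sums y0"
  proof -
    have "(\<lambda>n. y n 0) = (\<lambda>n. if n = 0 then y0 else 0)"
      using \<open>\<And>n. y (Suc n) 0 = 0\<close> by (auto simp: fun_eq_iff y_0 gr0_conv_Suc)
    then show ?thesis using sums_single[of 0 "\<lambda>n. y0"] by simp
  qed
  then have "g 0 = y0" using g(1)[of 0] True sums_unique2 by fastforce
  then show ?thesis using g(2) gY by (auto simp: has_vector_derivative_def)
qed auto

text \<open>Working with the squared norm keeps everything differentiable. In the integrating factor
  exp (-(2K + 1) s) the part 2K absorbs the growth and the extra 1 absorbs 2 |x| \<epsilon> \<le>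
  |x|^2 + \<epsilon>^2, so that \<phi> decreases. The case \<epsilon> = 0 gives uniqueness, small
  \<epsilon> gives dependence on parameters.\<close>

lemma gronwall_square:
  fixes x :: "real \<Rightarrow> 'a::real_inner"
  assumes deriv: "\<And>t. t \<in> {0..T} \<Longrightarrow> (x has_vector_derivative F t) (at t within {0..T})"
    and bound: "\<And>t. t \<in> {0..T} \<Longrightarrow> norm (F t) \<le> K * norm (x t) + \<epsilon>"
    and K: "K \<ge> 0" and t: "t \<in> {0..T}"
  shows "(norm (x t))\<^sup>2 \<le> ((norm (x 0))\<^sup>2 + \<epsilon>\<^sup>2 * T) * exp ((2 * K + 1) * T)"
proof -
  define c where "c = 2 * K + 1"
  define \<phi> where "\<phi> s = exp (- c * s) * (x s \<bullet> x s) - \<epsilon>\<^sup>2 * s" for s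
  have d: "(\<phi> has_real_derivative (exp (- c * s) * (2 * (x s \<bullet> F s)
      - c * (x s \<bullet> x s)) - \<epsilon>\<^sup>2))
      (at s within {0..T})" if "s \<in> {0..T}" for s
  proof -
    have "((\<lambda>s. x s \<bullet> x s) has_real_derivative 2 * (x s \<bullet> F s)) (at s within {0..T})"
      using bounded_bilinear.has_vector_derivative[OF bounded_bilinear_inner deriv[OF that] deriv[OF that]]
      by (simp add: has_real_derivative_iff_has_vector_derivative inner_commute)
    then show ?thesis unfolding \<phi>_def
      by (auto intro!: derivative_eq_intros simp: algebra_simps)
  qed
  have neg: "exp (- c * s) * (2 * (x s \<bullet> F s) - c * (x s \<bullet> x s))
      - \<epsilon>\<^sup>2 \<le> 0" if s: "s \<in> {0..T}" for s
  proof -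
    have "x s \<bullet> F s \<le> norm (x s) * (K * norm (x s) + \<epsilon>)"
      by (rule order.trans[OF norm_cauchy_schwarz]) (intro mult_left_mono bound s norm_ge_zero)
    moreover have "2 * norm (x s) * \<epsilon> \<le> (norm (x s))\<^sup>2 + \<epsilon>\<^sup>2"
        by (rule sum_squares_bound)
    ultimately have "2 * (x s \<bullet> F s) - c * (x s \<bullet> x s) \<le> \<epsilon>\<^sup>2"
      by (simp add: c_def dot_square_norm power2_eq_square algebra_simps)
    moreover have "exp (- c * s) * y \<le> \<epsilon>\<^sup>2" if "y \<le> \<epsilon>\<^sup>2" for y
    proof (cases "y \<ge> 0")
      case True
      have "exp (- c * s) \<le> 1" using K s by (simp add: c_def mult_nonpos_nonneg)
      then show ?thesis using that True mult_right_mono[of "exp (- c * s)" 1 y] by linarith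
    next
      case False
      then have "exp (- c * s) * y \<le> 0" by (simp add: mult_nonneg_nonpos)
      then show ?thesis using zero_le_power2[of \<epsilon>] by linarith
    qed
    ultimately show ?thesis by simp
  qed
  have "\<phi> t \<le> \<phi> 0"
  proof (rule DERIV_nonpos_imp_decreasing_open[of 0 t \<phi>])
    show "0 \<le> t" using t by simp
    show "continuous_on {0..t} \<phi>"
      using t by (intro continuous_on_subset[OF DERIV_continuous_on[OF d]]) auto
    fix s assume s: "0 < s" "s < t"
    then have "at s within {0..T} = at s" using t by (intro at_within_interior) auto
    then show "\<exists>y. (\<phi> has_real_derivative y) (at s) \<and> y \<le> 0"
      using d[of s] neg[of s] s t by auto
  qed
  then have "exp (- c * t) * (norm (x t))\<^sup>2 \<le> (norm (x 0))\<^sup>2 + \<epsilon>\<^sup>2 * t"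
    by (simp add: \<phi>_def dot_square_norm)
  also have "\<dots> \<le> (norm (x 0))\<^sup>2 + \<epsilon>\<^sup>2 * T" using t by (simp add: mult_left_mono)
  finally have "exp (c * t) * (exp (- c * t) * (norm (x t))\<^sup>2)
      \<le> exp (c * t) * ((norm (x 0))\<^sup>2 + \<epsilon>\<^sup>2 * T)"
    by (intro mult_left_mono) auto
  also have "\<dots> \<le> exp (c * T) * ((norm (x 0))\<^sup>2 + \<epsilon>\<^sup>2 * T)"
    using t K by (intro mult_right_mono) (auto simp: c_def mult_left_mono)
  finally show ?thesis
    by (simp add: mult.assoc[symmetric] exp_add[symmetric]) (simp add: c_def mult.commute)
qed

lemma linear_ode_unique:
  fixes pr :: "'b::real_normed_vector \<Rightarrow> 'a::real_inner \<Rightarrow> 'a"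
      and X :: "real \<Rightarrow> 'b"
  assumes pr: "bounded_bilinear pr" and X: "continuous_on {0..T} X"
    and x: "\<And>t. t \<in> {0..T} \<Longrightarrow> (x has_vector_derivative pr (X t) (x t))
        (at t within {0..T})"
    and y: "\<And>t. t \<in> {0..T} \<Longrightarrow> (y has_vector_derivative pr (X t) (y t))
        (at t within {0..T})"
    and "x 0 = y 0" "t \<in> {0..T}"
  shows "x t = y t"
proof -
  interpret bounded_bilinear pr by (rule pr)
  obtain K where K: "K > 0" "\<And>t b. t \<in> {0..T} \<Longrightarrow> norm (pr (X t) b) \<le> K * norm b"
    using bounded_bilinear_path_bound[OF pr X] by blast
  have "(norm (x t - y t))\<^sup>2 \<le> ((norm (x 0 - y 0))\<^sup>2 + 0\<^sup>2 * T) * exp ((2 * K + 1) * T)"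
  proof (rule gronwall_square)
    show "((\<lambda>t. x t - y t) has_vector_derivative pr (X t) (x t - y t)) (at t within {0..T})"
      if "t \<in> {0..T}" for t
      using has_vector_derivative_diff[OF x[OF that] y[OF that]] by (simp add: diff_right)
    show "norm (pr (X t) (x t - y t)) \<le> K * norm (x t - y t) + 0" if "t \<in> {0..T}" for t
      using K(2)[OF that] by simp
  qed (use assms K in auto)
  then show ?thesis using assms by simp
qed

text \<open>The difference of two solutions solves the same equation up to the defect
  \<open>pr (X q t - X p t) (y p t)\<close>, which is uniformly small in t because the time interval
  is compact; \<open>gronwall_square\<close> turns this into uniform closeness of the
  solutions.\<close>

lemma linear_ode_continuous_param:
  fixes pr :: "'b::real_normed_vector \<Rightarrow> 'a::real_inner \<Rightarrow> 'a"
    and X :: "'p::topological_space \<Rightarrow> real \<Rightarrow> 'b"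
  assumes pr: "bounded_bilinear pr" and X: "continuous_on (U \<times> {0..T}) (\<lambda>(p, t). X p t)"
    and y: "\<And>p t. p \<in> U \<Longrightarrow> t \<in> {0..T} \<Longrightarrow>
        (y p has_vector_derivative pr (X p t) (y p t)) (at t within {0..T})"
    and y0: "\<And>p. p \<in> U \<Longrightarrow> y p 0 = y0"
  shows "continuous_on (U \<times> {0..T}) (\<lambda>(p, t). y p t)"
proof (cases "T \<ge> 0")
  case True
  interpret bounded_bilinear pr by (rule pr)
  obtain C where C: "C > 0" "\<And>a b. norm (pr a b) \<le> norm a * norm b * C"
    using pos_bounded by blast
  have yc: "continuous_on {0..T} (y p)" if "p \<in> U" for p
    using has_vector_derivative_continuous[OF y[OF that]]
    by (auto simp: continuous_on_eq_continuous_within)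
  have Xc: "continuous_on {0..T} (X p)" if "p \<in> U" for p
  proof -
    have "continuous_on {0..T} (\<lambda>t. (\<lambda>(p, t). X p t) (p, t))"
      by (rule continuous_on_compose2[OF X], rule continuous_on_Pair[OF continuous_on_const continuous_on_id])
         (use that in auto)
    then show ?thesis by simp
  qed
  have unif: "\<forall>\<^sub>F q in at p within U. \<forall>t\<in>{0..T}. norm (y q t - y p t) < e"
    if p: "p \<in> U" and e: "e > 0" for p e
  proof -
    obtain KX where KX: "KX > 0" "\<And>t. t \<in> {0..T} \<Longrightarrow> norm (X p t) \<le> KX"
      using compact_imp_bounded[OF compact_continuous_image[OF Xc[OF p] compact_Icc]]
      by (metis bounded_pos imageI)
    obtain Ky where Ky: "Ky > 0" "\<And>t. t \<in> {0..T} \<Longrightarrow> norm (y p t) \<le> Ky"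
      using compact_imp_bounded[OF compact_continuous_image[OF yc[OF p] compact_Icc]]
      by (metis bounded_pos imageI)
    define K where "K = (KX + 1) * C"
    define E where "E = exp ((2 * K + 1) * T)"
    \<comment> \<open>The minimum with 1 bounds the norm of \<open>X q\<close> by
      \<open>KX + 1\<close> independently of q; the other entry makes the final bound e / 2.\<close>
    define d where "d = min 1 (e / (2 * (Ky * C) * sqrt ((T + 1) * E)))"
    have E: "E > 0" by (simp add: E_def)
    have K0: "K \<ge> 0" using KX C by (simp add: K_def)
    have d: "d > 0" using e E Ky C True by (auto simp: d_def)
    obtain X0 where X0: "p \<in> X0" "open X0"
      "\<forall>q\<in>X0 \<inter> U. \<forall>t \<in> {0..T}. dist (X q t) (X p t) \<le> d"
      using continuous_on_prod_compactE[OF X compact_Icc p d] by auto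
    have "\<forall>\<^sub>F q in at p within U. q \<in> X0 \<inter> U"
      using X0 eventually_at_topological by blast
    then show ?thesis
    proof eventually_elim
      case (elim q)
      have XX: "norm (X q t - X p t) \<le> d" if "t \<in> {0..T}" for t
        using X0(3) elim that by (auto simp: dist_norm)
      show ?case
      proof
        fix t assume t: "t \<in> {0..T}"
        have "(norm (y q t - y p t))\<^sup>2 \<le> ((norm (y q 0 - y p 0))\<^sup>2
            + (d * Ky * C)\<^sup>2 * T) * exp ((2 * K + 1) * T)"
        proof (rule gronwall_square[OF _ _ K0 t])
          fix t assume t: "t \<in> {0..T}"
          show "((\<lambda>t. y q t - y p t) has_vector_derivative
              pr (X q t) (y q t - y p t) + pr (X q t - X p t) (y p t)) (at t within {0..T})"
            using has_vector_derivative_diff[OF y[of q, OF _ t] y[OF p t]] elim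
            by (simp add: diff_right diff_left)
          have "norm (X q t) \<le> KX + 1"
            using norm_triangle_sub[of "X q t" "X p t"] XX[OF t] KX(2)[OF t] by (simp add: d_def)
          then have "norm (X q t) * norm (y q t - y p t) * C \<le> (KX + 1) * norm (y q t - y p t) * C"
            using C by (intro mult_right_mono) auto
          then have 1: "norm (pr (X q t) (y q t - y p t)) \<le> K * norm (y q t - y p t)"
            using C(2)[of "X q t" "y q t - y p t"] by (simp add: K_def mult_ac)
          have "norm (X q t - X p t) * norm (y p t) * C \<le> d * Ky * C"
            using XX[OF t] Ky(2)[OF t] C d by (intro mult_right_mono mult_mono) auto
          then have 2: "norm (pr (X q t - X p t) (y p t)) \<le> d * Ky * C"
            using C(2)[of "X q t - X p t" "y p t"] by simp
          show "norm (pr (X q t) (y q t - y p t) + pr (X q t - X p t) (y p t))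
              \<le> K * norm (y q t - y p t) + d * Ky * C"
            using norm_triangle_le[OF add_mono[OF 1 2]] .
        qed
        also have "\<dots> = (d * Ky * C)\<^sup>2 * T * E" using y0 p elim by (simp add: E_def)
        also have "\<dots> \<le> (d * Ky * C)\<^sup>2 * ((T + 1) * E)"
          unfolding mult.assoc using True E by (intro mult_left_mono mult_right_mono) auto
        also have "\<dots> = (d * (Ky * C) * sqrt ((T + 1) * E))\<^sup>2"
          using True E by (simp add: power_mult_distrib)
        finally have "norm (y q t - y p t) \<le> d * (Ky * C) * sqrt ((T + 1) * E)"
          using d Ky C True E by (auto intro: power2_le_imp_le)
        also have "\<dots> \<le> e / (2 * (Ky * C) * sqrt ((T + 1) * E)) * (Ky * C) * sqrt ((T + 1) * E)"
          using Ky C True E by (intro mult_right_mono) (auto simp: d_def)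
        also have "\<dots> = e / 2"
          using Ky C True mult_pos_pos[of "T + 1" E] E by simp
        finally show "norm (y q t - y p t) < e" using e by simp
      qed
    qed
  qed
  show ?thesis
    unfolding continuous_on_def split_beta
  proof
    fix x assume "x \<in> U \<times> {0..T}"
    then obtain p t where x: "x = (p, t)" "p \<in> U" "t \<in> {0..T}" by auto
    have "((\<lambda>q. y (fst q) (snd q) - y p (snd q)) \<longlongrightarrow> 0)
        (at x within U \<times> {0..T})"
    proof (rule tendstoI)
      fix e :: real assume e: "e > 0"
      obtain S where S: "open S" "p \<in> S" "\<forall>q\<in>S. q \<noteq> p \<longrightarrow> q \<in> U
          \<longrightarrow> (\<forall>t\<in>{0..T}. norm (y q t - y p t) < e)"
        using unif[OF x(2) e] unfolding eventually_at_topological by blast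
      have "\<forall>\<^sub>F q in at x within U \<times> {0..T}. q \<in> (S \<times> UNIV) \<inter> (U
          \<times> {0..T})"
        unfolding eventually_at_topological using S x
        by (intro exI[of _ "S \<times> UNIV"]) (auto intro: open_Times)
      then show "\<forall>\<^sub>F q in at x within U \<times> {0..T}. dist (y (fst q) (snd q)
          - y p (snd q)) 0 < e"
      proof eventually_elim
        case (elim q)
        show ?case using S(3) e elim by (cases "fst q = p") auto
      qed
    qed
    moreover have "((\<lambda>q. y p (snd q)) \<longlongrightarrow> y p t) (at x within U \<times> {0..T})"
      using continuous_on_compose2[OF yc[OF x(2)] continuous_on_snd[OF continuous_on_id], of "U \<times>
          {0..T}"] x
      unfolding continuous_on_def by force
    ultimately have "((\<lambda>q. (y (fst q) (snd q) - y p (snd q))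
        + y p (snd q)) \<longlongrightarrow> 0 + y p t) (at x within U \<times> {0..T})"
      by (rule tendsto_add)
    then show "((\<lambda>p. y (fst p) (snd p)) \<longlongrightarrow> y (fst x) (snd x))
        (at x within U \<times> {0..T})"
      by (simp add: x)
  qed
qed simp

section \<open>The fundamental solutions\<close>

lemma continuous_on_slice:
  assumes "continuous_on (U \<times> C) f" "p \<in> U" "S \<subseteq> C"
  shows "continuous_on S (\<lambda>t. f (p, t))"
  by (rule continuous_on_compose2[OF assms(1)], rule continuous_on_Pair[OF continuous_on_const
      continuous_on_id])
     (use assms in auto)

lemma matrix_add_rdistrib: "(A + C) ** B = A ** B + C ** (B :: 'a::semiring_1 ^ 'n ^ 'm)"
  by (simp add: vec_eq_iff matrix_matrix_mult_def sum.distrib distrib_right)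

lemma bounded_bilinear_matrix_matrix_mult:
  "bounded_bilinear ((**) :: real ^ 'n ^ 'm \<Rightarrow> real ^ 'p ^ 'n \<Rightarrow> real ^ 'p ^ 'm)"
proof -
  have "bilinear ((**) :: real ^ 'n ^ 'm \<Rightarrow> real ^ 'p ^ 'n \<Rightarrow> real ^ 'p ^ 'm)"
    unfolding bilinear_def
    by (auto intro!: linearI simp: matrix_add_ldistrib matrix_add_rdistrib scalar_matrix_assoc matrix_scalar_ac)
  then show ?thesis by (simp add: bilinear_conv_bounded_bilinear)
qed

lemma bounded_linear_transpose: "bounded_linear (transpose :: real ^ 'n ^ 'm \<Rightarrow> real ^ 'm ^ 'n)"
  by (intro linear_linear[THEN iffD2] linearI) (auto simp: transpose_def vec_eq_iff)

lemmas has_vector_derivative_matrix_mult [derivative_intros] =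
  bounded_bilinear.has_vector_derivative[OF bounded_bilinear_matrix_matrix_mult]

lemmas continuous_on_matrix_mult =
  bounded_bilinear.continuous_on[OF bounded_bilinear_matrix_matrix_mult]

lemma vector_4_eq_lambda:
  "(vector [w, x, y, z] :: 'a::zero ^ 4) = (\<chi> i. if i = 1 then w else if i = 2 then x else if i
      = 3 then y else z)"
  by (simp add: vec_eq_iff forall_4)

lemma continuous_on_vector_4:
  fixes w x y z :: "'b::topological_space \<Rightarrow> 'a::{zero, topological_space}"
  assumes "continuous_on S w" "continuous_on S x" "continuous_on S y" "continuous_on S z"
  shows "continuous_on S (\<lambda>p. vector [w p, x p, y p, z p] :: 'a ^ 4)"
  unfolding vector_4_eq_lambda
proof (rule continuous_on_vec_lambda)
  fix i :: 4
  show "continuous_on S (\<lambda>p. if i = 1 then w p else if i = 2 then x p else if i = 3 then y p else z p)"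
    using assms by (cases "i = 1"; cases "i = 2"; cases "i = 3") auto
qed

lemma one_plus_e_cos_pos:
  fixes e t :: real
  assumes "e \<in> {-1<..<1}"
  shows "1 + e * cos t > 0"
proof -
  have "\<bar>e * cos t\<bar> \<le> \<bar>e\<bar> * 1" unfolding abs_mult by (intro mult_left_mono) auto
  then show ?thesis using assms by auto
qed

abbreviation (input) params :: "(real \<times> real) set" where "params \<equiv> {0..9} \<times> {-1<..<1}"

lemma continuous_on_Bmat:
  "continuous_on (params \<times> {0..2 * pi}) (\<lambda>(p, t). Jmat ** Bmat (fst p) (snd p) t)"
proof -
  have nz: "\<forall>x\<in>params \<times> {0..2 * pi}. 2 * (1 + snd (fst x) * cos (snd x)) \<noteq> 0"
  proof
    fix x assume "x \<in> params \<times> {0..2 * pi}"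
    then show "2 * (1 + snd (fst x) * cos (snd x)) \<noteq> 0"
      using one_plus_e_cos_pos[of "snd (fst x)" "snd x"] by (auto simp: mem_Times_iff)
  qed
  have "continuous_on (params \<times> {0..2 * pi})
      (\<lambda>p. (2 * snd (fst p) * cos (snd p) - 1 - sqrt (9 - fst (fst p))) / (2 * (1
          + snd (fst p) * cos (snd p))))"
    "continuous_on (params \<times> {0..2 * pi})
      (\<lambda>p. (2 * snd (fst p) * cos (snd p) - 1 + sqrt (9 - fst (fst p))) / (2 * (1
          + snd (fst p) * cos (snd p))))"
    by (rule continuous_on_divide[OF _ _ nz]; intro continuous_intros)+
  then show ?thesis
    unfolding Bmat_def split_beta
    by (intro continuous_on_matrix_mult continuous_on_vector_4 continuous_on_const)
qed

lemma Jmat_sq: "Jmat ** Jmat = - mat 1"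
  by (simp add: vec_eq_iff forall_4 Jmat_def matrix_matrix_mult_def sum_4 mat_def)

lemma transpose_Jmat: "transpose Jmat = - Jmat"
  by (simp add: vec_eq_iff forall_4 Jmat_def transpose_def)

lemma transpose_Bmat: "transpose (Bmat \<beta> e t) = Bmat \<beta> e t"
  by (simp add: vec_eq_iff forall_4 Bmat_def transpose_def)

lemma matrix_minus_left: "(- A) ** B = - (A ** (B :: 'a::ring_1 ^ 'n ^ 'm))"
  by (simp add: vec_eq_iff matrix_matrix_mult_def sum_negf)

lemma matrix_minus_right: "A ** (- B) = - (A ** (B :: 'a::ring_1 ^ 'n ^ 'm))"
  by (simp add: vec_eq_iff matrix_matrix_mult_def sum_negf)

lemma matrix_diff_left: "(A - C) ** B = A ** B - C ** (B :: 'a::ring_1 ^ 'n ^ 'm)"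
  by (simp add: vec_eq_iff matrix_matrix_mult_def sum_subtractf left_diff_distrib)

lemma matrix_diff_right: "A ** (B - C) = A ** B - A ** (C :: 'a::ring_1 ^ 'n ^ 'm)"
  by (simp add: vec_eq_iff matrix_matrix_mult_def sum_subtractf right_diff_distrib)

text \<open>J^2 = -1 and the symmetry of B leave only the difference of the two coefficient
  matrices. For equal parameters the product is conserved, which makes the flow symplectic; for two
  values of \<beta> it is the exact variation formula behind \<open>gamma_end_diff\<close>.\<close>

lemma symplectic_product_deriv:
  fixes Y Z :: "real \<Rightarrow> real ^ 4 ^ 4"
  assumes Y: "(Y has_vector_derivative Jmat ** Bmat \<beta> e t ** Y t) (at t within S)"
    and Z: "(Z has_vector_derivative Jmat ** Bmat \<beta>' e' t ** Z t) (at t within S)"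
  shows "((\<lambda>t. transpose (Y t) ** Jmat ** Z t) has_vector_derivative
     transpose (Y t) ** (Bmat \<beta> e t - Bmat \<beta>' e' t) ** Z t) (at t within S)"
proof -
  have T: "((\<lambda>t. transpose (Y t)) has_vector_derivative transpose (Jmat ** Bmat \<beta> e t ** Y
      t)) (at t within S)"
    by (rule bounded_linear.has_vector_derivative[OF bounded_linear_transpose Y])
  have JJ: "Jmat ** (Jmat ** A) = - A" for A :: "real ^ 4 ^ 4"
    by (simp add: matrix_mul_assoc Jmat_sq matrix_minus_left)
  have "((\<lambda>t. transpose (Y t) ** (Jmat ** Z t)) has_vector_derivative
     transpose (Y t) ** (Jmat ** (Jmat ** Bmat \<beta>' e' t ** Z t) + 0 ** Z t) +
     transpose (Jmat ** Bmat \<beta> e t ** Y t) ** (Jmat ** Z t)) (at t within S)"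
    by (intro derivative_intros T Z)
  then show ?thesis
    by (simp add: matrix_transpose_mul transpose_Jmat transpose_Bmat matrix_mul_assoc[symmetric] JJ
        matrix_minus_left matrix_minus_right matrix_diff_left matrix_diff_right)
qed

lemma invertible_if_symplectic:
  assumes "transpose M ** Jmat ** M = Jmat"
  shows "invertible M"
proof -
  have "(- (Jmat ** (transpose M ** Jmat))) ** M = mat 1"
    using assms by (simp add: matrix_minus_left matrix_mul_assoc[symmetric] Jmat_sq)
  then show ?thesis by (auto simp: invertible_left_inverse)
qed

lemma invertible_Jmat: "invertible Jmat"
  by (rule invertible_if_symplectic) (simp add: transpose_Jmat Jmat_sq matrix_minus_left)

lemma is_fundamental_solution_exists:
  assumes "\<beta> \<in> {0..9}" "e \<in> {-1<..<1}"
  shows "\<exists>g. is_fundamental_solution \<beta> e g"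
proof -
  have X: "continuous_on {0..2 * pi} (\<lambda>t. Jmat ** Bmat \<beta> e t)"
    using continuous_on_slice[OF continuous_on_Bmat, of "(\<beta>, e)" "{0..2 * pi}"] assms by simp
  obtain g where g: "g 0 = mat 1"
    "\<And>t. t \<in> {0..2 * pi} \<Longrightarrow> (g
        has_vector_derivative Jmat ** Bmat \<beta> e t ** g t) (at t within {0..2 * pi})"
    using linear_ode_exists[OF bounded_bilinear_matrix_matrix_mult X] by blast
  have "transpose (g t) ** Jmat ** g t = Jmat" if t: "t \<in> {0..2 * pi}" for t
  proof -
    have "((\<lambda>t. transpose (g t) ** Jmat ** g t) has_derivative (\<lambda>h. 0))
        (at s within {0..2 * pi})"
      if "s \<in> {0..2 * pi}" for s
      using symplectic_product_deriv[OF g(2) g(2), OF that that] by (simp add: has_vector_derivative_def)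
    then obtain c where "\<And>t. t \<in> {0..2 * pi} \<Longrightarrow> transpose (g t) ** Jmat ** g t = c"
      using has_derivative_zero_constant[of "{0..2 * pi}" "\<lambda>t. transpose (g t) ** Jmat ** g t"] by auto
    from this[of t] this[of 0] show ?thesis using t g(1) by (simp add: transpose_mat)
  qed
  then have "is_fundamental_solution \<beta> e g"
    unfolding is_fundamental_solution_def Sp4_def using g invertible_if_symplectic by auto
  then show ?thesis by blast
qed

context
  fixes \<beta> e :: real
  assumes \<beta>: "\<beta> \<in> {0..9}" and e: "e \<in> {-1<..<1}"
begin

lemma is_fundamental_solution_gamma: "is_fundamental_solution \<beta> e (gamma \<beta> e)"
  unfolding gamma_def using is_fundamental_solution_exists[OF \<beta> e] by (rule someI_ex)

lemma gamma_0: "gamma \<beta> e 0 = mat 1"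
  using is_fundamental_solution_gamma by (simp add: is_fundamental_solution_def)

lemma gamma_deriv:
  "t \<in> {0..2 * pi} \<Longrightarrow>
    (gamma \<beta> e has_vector_derivative Jmat ** Bmat \<beta> e t ** gamma \<beta> e t)
        (at t within {0..2 * pi})"
  using is_fundamental_solution_gamma by (simp add: is_fundamental_solution_def)

lemma continuous_on_gamma_time:
  "continuous_on {0..2 * pi} (gamma \<beta> e)"
  using has_vector_derivative_continuous[OF gamma_deriv] by (auto simp: continuous_on_eq_continuous_within)

lemma gamma_symplectic:
  "t \<in> {0..2 * pi} \<Longrightarrow> transpose (gamma \<beta> e t) ** Jmat ** gamma \<beta> e t = Jmat"
  using is_fundamental_solution_gamma by (auto simp: is_fundamental_solution_def Sp4_def)

lemma gamma_invertible: "t \<in> {0..2 * pi} \<Longrightarrow> invertible (gamma \<beta> e t)"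
  using gamma_symplectic invertible_if_symplectic by blast

lemma continuous_on_JB: "S \<subseteq> {0..2 * pi} \<Longrightarrow> continuous_on S (\<lambda>t. Jmat **
    Bmat \<beta> e t)"
  using continuous_on_slice[OF continuous_on_Bmat, of "(\<beta>, e)" S] \<beta> e by simp

end

lemma continuous_on_gamma:
  "continuous_on (params \<times> {0..2 * pi}) (\<lambda>(p, t). gamma (fst p) (snd p) t)"
proof (rule linear_ode_continuous_param[where pr = "(**)" and X = "\<lambda>p t. Jmat ** Bmat (fst p) (snd p) t"
      and y = "\<lambda>p. gamma (fst p) (snd p)" and ?y0.0 = "mat 1"])
  show "bounded_bilinear ((**) :: real ^ 4 ^ 4 \<Rightarrow> real ^ 4 ^ 4 \<Rightarrow> real ^ 4 ^ 4)"
    by (rule bounded_bilinear_matrix_matrix_mult)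
  show "continuous_on (params \<times> {0..2 * pi}) (\<lambda>(p, t). Jmat ** Bmat (fst p) (snd p) t)"
    by (rule continuous_on_Bmat)
  fix p :: "real \<times> real" assume "p \<in> params"
  then have p: "fst p \<in> {0..9}" "snd p \<in> {-1<..<1}" by auto
  show "gamma (fst p) (snd p) 0 = mat 1" by (rule gamma_0[OF p])
  show "(gamma (fst p) (snd p) has_vector_derivative
      Jmat ** Bmat (fst p) (snd p) t ** gamma (fst p) (snd p) t) (at t within {0..2 * pi})"
    if "t \<in> {0..2 * pi}" for t
    by (rule gamma_deriv[OF p that])
qed

section \<open>The symmetry \<open>e \<mapsto> -e\<close>\<close>

lemma Bmat_minus: "Bmat \<beta> (- e) t = Bmat \<beta> e (t + pi)"
  by (simp add: Bmat_def)

text \<open>On the second half period the shifted solution \<open>gamma \<beta> e (t + pi)\<close>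
  obeys the equation for -e with the initial value \<open>gamma \<beta> e pi\<close>, so uniqueness
  identifies it with the product.\<close>

lemma gamma_half_period:
  assumes \<beta>: "\<beta> \<in> {0..9}" and e: "e \<in> {-1<..<1}"
  shows "gamma \<beta> e (2 * pi) = gamma \<beta> (- e) pi ** gamma \<beta> e pi"
proof -
  have e': "- e \<in> {-1<..<1}" using e by auto
  have "gamma \<beta> e (pi + pi) = gamma \<beta> (- e) pi ** gamma \<beta> e pi"
  proof (rule linear_ode_unique[OF bounded_bilinear_matrix_matrix_mult,
        where X = "\<lambda>t. Jmat ** Bmat \<beta> (- e) t" and T = pi and t = pi
          and x = "\<lambda>t. gamma \<beta> e (t + pi)" and y
              = "\<lambda>t. gamma \<beta> (- e) t ** gamma \<beta> e pi"])
    show "continuous_on {0..pi} (\<lambda>t. Jmat ** Bmat \<beta> (- e) t)"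
      by (rule continuous_on_JB[OF \<beta> e']) auto
    show "gamma \<beta> e (0 + pi) = gamma \<beta> (- e) 0 ** gamma \<beta> e pi"
      using gamma_0[OF \<beta> e'] by simp
    fix t assume t: "t \<in> {0..pi}"
    have "((gamma \<beta> e \<circ> (\<lambda>t. t + pi)) has_vector_derivative
        1 *\<^sub>R (Jmat ** Bmat \<beta> e (t + pi) ** gamma \<beta> e (t + pi))) (at t within {0..pi})"
    proof (rule vector_diff_chain_within)
      show "((\<lambda>t. t + pi) has_vector_derivative 1) (at t within {0..pi})"
        by (auto intro!: derivative_eq_intros)
      show "(gamma \<beta> e has_vector_derivative Jmat ** Bmat \<beta> e (t + pi) ** gamma \<beta> e (t + pi))
          (at (t + pi) within (\<lambda>t. t + pi) ` {0..pi})"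
        using t by (intro has_vector_derivative_within_subset[OF gamma_deriv[OF \<beta> e]]) auto
    qed
    then show "((\<lambda>t. gamma \<beta> e (t + pi)) has_vector_derivative
        Jmat ** Bmat \<beta> (- e) t ** gamma \<beta> e (t + pi)) (at t within {0..pi})"
      by (simp add: Bmat_minus o_def)
    have "(gamma \<beta> (- e) has_vector_derivative Jmat ** Bmat \<beta> (- e) t ** gamma \<beta> (- e)
        t) (at t within {0..pi})"
      using t by (intro has_vector_derivative_within_subset[OF gamma_deriv[OF \<beta> e']]) auto
    from has_vector_derivative_matrix_mult[OF this has_vector_derivative_const]
    show "((\<lambda>t. gamma \<beta> (- e) t ** gamma \<beta> e pi) has_vector_derivative
        Jmat ** Bmat \<beta> (- e) t ** (gamma \<beta> (- e) t ** gamma \<beta> e pi)) (at t within {0..pi})"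
      by (simp add: matrix_mul_assoc)
  qed auto
  then show ?thesis by simp
qed

section \<open>Complexified matrices and geometric multiplicities\<close>

lemma complex_matrix_mult:
  "complex_matrix (A ** B) = complex_matrix A ** complex_matrix (B :: real ^ 'n ^ 'n)"
  by (simp add: vec_eq_iff matrix_matrix_mult_def)

lemma complex_matrix_mat: "complex_matrix (mat r :: real ^ 'n ^ 'n) = mat (complex_of_real r)"
  by (simp add: vec_eq_iff mat_def)

lemma invertible_complex_matrix:
  assumes "invertible (A :: real ^ 'n ^ 'n)"
  shows "invertible (complex_matrix A)"
proof -
  obtain B where "A ** B = mat 1" "B ** A = mat 1" using assms by (auto simp: invertible_def)
  then have "complex_matrix A ** complex_matrix B = mat 1" "complex_matrix B ** complex_matrix A = mat 1"
    by (simp_all flip: complex_matrix_mult add: complex_matrix_mat)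
  then show ?thesis by (auto simp: invertible_def)
qed

lemma mat_mult_vec: "mat \<mu> *v v = \<mu> *s (v :: 'a::comm_semiring_1 ^ 'n)"
  by (simp add: vec_eq_iff matrix_vector_mult_def mat_def if_distrib if_distribR sum.delta' cong: if_cong)

lemma eigenspace_eq:
  "{v :: complex ^ 'n. (complex_matrix M - mat \<mu>) *v v = 0} = {v. complex_matrix M *v v = \<mu> *s v}"
  by (simp add: matrix_vector_mult_diff_rdistrib mat_mult_vec)

lemma mem_cspectrum_iff_eigen_dim: "\<mu> \<in> cspectrum M \<longleftrightarrow> eigen_dim M \<mu> \<noteq> 0"
  unfolding eigen_dim_def eigenspace_eq cspectrum_def by auto

lemma mem_cspectrum_iff_det: "\<mu> \<in> cspectrum M
    \<longleftrightarrow> det (complex_matrix M - mat \<mu>) = 0"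
proof -
  have "det (complex_matrix M - mat \<mu>) \<noteq> 0
      \<longleftrightarrow> inj ((*v) (complex_matrix M - mat \<mu>))"
    using det_nz_iff_inj_gen[OF matrix_vector_mul_linear_gen[of "complex_matrix M - mat \<mu>"]] by simp
  also have "\<dots> \<longleftrightarrow> (\<forall>v. (complex_matrix M - mat \<mu>) *v v
      = 0 \<longrightarrow> v = 0)"
    by (metis vec.inj_iff_eq_0 matrix_vector_mul_linear_gen)
  finally show ?thesis
    by (auto simp: cspectrum_def matrix_vector_mult_diff_rdistrib mat_mult_vec)
qed

text \<open>\<open>A\<close> maps the eigenspace of \<open>B ** A\<close> bijectively onto that of
  \<open>A ** B\<close>. Dimensions are compared, and not only spectra, because the degeneracy
  curves are counted with the dimension of the kernel.\<close>

lemma eigen_dim_commute: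
  assumes A: "invertible (A :: real ^ 'n ^ 'n)"
  shows "eigen_dim (A ** B) \<mu> = eigen_dim (B ** A) \<mu>"
proof -
  let ?A = "complex_matrix A" and ?B = "complex_matrix B"
  obtain C where C: "?A ** C = mat 1" "C ** ?A = mat 1"
    using invertible_complex_matrix[OF A] by (auto simp: invertible_def)
  have CA: "C *v (?A *v v) = v" and AC: "?A *v (C *v v) = v" for v
    by (simp_all add: matrix_vector_mul_assoc C)
  have "{v. complex_matrix (A ** B) *v v = \<mu> *s v} = (*v) ?A ` {v. complex_matrix (B ** A) *v v
      = \<mu> *s v}"
  proof (intro equalityI subsetI)
    fix v assume "v \<in> {v. complex_matrix (A ** B) *v v = \<mu> *s v}"
    then have v: "?A *v (?B *v v) = \<mu> *s v"
      by (simp add: complex_matrix_mult matrix_vector_mul_assoc)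
    have "?B *v (?A *v (C *v v)) = C *v (\<mu> *s v)"
      unfolding AC v[symmetric] CA ..
    then have "C *v v \<in> {v. complex_matrix (B ** A) *v v = \<mu> *s v}"
      by (simp add: complex_matrix_mult matrix_vector_mul_assoc[symmetric] vec.scale)
    then have "?A *v (C *v v) \<in> (*v) ?A ` {v. complex_matrix (B ** A) *v v = \<mu> *s v}"
      by (rule imageI)
    then show "v \<in> (*v) ?A ` {v. complex_matrix (B ** A) *v v = \<mu> *s v}"
      unfolding AC .
  next
    fix v assume "v \<in> (*v) ?A ` {v. complex_matrix (B ** A) *v v = \<mu> *s v}"
    then obtain w where w: "v = ?A *v w" "?B *v (?A *v w) = \<mu> *s w"
      by (auto simp: complex_matrix_mult matrix_vector_mul_assoc)
    then show "v \<in> {v. complex_matrix (A ** B) *v v = \<mu> *s v}"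
      by (simp add: complex_matrix_mult matrix_vector_mul_assoc[symmetric] vec.scale)
  qed
  moreover have "inj_on ((*v) ?A) S" for S
    by (rule inj_on_inverseI[where g = "(*v) C"]) (rule CA)
  ultimately show ?thesis
    unfolding eigen_dim_def eigenspace_eq
    by (simp add: vec.dim_image_eq[OF matrix_vector_mul_linear_gen])
qed

lemma eigen_dim_gamma_minus:
  assumes "\<beta> \<in> {0..9}" "e \<in> {-1<..<1}"
  shows "eigen_dim (gamma \<beta> (- e) (2 * pi)) \<mu> = eigen_dim (gamma \<beta> e (2 * pi)) \<mu>"
proof -
  have e': "- e \<in> {-1<..<1}" using assms by auto
  show ?thesis
    unfolding gamma_half_period[OF assms] gamma_half_period[OF assms(1) e'] minus_minus
    by (intro eigen_dim_commute gamma_invertible assms) auto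
qed

lemma cspectrum_gamma_minus:
  assumes "\<beta> \<in> {0..9}" "e \<in> {-1<..<1}"
  shows "cspectrum (gamma \<beta> (- e) (2 * pi)) = cspectrum (gamma \<beta> e (2 * pi))"
  using eigen_dim_gamma_minus[OF assms] by (auto simp: mem_cspectrum_iff_eigen_dim)

lemma beta_k_even:
  assumes "e \<in> {-1<..<1}"
  shows "beta_k (- e) = beta_k e"
  unfolding beta_k_def
proof -
  have "cspectrum (gamma \<beta> (- e) (2 * pi)) = cspectrum (gamma \<beta> e (2 * pi))"
    if "\<beta>' \<in> {0..9}" "\<beta> \<in> {0..\<beta>'}" for \<beta>' \<beta>
    using that by (intro cspectrum_gamma_minus assms) auto
  then have "{\<beta>'\<in>{0..9}. \<forall>\<beta>\<in>{0..\<beta>'}. cspectrum (gamma \<beta> (- e) (2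
      * pi)) \<inter> sphere 0 1 \<noteq> {}} =
      {\<beta>'\<in>{0..9}. \<forall>\<beta>\<in>{0..\<beta>'}. cspectrum (gamma \<beta> e (2 * pi))
          \<inter> sphere 0 1 \<noteq> {}}"
    by (intro Collect_cong conj_cong ball_cong refl) simp
  then show "Sup {\<beta>'\<in>{0..9}. \<forall>\<beta>\<in>{0..\<beta>'}. cspectrum (gamma \<beta> (- e)
      (2 * pi)) \<inter> sphere 0 1 \<noteq> {}} =
      Sup {\<beta>'\<in>{0..9}. \<forall>\<beta>\<in>{0..\<beta>'}. cspectrum (gamma \<beta> e (2 * pi))
          \<inter> sphere 0 1 \<noteq> {}}"
    by (rule arg_cong)
qed

section \<open>Real analytic functions\<close>

text \<open>Dividing by h^n with n the \<open>subdegree\<close> of F leaves a function that is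
  continuous with a nonzero value at 0, so zeros cannot accumulate at x.\<close>

lemma has_fps_expansion_nonzero_isolated:
  fixes f :: "real \<Rightarrow> real"
  assumes F: "(\<lambda>h. f (x + h)) has_fps_expansion F" and "F \<noteq> 0"
  shows "\<forall>\<^sub>F y in at x. f y \<noteq> 0"
proof -
  define n where "n = subdegree F"
  define g where "g = (\<lambda>h. if h = 0 then fps_nth F n else f (x + h) / h ^ n)"
  have "g has_fps_expansion fps_shift n F"
    unfolding g_def by (rule has_fps_expansion_shift[OF F]) (simp_all add: n_def)
  then have "isCont g 0" using has_fps_expansion_imp_continuous[of g _ UNIV] by simp
  then have "g \<midarrow>0\<rightarrow> fps_nth F n" by (simp add: isCont_def g_def)
  moreover have "fps_nth F n \<noteq> 0" using \<open>F \<noteq> 0\<close> by (simp add: n_def)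
  ultimately have "\<forall>\<^sub>F h in at 0. g h \<noteq> 0" by (rule tendsto_imp_eventually_ne)
  then have "\<forall>\<^sub>F h in at 0. f (x + h) \<noteq> 0"
    using eventually_neq_at_within[of 0] by eventually_elim (auto simp: g_def)
  then show ?thesis by (simp add: at_to_0[of x] eventually_filtermap add.commute)
qed

lemma real_analytic_on_isCont:
  assumes "real_analytic_on f S" "x \<in> S"
  shows "isCont f x"
proof -
  obtain F where "(\<lambda>h. f (x + h)) has_fps_expansion F"
    using assms by (auto simp: real_analytic_on_def)
  then have "isCont (\<lambda>h. f (x + h)) 0" by (rule has_fps_expansion_imp_continuous)
  then show ?thesis by (simp add: isCont_iff)
qed

lemma real_analytic_on_diff:
  assumes "real_analytic_on f S" "real_analytic_on g S"
  shows "real_analytic_on (\<lambda>x. f x - g x) S"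
  unfolding real_analytic_on_def
proof
  fix x assume "x \<in> S"
  then obtain F G where "(\<lambda>h. f (x + h)) has_fps_expansion F" "(\<lambda>h. g (x
      + h)) has_fps_expansion G"
    using assms unfolding real_analytic_on_def by blast
  from has_fps_expansion_diff[OF this]
  show "\<exists>F. (\<lambda>h. f (x + h) - g (x + h)) has_fps_expansion F" by blast
qed

lemma has_fps_expansion_mirror:
  fixes f :: "real \<Rightarrow> real"
  assumes "f has_fps_expansion F"
  shows "(\<lambda>h. f (- h)) has_fps_expansion Abs_fps (\<lambda>n. (- 1) ^ n * fps_nth F n)" (is "_
      has_fps_expansion ?G")
proof -
  have "conv_radius (\<lambda>n. (- 1) ^ n * fps_nth F n) = conv_radius (fps_nth F)"
    using conv_radius_norm[of "\<lambda>n. (- 1) ^ n * fps_nth F n"] conv_radius_norm[of "fps_nth F"]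
    by (simp add: abs_mult power_abs)
  then have r: "fps_conv_radius ?G = fps_conv_radius F"
    by (simp add: fps_conv_radius_def)
  have ev: "eval_fps ?G h = eval_fps F (- h)" for h
    unfolding eval_fps_def by (rule suminf_cong) (simp add: power_minus[of h] mult_ac)
  have "\<forall>\<^sub>F h in nhds 0. eval_fps F h = f h"
    using assms by (simp add: has_fps_expansion_def)
  moreover have "filterlim uminus (nhds 0) (nhds (0 :: real))"
    by (auto intro!: tendsto_eq_intros filterlim_ident)
  ultimately have "\<forall>\<^sub>F h in nhds 0. eval_fps F (- h) = f (- h)"
    by (rule eventually_compose_filterlim)
  then show ?thesis using assms by (simp add: has_fps_expansion_def r ev)
qed

lemma real_analytic_on_mirror:
  assumes "real_analytic_on f {-1<..<1}"
  shows "real_analytic_on (\<lambda>x. f (- x)) {-1<..<1}"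
  unfolding real_analytic_on_def
proof
  fix x :: real assume "x \<in> {-1<..<1}"
  then have "- x \<in> {-1<..<1}" by auto
  then obtain F where "(\<lambda>h. f (- x + h)) has_fps_expansion F"
    using assms unfolding real_analytic_on_def by blast
  from has_fps_expansion_mirror[OF this] show "\<exists>F. (\<lambda>h. f (- (x + h))) has_fps_expansion F"
    by auto
qed

text \<open>If f has no zero near x except possibly at x, then every other point nearby has a
  neighbourhood without zeros, obtained by removing x.\<close>

lemma open_punctured_nonzero: "open {x. \<forall>\<^sub>F y in at x. f y \<noteq> (0 :: real)}"
    for f :: "real \<Rightarrow> real"
proof (subst open_subopen, intro ballI)
  fix x assume "x \<in> {x. \<forall>\<^sub>F y in at x. f y \<noteq> 0}"
  then obtain S where S: "open S" "x \<in> S" "\<And>y. y \<in> S \<Longrightarrow> y \<noteq> x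
      \<Longrightarrow> f y \<noteq> 0"
    unfolding eventually_at_topological by blast
  have "\<forall>\<^sub>F z in at y. f z \<noteq> 0" if "y \<in> S" for y
  proof (cases "y = x")
    case True
    then show ?thesis using S unfolding eventually_at_topological by blast
  next
    case False
    then show ?thesis
      using S that open_delete[OF S(1), of x]
      unfolding eventually_at_topological by (intro exI[of _ "S - {x}"]) auto
  qed
  then show "\<exists>T. open T \<and> x \<in> T
      \<and> T \<subseteq> {x. \<forall>\<^sub>F y in at x. f y \<noteq> 0}"
    using S by blast
qed

text \<open>The interval is covered by two disjoint open sets, the interior of the zero set of f and
  the points where zeros of f do not accumulate, so one of them misses the interval. If it is the
  first, g vanishes off isolated points and by continuity everywhere. This turns a pointwise
  alternative between curves into a global one.\<close>

lemma real_analytic_on_mult_eq_0: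
  fixes f g :: "real \<Rightarrow> real"
  assumes f: "real_analytic_on f {a<..<b}" and g: "real_analytic_on g {a<..<b}"
    and fg: "\<And>x. x \<in> {a<..<b} \<Longrightarrow> f x * g x = 0"
  shows "(\<forall>x\<in>{a<..<b}. f x = 0) \<or> (\<forall>x\<in>{a<..<b}. g x = 0)"
proof -
  define U where "U = interior {x. f x = 0}"
  define V where "V = {x. \<forall>\<^sub>F y in at x. f y \<noteq> 0}"
  have UV: "{a<..<b} \<subseteq> U \<union> V"
  proof
    fix x assume "x \<in> {a<..<b}"
    then obtain F where F: "(\<lambda>h. f (x + h)) has_fps_expansion F"
      using f unfolding real_analytic_on_def by blast
    show "x \<in> U \<union> V"
    proof (cases "F = 0")
      case True
      then have "\<forall>\<^sub>F h in nhds 0. f (x + h) = 0" using F by (simp add: has_fps_expansion_def)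
      then have "\<forall>\<^sub>F h in filtermap (\<lambda>y. y - x) (nhds x). f (x + h) = 0"
        unfolding filtermap_nhds_shift by simp
      then have "\<forall>\<^sub>F y in nhds x. f y = 0" by (simp add: eventually_filtermap)
      then have "x \<in> U" unfolding U_def eventually_nhds by (auto simp: interior_def)
      then show ?thesis ..
    next
      case False
      then show ?thesis using has_fps_expansion_nonzero_isolated[OF F] by (simp add: V_def)
    qed
  qed
  have "U \<inter> V = {}"
  proof -
    have False if "x \<in> U" "x \<in> V" for x
    proof -
      have "\<forall>\<^sub>F y in at x. y \<in> U"
        using that(1) by (intro eventually_at_in_open') (auto simp: U_def)
      moreover have "\<forall>\<^sub>F y in at x. f y \<noteq> 0" using that by (simp add: V_def)
      ultimately have "\<forall>\<^sub>F y in at x. False"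
        by eventually_elim (use interior_subset[of "{x. f x = 0}"] in \<open>auto simp: U_def\<close>)
      then show False by simp
    qed
    then show ?thesis by blast
  qed
  moreover have "open U" "open V" by (simp_all add: U_def V_def open_punctured_nonzero)
  ultimately have "U \<inter> {a<..<b} = {} \<or> V \<inter> {a<..<b} = {}"
    using UV connected_Ioo[of a b] by (intro connectedD) auto
  then show ?thesis
  proof
    assume "V \<inter> {a<..<b} = {}"
    then have "{a<..<b} \<subseteq> U" using UV by blast
    then show ?thesis using interior_subset[of "{x. f x = 0}"] by (auto simp: U_def)
  next
    assume "U \<inter> {a<..<b} = {}"
    then have V: "{a<..<b} \<subseteq> V" using UV by blast
    have "g x = 0" if x: "x \<in> {a<..<b}" for x
    proof -
      have "\<forall>\<^sub>F y in at x. f y \<noteq> 0" using V x by (auto simp: V_def)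
      moreover have "\<forall>\<^sub>F y in at x. y \<in> {a<..<b}"
          using x by (intro eventually_at_in_open') auto
      ultimately have "\<forall>\<^sub>F y in at x. g y = 0"
        by eventually_elim (use fg in force)
      then have "g \<midarrow>x\<rightarrow> 0" by (rule tendsto_eventually)
      moreover have "g \<midarrow>x\<rightarrow> g x"
        using real_analytic_on_isCont[OF g x] by (simp add: isCont_def)
      ultimately show ?thesis using LIM_unique by blast
    qed
    then show ?thesis by blast
  qed
qed

section \<open>Solutions in coordinates\<close>

text \<open>Hamilton's equations for z = (p1, p2, q1, q2), with the diagonal entries rewritten as in
  \<open>Bmat_entry\<close>. Eliminating p gives q1'' - 2 q2' = (3 + s) q1 / (2 rho) and q2'' + 2
  q1' = (3 - s) q2 / (2 rho), a motion in a rotating frame, where s = sqrt (9 - \<beta>) and rho = 1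
  + e cos t. The value type is free, so that complex solutions and their real and imaginary parts
  are all covered.\<close>

definition sol_on :: "real \<Rightarrow> real \<Rightarrow> (real \<Rightarrow> 'a) \<Rightarrow> (real
    \<Rightarrow> 'a) \<Rightarrow> (real \<Rightarrow> 'a) \<Rightarrow> (real \<Rightarrow>
    'a::real_normed_vector) \<Rightarrow> bool" where
  "sol_on \<beta> e p1 p2 q1 q2 \<longleftrightarrow> (\<forall>t\<in>{0..2 * pi}.
     (p1 has_vector_derivative p2 t - (1 - (3 + sqrt (9 - \<beta>)) / (2 * (1
         + e * cos t))) *\<^sub>R q1 t) (at t within {0..2 * pi}) \<and>
     (p2 has_vector_derivative - p1 t - (1 - (3 - sqrt (9 - \<beta>)) / (2 * (1
         + e * cos t))) *\<^sub>R q2 t) (at t within {0..2 * pi}) \<and>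
     (q1 has_vector_derivative p1 t + q2 t) (at t within {0..2 * pi}) \<and>
     (q2 has_vector_derivative p2 t - q1 t) (at t within {0..2 * pi}))"

lemma sol_onD:
  assumes "sol_on \<beta> e p1 p2 q1 q2" "t \<in> {0..2 * pi}"
  shows "(p1 has_vector_derivative p2 t - (1 - (3 + sqrt (9 - \<beta>)) / (2 * (1
      + e * cos t))) *\<^sub>R q1 t) (at t within {0..2 * pi})"
    "(p2 has_vector_derivative - p1 t - (1 - (3 - sqrt (9 - \<beta>)) / (2 * (1
        + e * cos t))) *\<^sub>R q2 t) (at t within {0..2 * pi})"
    "(q1 has_vector_derivative p1 t + q2 t) (at t within {0..2 * pi})"
    "(q2 has_vector_derivative p2 t - q1 t) (at t within {0..2 * pi})"
  using assms by (simp_all add: sol_on_def)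

lemma sol_on_continuous:
  assumes "sol_on \<beta> e p1 p2 q1 q2"
  shows "continuous_on {0..2 * pi} p1" "continuous_on {0..2 * pi} p2"
    "continuous_on {0..2 * pi} q1" "continuous_on {0..2 * pi} q2"
  using sol_onD[OF assms, THEN has_vector_derivative_continuous]
  by (simp_all add: continuous_on_eq_continuous_within)

lemma sol_on_bounded_linear:
  assumes f: "bounded_linear f" and sol: "sol_on \<beta> e p1 p2 q1 q2"
  shows "sol_on \<beta> e (\<lambda>t. f (p1 t)) (\<lambda>t. f (p2 t)) (\<lambda>t. f (q1 t))
      (\<lambda>t. f (q2 t))"
proof -
  interpret bounded_linear f by (rule f)
  show ?thesis
    unfolding sol_on_def
    using sol_onD[OF sol, THEN has_vector_derivative] by (simp add: add diff scale neg)
qed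

lemma Bmat_entry:
  fixes e t s :: real
  assumes "e \<in> {-1<..<1}"
  shows "(2 * e * cos t - 1 + s) / (2 * (1 + e * cos t)) = 1 - (3 - s) / (2 * (1 + e * cos t))"
    "(2 * e * cos t - 1 - s) / (2 * (1 + e * cos t)) = 1 - (3 + s) / (2 * (1 + e * cos t))"
  using one_plus_e_cos_pos[OF assms, of t] by (simp_all add: field_simps)

lemma bounded_linear_complex_matrix_component:
  "bounded_linear (\<lambda>M :: real ^ 'n ^ 'n. (complex_matrix M *v v) $ i)"
  by (intro linear_linear[THEN iffD2] linearI)
     (simp_all add: matrix_vector_mult_def sum.distrib distrib_right scaleR_sum_right,
      simp add: scaleR_conv_of_real mult.assoc)

abbreviation complex_flow :: "real \<Rightarrow> real \<Rightarrow> complex ^ 4 \<Rightarrow> real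
    \<Rightarrow> complex ^ 4" where
  "complex_flow \<beta> e v t \<equiv> complex_matrix (gamma \<beta> e t) *v v"

lemma complex_flow_sol_on:
  assumes "\<beta> \<in> {0..9}" "e \<in> {-1<..<1}"
  shows "sol_on \<beta> e (\<lambda>t. complex_flow \<beta> e v t $ 1) (\<lambda>t. complex_flow \<beta>
      e v t $ 2)
    (\<lambda>t. complex_flow \<beta> e v t $ 3) (\<lambda>t. complex_flow \<beta> e v t $ 4)"
proof -
  have d: "((\<lambda>t. complex_flow \<beta> e v t $ i) has_vector_derivative
     (complex_matrix (Jmat ** Bmat \<beta> e t) *v complex_flow \<beta> e v t) $ i) (at t within {0..2 * pi})"
    if "t \<in> {0..2 * pi}" for t i
    using bounded_linear.has_vector_derivative[OF bounded_linear_complex_matrix_component gamma_deriv[OF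
        assms that]]
    by (simp add: complex_matrix_mult matrix_vector_mul_assoc)
  have JB: "(complex_matrix (Jmat ** Bmat \<beta> e t) *v w) $ 1
      = w $ 2 - (1 - (3 + sqrt (9 - \<beta>)) / (2 * (1 + e * cos t))) *\<^sub>R w $ 3"
    "(complex_matrix (Jmat ** Bmat \<beta> e t) *v w) $ 2
        = - w $ 1 - (1 - (3 - sqrt (9 - \<beta>)) / (2 * (1 + e * cos t))) *\<^sub>R w $ 4"
    "(complex_matrix (Jmat ** Bmat \<beta> e t) *v w) $ 3 = w $ 1 + w $ 4"
    "(complex_matrix (Jmat ** Bmat \<beta> e t) *v w) $ 4 = w $ 2 - w $ 3" for t w
    unfolding Bmat_def Bmat_entry[OF assms(2)]
    by (simp_all add: matrix_vector_mult_def matrix_matrix_mult_def sum_4 Jmat_def scaleR_conv_of_real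
        left_diff_distrib)
  show ?thesis unfolding sol_on_def using d[of _ 1] d[of _ 2] d[of _ 3] d[of _ 4]
    unfolding JB by blast
qed

section \<open>The energy identity\<close>

text \<open>With k = e sin t / rho = - rho' / rho, this is the part of the energy without s plus the
  derivative of k |q|^2. The momenta go into the completed square, and the weight 1 / (2 rho) is
  what remains of 3 / (2 rho) - 1 after k' - k^2 = 1 - 1 / rho has been added.\<close>

definition energy_pos :: "real \<Rightarrow> (real \<Rightarrow> 'a) \<Rightarrow> (real \<Rightarrow>
    'a) \<Rightarrow> (real \<Rightarrow> 'a) \<Rightarrow> (real \<Rightarrow> 'a::real_inner)
    \<Rightarrow> real \<Rightarrow> real" where
  "energy_pos e p1 p2 q1 q2 t =
     (norm (p1 t + (e * sin t / (1 + e * cos t)) *\<^sub>R q1 t))\<^sup>2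
     + (norm (p2 t + (e * sin t / (1 + e * cos t)) *\<^sub>R q2 t))\<^sup>2
     + (q1 t \<bullet> q1 t + q2 t \<bullet> q2 t) / (2 * (1 + e * cos t))"

definition energy_diff :: "real \<Rightarrow> (real \<Rightarrow> 'a) \<Rightarrow> (real \<Rightarrow>
    'a::real_inner) \<Rightarrow> real \<Rightarrow> real" where
  "energy_diff e q1 q2 t = (q1 t \<bullet> q1 t - q2 t \<bullet> q2 t) / (2 * (1 + e * cos t))"

text \<open>For k = - rho' / rho this is the Riccati equation equivalent to rho'' = 1 - rho.\<close>

lemma log_deriv_rho:
  fixes e t :: real
  assumes e: "e \<in> {-1<..<1}"
  shows "((\<lambda>t. e * sin t / (1 + e * cos t)) has_real_derivative
    (1 - 1 / (1 + e * cos t) + (e * sin t / (1 + e * cos t))\<^sup>2)) (at t within S)"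
proof -
  have \<rho>: "1 + e * cos t > 0" by (rule one_plus_e_cos_pos[OF e])
  have "((\<lambda>t. e * sin t / (1 + e * cos t)) has_real_derivative
      (e * cos t * (1 + e * cos t) - e * sin t * (- e * sin t)) / ((1 + e * cos t) * (1
          + e * cos t))) (at t within S)"
    using \<rho> by (auto intro!: derivative_eq_intros)
  moreover have "((R - 1) * R + S * S) / (R * R) = 1 - 1 / R + (S / R)\<^sup>2" if "R > 0" for R S :: real
    using that by (simp add: field_simps power2_eq_square)
  from this[OF \<rho>, of "e * sin t"]
  have "(e * cos t * (1 + e * cos t) - e * sin t * (- e * sin t)) / ((1 + e * cos t) * (1 + e * cos t))
      = 1 - 1 / (1 + e * cos t) + (e * sin t / (1 + e * cos t))\<^sup>2"
    by simp
  ultimately show ?thesis by simp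
qed

text \<open>With \<open>\<rho> = 1 + e cos t\<close>, a positive solution of \<open>\<rho>''
    = (1/\<rho> - 1) \<rho>\<close>, this is Jacobi's
  completion of squares for \<open>-d\<^sup>2/dt\<^sup>2 - 1 + 1/\<rho>\<close>.\<close>

lemma energy_deriv:
  fixes p1 p2 q1 q2 :: "real \<Rightarrow> 'a::real_inner"
  assumes e: "e \<in> {-1<..<1}" and sol: "sol_on \<beta> e p1 p2 q1 q2" and t: "t \<in> {0..2 * pi}"
  shows "((\<lambda>t. p1 t \<bullet> q1 t + p2 t \<bullet> q2 t + e * sin t / (1
      + e * cos t) * (q1 t \<bullet> q1 t + q2 t \<bullet> q2 t))
    has_real_derivative energy_pos e p1 p2 q1 q2 t + sqrt (9 - \<beta>) * energy_diff e q1 q2 t)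
        (at t within {0..2 * pi})"
proof -
  have \<rho>: "1 + e * cos t > 0" by (rule one_plus_e_cos_pos[OF e])
  define k where "k t = e * sin t / (1 + e * cos t)" for t
  define r where "r = 1 / (1 + e * cos t)"
  define s where "s = sqrt (9 - \<beta>)"
  have dk: "(k has_real_derivative (1 - r + (k t)\<^sup>2)) (at t within {0..2 * pi})"
    unfolding k_def[abs_def] r_def by (rule log_deriv_rho[OF e])
  note d = sol_onD[OF sol t]
  note dd = bounded_bilinear.has_vector_derivative[OF bounded_bilinear_inner]
  have c: "a / (2 * (1 + e * cos t)) = a * r / 2" for a by (simp add: r_def)
  let ?D = "(p1 t \<bullet> (p1 t + q2 t) + (p2 t - (1 - (3 + s) * r / 2) *\<^sub>R q1 t) \<bullet> q1 t)
     + (p2 t \<bullet> (p2 t - q1 t) + (- p1 t - (1 - (3 - s) * r / 2) *\<^sub>R q2 t) \<bullet> q2 t)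
     + ((1 - r + (k t)\<^sup>2) * (q1 t \<bullet> q1 t + q2 t \<bullet> q2 t)
       + ((q1 t \<bullet> (p1 t + q2 t) + (p1 t + q2 t) \<bullet> q1 t) + (q2 t \<bullet> (p2 t - q1 t)
           + (p2 t - q1 t) \<bullet> q2 t)) * k t)"
  have "((\<lambda>t. p1 t \<bullet> q1 t + p2 t \<bullet> q2 t + k t * (q1 t \<bullet> q1 t
      + q2 t \<bullet> q2 t)) has_real_derivative ?D)
      (at t within {0..2 * pi})"
    using dd[OF d(1) d(3)] dd[OF d(2) d(4)] dd[OF d(3) d(3)] dd[OF d(4) d(4)]
    unfolding has_real_derivative_iff_has_vector_derivative[symmetric] c s_def[symmetric]
    by (intro DERIV_add DERIV_mult dk)
  moreover have "?D = energy_pos e p1 p2 q1 q2 t + sqrt (9 - \<beta>) * energy_diff e q1 q2 t"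
    unfolding energy_pos_def energy_diff_def c s_def[symmetric] k_def[symmetric] power2_norm_eq_inner
    by (simp add: inner_simps inner_commute algebra_simps power2_eq_square add_divide_distrib
        diff_divide_distrib)
  ultimately show ?thesis by (simp add: k_def)
qed

lemma continuous_on_inverse_rho:
  assumes e: "e \<in> {-1<..<1}" and f: "continuous_on S f"
  shows "continuous_on S (\<lambda>t. f t / (1 + e * cos t) :: real)"
proof (rule continuous_on_divide[OF f])
  show "continuous_on S (\<lambda>t. 1 + e * cos t)" by (intro continuous_intros)
  show "\<forall>t\<in>S. 1 + e * cos t \<noteq> 0" using one_plus_e_cos_pos[OF e] by (auto simp: less_le)
qed

lemma continuous_on_energy:
  assumes e: "e \<in> {-1<..<1}" and sol: "sol_on \<beta> e p1 p2 q1 q2"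
  shows "continuous_on {0..2 * pi} (energy_pos e p1 p2 q1 q2)"
    and "continuous_on {0..2 * pi} (energy_diff e q1 q2)"
proof -
  have a: "x / (2 * (1 + e * cos t)) = (1 / 2 * x) / (1 + e * cos t)" for x t by simp
  note rules = continuous_on_inverse_rho[OF e] continuous_on_add continuous_on_diff continuous_on_power
    continuous_on_norm continuous_on_scaleR continuous_on_mult continuous_on_inner continuous_on_const
    continuous_on_sin continuous_on_id sol_on_continuous[OF sol]
  show "continuous_on {0..2 * pi} (energy_pos e p1 p2 q1 q2)"
    unfolding energy_pos_def[abs_def] a
    by (intro rules)
  show "continuous_on {0..2 * pi} (energy_diff e q1 q2)"
    unfolding energy_diff_def[abs_def] a
    by (intro rules)
qed

text \<open>The term k |q|^2 vanishes at both ends together with sin t, so only the products of p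
  and q have to agree there. They do so for a solution that is multiplied by a unit number \<omega>
  over one period, and not only for a periodic one.\<close>

lemma energy_integral:
  fixes p1 p2 q1 q2 :: "real \<Rightarrow> 'a::real_inner"
  assumes e: "e \<in> {-1<..<1}" and sol: "sol_on \<beta> e p1 p2 q1 q2"
    and per: "p1 (2 * pi) \<bullet> q1 (2 * pi) = p1 0 \<bullet> q1 0" "p2 (2 * pi) \<bullet> q2 (2 * pi)
        = p2 0 \<bullet> q2 0"
  shows "integral {0..2 * pi} (energy_pos e p1 p2 q1 q2)
      + sqrt (9 - \<beta>) * integral {0..2 * pi} (energy_diff e q1 q2) = 0"
proof -
  let ?f = "\<lambda>t. p1 t \<bullet> q1 t + p2 t \<bullet> q2 t + e * sin t / (1
      + e * cos t) * (q1 t \<bullet> q1 t + q2 t \<bullet> q2 t)"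
  have "((\<lambda>t. energy_pos e p1 p2 q1 q2 t
      + sqrt (9 - \<beta>) * energy_diff e q1 q2 t) has_integral (?f (2 * pi) - ?f 0)) {0..2 * pi}"
    by (rule fundamental_theorem_of_calculus)
       (use energy_deriv[OF e sol] in \<open>auto simp: has_real_derivative_iff_has_vector_derivative\<close>)
  then have "((\<lambda>t. energy_pos e p1 p2 q1 q2 t
      + sqrt (9 - \<beta>) * energy_diff e q1 q2 t) has_integral 0) {0..2 * pi}"
    using per by simp
  moreover have "energy_pos e p1 p2 q1 q2 integrable_on {0..2 * pi}" "energy_diff e q1 q2 integrable_on
      {0..2 * pi}"
    using continuous_on_energy[OF e sol] by (simp_all add: integrable_continuous_real)
  then have "((\<lambda>t. energy_pos e p1 p2 q1 q2 t + sqrt (9 - \<beta>) * energy_diff e q1 q2 t) has_integral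
      integral {0..2 * pi} (energy_pos e p1 p2 q1 q2)
          + sqrt (9 - \<beta>) * integral {0..2 * pi} (energy_diff e q1 q2)) {0..2 * pi}"
    by (intro has_integral_add has_integral_mult_right integrable_integral)
  ultimately show ?thesis by (rule has_integral_unique[symmetric])
qed

lemma energy_pos_nonneg:
  assumes "e \<in> {-1<..<1}"
  shows "energy_pos e p1 p2 q1 q2 t \<ge> 0"
  using one_plus_e_cos_pos[OF assms, of t] by (simp add: energy_pos_def)

text \<open>The positive weight on q forces q = 0 on the whole interval; then q' = 0 at time 0, and
  the equations for q' express p through q.\<close>

lemma energy_pos_integral_zero:
  assumes e: "e \<in> {-1<..<1}" and sol: "sol_on \<beta> e p1 p2 q1 q2"
    and "integral {0..2 * pi} (energy_pos e p1 p2 q1 q2) = 0"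
  shows "p1 0 = 0 \<and> p2 0 = 0 \<and> q1 0 = 0 \<and> q2 0 = 0"
proof -
  have c: "continuous_on (cbox 0 (2 * pi)) (energy_pos e p1 p2 q1 q2)"
    using continuous_on_energy[OF e sol] by simp
  have i: "(energy_pos e p1 p2 q1 q2 has_integral 0) (cbox 0 (2 * pi))"
    using integrable_integral[OF integrable_continuous[OF c]] assms(3) by simp
  have z: "energy_pos e p1 p2 q1 q2 t = 0" if "t \<in> {0..2 * pi}" for t
    by (rule has_integral_0_cbox_imp_0[OF c energy_pos_nonneg[OF e] i]) (use that pi_gt_zero in
        \<open>auto simp: box_real intro!: exI[of _ 1] simp del: pi_gt_zero\<close>)
  have q: "q1 t = 0 \<and> q2 t = 0" if "t \<in> {0..2 * pi}" for t
  proof -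
    have \<rho>: "1 + e * cos t > 0" by (rule one_plus_e_cos_pos[OF e])
    have "(q1 t \<bullet> q1 t + q2 t \<bullet> q2 t) / (2 * (1 + e * cos t)) \<le> energy_pos e p1 p2 q1 q2 t"
      by (simp add: energy_pos_def)
    then have "q1 t \<bullet> q1 t + q2 t \<bullet> q2 t \<le> 0"
      using \<rho> z[OF that] by (simp add: divide_le_0_iff)
    then have "q1 t \<bullet> q1 t = 0 \<and> q2 t \<bullet> q2 t = 0"
      using inner_ge_zero[of "q1 t"] inner_ge_zero[of "q2 t"] by linarith
    then show ?thesis by simp
  qed
  have 0: "0 \<in> {0..2 * pi}" by simp
  have zero: "((\<lambda>t. f t) has_vector_derivative 0) (at 0 within {0..2 * pi})"
    if "\<And>t. t \<in> {0..2 * pi} \<Longrightarrow> f t = 0" for f :: "real \<Rightarrow> 'a"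
    by (rule has_vector_derivative_transform[OF 0 _ has_vector_derivative_const[of 0]]) (use that in simp)
  have "p1 0 + q2 0 = 0" "p2 0 - q1 0 = 0"
    using vector_derivative_unique_within_closed_interval[of 0 "2 * pi" 0 q1 "p1 0 + q2 0" 0]
      vector_derivative_unique_within_closed_interval[of 0 "2 * pi" 0 q2 "p2 0 - q1 0" 0]
      sol_onD(3,4)[OF sol 0] zero[of q1] zero[of q2] q by auto
  then show ?thesis using q[of 0] by simp
qed

section \<open>Nondegeneracy of the eigenvalue 1\<close>

text \<open>Needed at the ends of the half period, where the comparison function rho sin t vanishes
  and the boundary term in Jacobi's completion of squares contains a quotient 0 / 0.\<close>

lemma tendsto_quotient_at_zero_of_sin:
  fixes y :: "real \<Rightarrow> real"
  assumes y: "(y has_real_derivative D) (at a within S)" "y a = 0" and a: "sin a = 0"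
  shows "((\<lambda>t. y t / sin t) \<longlongrightarrow> D / cos a) (at a within S)"
proof -
  have "cos a \<noteq> 0" using a sin_cos_squared_add[of a] by auto
  moreover have "((\<lambda>t. (sin t - sin a) / (t - a)) \<longlongrightarrow> cos a) (at a within S)"
    using DERIV_sin[of a, THEN has_field_derivative_at_within] by (simp add: has_field_derivative_iff)
  moreover have "((\<lambda>t. (y t - y a) / (t - a)) \<longlongrightarrow> D) (at a within S)"
    using y by (simp add: has_field_derivative_iff)
  ultimately have "((\<lambda>t. ((y t - y a) / (t - a)) / ((sin t - sin a) / (t
      - a))) \<longlongrightarrow> D / cos a) (at a within S)"
    by (intro tendsto_divide)
  then show ?thesis
    by (rule Lim_transform_eventually)
       (use eventually_neq_at_within[of a] in \<open>eventually_elim; simp add: a y\<close>)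
qed

text \<open>With \<open>\<rho> = 1 + e cos t\<close>, the operator \<open>L
    = -d\<^sup>2/dt\<^sup>2 - 4 + 3/\<rho>\<close> annihilates \<open>\<rho> sin t\<close>, which is
  positive on \<open>(0, \<pi>)\<close>, and satisfies \<open>L (\<rho> cos t)
      = -2e\<close> and \<open>L (2 - 3 e M \<rho> sin t) = -2\<close> where
  \<open>M' = 1/\<rho>\<^sup>2\<close>. After subtracting the combination \<open>h\<close> of the latter
      two functions that agrees with \<open>u\<close>
  at both end points, Jacobi's completion of squares applies to \<open>u - h\<close>.\<close>

lemma kepler_form_half_period:
  fixes u u' :: "real \<Rightarrow> real"
  assumes e: "e \<in> {-1<..<1}"
    and u: "\<And>t. t \<in> {0..pi} \<Longrightarrow> (u has_real_derivative u' t) (at t within {0..pi})"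
    and u': "continuous_on {0..pi} u'"
  defines "\<alpha> \<equiv> (u 0 - u pi) / 2"
  defines "b \<equiv> (u 0 - \<alpha> * (1 + e)) / 2"
  defines "p \<equiv> e * \<alpha> + b"
  shows "integral {0..pi} (\<lambda>t. (u' t)\<^sup>2 - 4 * (u t)\<^sup>2 + 3 * (u t)\<^sup>2 / (1 + e * cos t))
    \<ge> pi * p\<^sup>2 - 4 * p * integral {0..pi} u"
proof -
  have \<rho>: "1 + e * cos t > 0" for t by (rule one_plus_e_cos_pos[OF e])
  define \<rho>' where "\<rho>' t = 1 + e * cos t" for t
  have r: "\<rho>' t > 0" for t using \<rho> by (simp add: \<rho>'_def)
  have uc: "continuous_on {0..pi} u" by (rule DERIV_continuous_on[OF u])
  have dr: "(\<rho>' has_real_derivative - (e * sin t)) (at t within S)" for t S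
    unfolding \<rho>'_def[abs_def] by (auto intro!: derivative_eq_intros)
  have rc: "continuous_on S \<rho>'" for S by (rule DERIV_continuous_on[OF dr])
  \<comment> \<open>By Kepler's area law \<open>M\<close> is, up to a constant factor, the time
    along the Kepler orbit with true anomaly t; it produces the secular term in
    \<open>h\<close>.\<close>
  define M where "M t = integral {0..t} (\<lambda>s. 1 / (\<rho>' s)\<^sup>2)" for t
  have dM: "(M has_real_derivative 1 / (\<rho>' t)\<^sup>2) (at t within {0..pi})" if "t \<in> {0..pi}" for t
    unfolding M_def[abs_def]
    by (rule integral_has_real_derivative[OF _ that])
       (use r in \<open>auto intro!: continuous_intros rc simp: less_imp_neq[THEN not_sym]\<close>)
  have M0: "M 0 = 0" by (simp add: M_def)
  have Mpi: "M pi \<ge> 0" unfolding M_def 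
    by (rule integral_nonneg[OF integrable_continuous_real])
       (use r in \<open>auto intro!: continuous_intros rc simp: less_imp_neq[THEN not_sym]\<close>)
  define F where "F t = (u' t)\<^sup>2 - 4 * (u t)\<^sup>2 + 3 * (u t)\<^sup>2 / \<rho>' t" for t
  have Fc: "continuous_on {0..pi} F"
    unfolding F_def[abs_def] using r by (auto intro!: continuous_intros u' uc rc simp: less_imp_neq[THEN
        not_sym])
  define h where "h t = \<alpha> * (\<rho>' t * cos t) + b * (2 - 3 * e * (M t * (\<rho>' t * sin t)))" for t
  define h' where "h' t = \<alpha> * (- e * sin t * cos t - \<rho>' t * sin t)
    - 3 * e * b * (sin t / \<rho>' t + M t * (\<rho>' t * cos t - e * (sin t)\<^sup>2))" for t
  \<comment> \<open>The antiderivative of \<open>h\<close> with \<open>H 0 = 0\<close>. As L h = -2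
    p is constant, the cross terms of the form reduce to boundary terms and to integrals of
    \<open>h\<close> and \<open>u\<close>.\<close>
  define H where "H t = \<alpha> * (sin t + e * (t + sin t * cos t) / 2) + b * (t / 2
      + 3 / 2 * (M t * (\<rho>' t)\<^sup>2))" for t
  have dh: "(h has_real_derivative h' t) (at t within {0..pi})" if t: "t \<in> {0..pi}" for t
  proof -
    define g where "g = 1 / (\<rho>' t)\<^sup>2"
    have dM': "(M has_real_derivative g) (at t within {0..pi})" unfolding g_def by (rule dM[OF t])
    have "(h has_real_derivative
       \<alpha> * (\<rho>' t * - sin t + - (e * sin t) * cos t)
           + b * (0 - 3 * e * (M t * (\<rho>' t * cos t + - (e * sin t) * sin t) +
         g * (\<rho>' t * sin t)))) (at t within {0..pi})"
      unfolding h_def[abs_def]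
      by (auto intro!: derivative_eq_intros dr dM' simp: algebra_simps)
    moreover have eq: "g * (\<rho>' t * sin t) = sin t / \<rho>' t"
      using r[of t] by (simp add: g_def power2_eq_square)
    have "\<alpha> * (\<rho>' t * - sin t + - (e * sin t) * cos t)
        + b * (0 - 3 * e * (M t * (\<rho>' t * cos t + - (e * sin t) * sin t) +
         g * (\<rho>' t * sin t))) = h' t"
      unfolding eq h'_def by (simp add: power2_eq_square algebra_simps)
    ultimately show ?thesis by (simp only:)
  qed
  have dh': "(h' has_real_derivative - 4 * h t + 3 * h t / \<rho>' t + 2 * p) (at t within {0..pi})"
    if t: "t \<in> {0..pi}" for t
  proof -
    have "(h' has_real_derivative
       \<alpha> * ((- e * sin t * - sin t + - e * cos t * cos t) - (\<rho>' t * cos t + - (e * sin t) * sin t))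
       - 3 * e * b * ((cos t * \<rho>' t - sin t * - (e * sin t)) / (\<rho>' t * \<rho>' t)
         + (M t * ((\<rho>' t * - sin t + - (e * sin t) * cos t) - e * (2 * sin t * cos t))
           + 1 / (\<rho>' t)\<^sup>2 * (\<rho>' t * cos t - e * (sin t)\<^sup>2)))) (at t within {0..pi})"
      unfolding h'_def[abs_def] using r[of t]
      by (auto intro!: derivative_eq_intros dr dM[OF t] simp: algebra_simps)
    moreover have "\<alpha> * ((- e * S * - S + - e * C * C) - (R * C + - (e * S) * S))
       - 3 * e * b * ((C * R - S * - (e * S)) / (R * R)
         + (m * ((R * - S + - (e * S) * C) - e * (2 * S * C)) + 1 / R\<^sup>2 * (R * C - e * S\<^sup>2)))
       = - 4 * (\<alpha> * (R * C) + b * (2 - 3 * e * (m * (R * S))))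
         + 3 * (\<alpha> * (R * C) + b * (2 - 3 * e * (m * (R * S)))) / R + 2 * (e * \<alpha> + b)"
      if R: "R > 0" "R = 1 + e * C" and SC: "S\<^sup>2 = 1 - C\<^sup>2" for R S C m :: real
    proof -
      have SS: "S * S = 1 - C * C" using SC by (simp add: power2_eq_square)
      have 1: "(- e * S * - S + - e * C * C) - (R * C + - (e * S) * S) = - 4 * (R * C) + 3 * C + 2 * e"
        using SS unfolding R(2) by algebra
      have 2: "(C * R - S * - (e * S)) / (R * R) + 1 / R\<^sup>2 * (R * C - e * S\<^sup>2) = 2 * C / R"
        using R(1) by (simp add: field_simps power2_eq_square)
      have 3: "m * ((R * - S + - (e * S) * C) - e * (2 * S * C)) = m * (- 4 * (R * S) + 3 * S)"
        unfolding R(2) by (simp add: algebra_simps)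
      have 4: "e * C = R - 1" using R by simp
      have "- 3 * e * (2 * C / R) = - 6 * (e * C) / R" by simp
      also have "\<dots> = - 8 + 6 / R + 2" unfolding 4 using R(1) by (simp add: field_simps)
      finally have 5: "- 3 * e * (2 * C / R) = - 6 + 6 / R" by simp
      have "\<alpha> * ((- e * S * - S + - e * C * C) - (R * C + - (e * S) * S))
       - 3 * e * b * ((C * R - S * - (e * S)) / (R * R)
         + (m * ((R * - S + - (e * S) * C) - e * (2 * S * C)) + 1 / R\<^sup>2 * (R * C - e * S\<^sup>2)))
        = \<alpha> * (- 4 * (R * C) + 3 * C + 2 * e) + b * (- 3 * e * (2 * C / R))
            - 3 * e * b * (m * (- 4 * (R * S) + 3 * S))"
        unfolding 1 3 2[symmetric] by (simp add: algebra_simps add_divide_distrib diff_divide_distrib)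
      also have "\<dots> = \<alpha> * (- 4 * (R * C) + 3 * C + 2 * e) + b * (- 6
          + 6 / R) - 3 * e * b * (m * (- 4 * (R * S) + 3 * S))"
        unfolding 5 ..
      also have "\<dots> = - 4 * (\<alpha> * (R * C) + b * (2 - 3 * e * (m * (R * S))))
         + 3 * (\<alpha> * (R * C) + b * (2 - 3 * e * (m * (R * S)))) / R + 2 * (e * \<alpha> + b)"
        using R(1) by (simp add: field_simps)
      finally show ?thesis .
    qed
    from this[of "\<rho>' t" "cos t" "sin t" "M t"] r[of t]
    have "\<alpha> * ((- e * sin t * - sin t + - e * cos t * cos t) - (\<rho>' t * cos t
        + - (e * sin t) * sin t))
       - 3 * e * b * ((cos t * \<rho>' t - sin t * - (e * sin t)) / (\<rho>' t * \<rho>' t)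
         + (M t * ((\<rho>' t * - sin t + - (e * sin t) * cos t) - e * (2 * sin t * cos t))
           + 1 / (\<rho>' t)\<^sup>2 * (\<rho>' t * cos t - e * (sin t)\<^sup>2)))
       = - 4 * h t + 3 * h t / \<rho>' t + 2 * p"
      by (simp only: h_def p_def \<rho>'_def sin_squared_eq simp_thms)
    ultimately show ?thesis by simp
  qed
  have dH: "(H has_real_derivative h t) (at t within {0..pi})" if t: "t \<in> {0..pi}" for t
  proof -
    have "(H has_real_derivative
       \<alpha> * (cos t + e * (1 + (sin t * - sin t + cos t * cos t)) / 2) + b * (1 / 2 + 3 / 2 *
         (M t * (2 * \<rho>' t * - (e * sin t)) + 1 / (\<rho>' t)\<^sup>2 * (\<rho>' t)\<^sup>2)))
             (at t within {0..pi})"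
      unfolding H_def[abs_def]
      by (rule derivative_eq_intros dr dM[OF t] refl | simp)+
    moreover have eq1: "1 / (\<rho>' t)\<^sup>2 * (\<rho>' t)\<^sup>2 = 1" using r[of t] by simp
    have eq2: "cos t + e * (1 + (sin t * - sin t + cos t * cos t)) / 2 = \<rho>' t * cos t"
    proof -
      have eq: "sin t * - sin t = cos t * cos t - 1"
        using sin_cos_squared_add[of t] by (simp add: power2_eq_square)
      show ?thesis unfolding eq \<rho>'_def by (simp add: field_simps)
    qed
    have "\<alpha> * (cos t + e * (1 + (sin t * - sin t + cos t * cos t)) / 2) + b * (1 / 2 + 3 / 2 *
         (M t * (2 * \<rho>' t * - (e * sin t)) + 1 / (\<rho>' t)\<^sup>2 * (\<rho>' t)\<^sup>2)) = h t"
      unfolding eq1 eq2 h_def by (simp add: algebra_simps)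
    ultimately show ?thesis by (simp only:)
  qed
  define y where "y t = u t - h t" for t
  define y' where "y' t = u' t - h' t" for t
  have dy: "(y has_real_derivative y' t) (at t within {0..pi})" if t: "t \<in> {0..pi}" for t
    unfolding y_def[abs_def] y'_def by (intro DERIV_diff u dh that)
  have yc: "continuous_on {0..pi} y" by (rule DERIV_continuous_on[OF dy])
  have hc: "continuous_on {0..pi} h" by (rule DERIV_continuous_on[OF dh])
  have hc': "continuous_on {0..pi} h'" by (rule DERIV_continuous_on[OF dh'])
  have Hc: "continuous_on {0..pi} H" by (rule DERIV_continuous_on[OF dH])
  have y_ends: "y 0 = 0" "y pi = 0"
    by (simp_all add: y_def h_def \<rho>'_def \<alpha>_def b_def M0 field_simps)
  \<comment> \<open>This is q y^2 for the logarithmic derivative q of rho sin t. Grouped as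
    \<open>y t * (y t / sin t)\<close> the pole at the ends is cancelled by one of the two zeros of
    y^2. Division by zero gives \<open>G\<close> the value 0 there, which is also its limit.\<close>
  define G where "G t = (\<rho>' t * cos t - e * (sin t)\<^sup>2) / \<rho>' t * y t * (y t / sin t)" for t
  have Gc: "continuous_on {0..pi} G"
    unfolding continuous_on_def
  proof
    fix t assume t: "t \<in> {0..pi}"
    have q: "((\<lambda>t. (\<rho>' t * cos t - e * (sin t)\<^sup>2) / \<rho>' t * y t)
        \<longlongrightarrow> (\<rho>' t * cos t - e * (sin t)\<^sup>2) / \<rho>' t * y t)
        (at t within {0..pi})"
      using yc rc[of "{0..pi}"] t r[of t] unfolding continuous_on_def
      by (intro tendsto_intros) auto
    show "(G \<longlongrightarrow> G t) (at t within {0..pi})"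
    proof (cases "sin t = 0")
      case True
      then have "t = 0 \<or> t = pi" using t sin_gt_zero[of t] by (cases "t = 0"; cases "t = pi") auto
      then have y0: "y t = 0" using y_ends by auto
      show ?thesis
        unfolding G_def[abs_def]
        using tendsto_mult[OF q tendsto_quotient_at_zero_of_sin[OF dy[OF t] y0 True]] y0 by simp
    next
      case False
      have "((\<lambda>t. y t / sin t) \<longlongrightarrow> y t / sin t) (at t within {0..pi})"
        using yc t False unfolding continuous_on_def by (intro tendsto_intros) auto
      then show ?thesis unfolding G_def[abs_def] by (intro tendsto_mult q)
    qed
  qed
  \<comment> \<open>Chosen to make F + 4 p u - \<Psi>' equal to the square (y' - q y)^2: the first
    two summands integrate by parts the terms in \<open>h\<close> alone and the mixed terms,
    \<open>H\<close> accounts for the constant 2 p, and \<open>G\<close> for Jacobi's identity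
    applied to y.\<close>
  define \<Psi> where "\<Psi> t = h t * h' t + 2 * (h' t * y t) + 2 * p * H t + G t" for t
  define P where "P t = integral {0..t} F + 4 * p * integral {0..t} u - \<Psi> t" for t
  have "P 0 \<le> P pi"
  proof (rule DERIV_nonneg_imp_increasing_open[of 0 pi P])
    show "continuous_on {0..pi} P"
      unfolding P_def[abs_def] \<Psi>_def[abs_def]
      by (intro continuous_intros hc hc' yc Hc Gc indefinite_integral_continuous_1
          integrable_continuous_real Fc uc)
    fix t :: real assume t: "0 < t" "t < pi"
    then have t': "t \<in> {0..pi}" and w: "at t within {0..pi} = at t"
      by (auto intro!: at_within_interior)
    have s: "sin t > 0" using t by (simp add: sin_gt_zero)
    define q where "q t = (\<rho>' t * cos t - e * (sin t)\<^sup>2) / (\<rho>' t * sin t)" for t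
    have Gq: "G = (\<lambda>t. q t * (y t)\<^sup>2)"
      by (simp add: G_def q_def fun_eq_iff power2_eq_square)
    have dq: "(q has_real_derivative (- 4 + 3 / \<rho>' t - (q t)\<^sup>2)) (at t)"
    proof -
      have "(q has_real_derivative
          ((\<rho>' t * - sin t + - (e * sin t) * cos t - e * (2 * sin t * cos t)) * (\<rho>' t * sin t)
           - (\<rho>' t * cos t - e * (sin t)\<^sup>2) * (\<rho>' t * cos t
               + - (e * sin t) * sin t)) / ((\<rho>' t * sin t) * (\<rho>' t * sin t))) (at t)"
        unfolding q_def[abs_def] using r[of t] s
        by (auto intro!: derivative_eq_intros dr simp: algebra_simps)
      moreover have "((R * - S + - (e * S) * C - e * (2 * S * C)) * (R * S)
           - (R * C - e * S\<^sup>2) * (R * C + - (e * S) * S)) / ((R * S) * (R * S))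
               = - 4 + 3 / R - ((R * C - e * S\<^sup>2) / (R * S))\<^sup>2"
        if R: "R > 0" "S > 0" "R = 1 + e * C" for R S C :: real
      proof -
        have "(- 4 + 3 / R) * (R * S) = - 4 * R * S + 3 * S"
          using R(1) by (simp add: field_simps)
        moreover have "R * - S + - (e * S) * C - e * (2 * S * C) = - 4 * R * S + 3 * S"
          unfolding R(3) by (simp add: algebra_simps)
        ultimately have "R * - S + - (e * S) * C - e * (2 * S * C) = (- 4 + 3 / R) * (R * S)" by simp
        moreover have "R * C + - (e * S) * S = R * C - e * S\<^sup>2" by (simp add: power2_eq_square)
        moreover have "(K * N * N - A * A) / (N * N) = K - (A / N)\<^sup>2" if "N > 0" for K N A :: real
          using that by (simp add: field_simps power2_eq_square)
        ultimately show ?thesis using R(1,2) by (simp only: mult_pos_pos)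
      qed
      from this[of "\<rho>' t" "sin t" "cos t"] r[of t] s
      have "((\<rho>' t * - sin t + - (e * sin t) * cos t - e * (2 * sin t * cos t)) * (\<rho>' t * sin t)
           - (\<rho>' t * cos t - e * (sin t)\<^sup>2) * (\<rho>' t * cos t
               + - (e * sin t) * sin t)) / ((\<rho>' t * sin t) * (\<rho>' t * sin t))
               = - 4 + 3 / \<rho>' t - (q t)\<^sup>2"
        by (simp only: q_def \<rho>'_def simp_thms)
      ultimately show ?thesis by simp
    qed
    note ds = dh[OF t', unfolded w] dh'[OF t', unfolded w] dy[OF t', unfolded w] dH[OF t', unfolded w]
    have dI: "((\<lambda>t. integral {0..t} F) has_real_derivative F t) (at t)"
      "((\<lambda>t. integral {0..t} u) has_real_derivative u t) (at t)"
      using integral_has_real_derivative[OF Fc t'] integral_has_real_derivative[OF uc t'] w by simp_all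
    have "(P has_real_derivative F t + 4 * p * u t -
       (h t * (- 4 * h t + 3 * h t / \<rho>' t + 2 * p) + h' t * h' t
        + 2 * (h' t * y' t + (- 4 * h t + 3 * h t / \<rho>' t + 2 * p) * y t) + 2 * p * h t
        + (q t * (2 * y t * y' t) + (- 4 + 3 / \<rho>' t - (q t)\<^sup>2) * (y t)\<^sup>2))) (at t)"
      unfolding P_def[abs_def] \<Psi>_def[abs_def] Gq
      by (rule derivative_eq_intros dI ds dq refl | simp)+
    moreover have "F t + 4 * p * u t -
       (h t * (- 4 * h t + 3 * h t / \<rho>' t + 2 * p) + h' t * h' t
        + 2 * (h' t * y' t + (- 4 * h t + 3 * h t / \<rho>' t + 2 * p) * y t) + 2 * p * h t
        + (q t * (2 * y t * y' t) + (- 4 + 3 / \<rho>' t - (q t)\<^sup>2) * (y t)\<^sup>2))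
            = (y' t - q t * y t)\<^sup>2"
    proof -
      have u_eq: "u t = h t + y t" "u' t = h' t + y' t" by (simp_all add: y_def y'_def)
      define i where "i = 1 / \<rho>' t"
      have i: "x / \<rho>' t = x * i" for x by (simp add: i_def)
      show ?thesis unfolding F_def u_eq i by algebra
    qed
    ultimately show "\<exists>d. (P has_real_derivative d) (at t) \<and> d \<ge> 0" by auto
  qed simp
  moreover have "\<Psi> 0 = 0" by (simp add: \<Psi>_def h'_def H_def G_def M0)
  \<comment> \<open>The summand with \<open>M pi\<close> is nonnegative because e^2 < 1, and
    dropping it leaves pi p^2.\<close>
  moreover have "\<Psi> pi = pi * p\<^sup>2 + 3 * (1 - e\<^sup>2) * M pi * b\<^sup>2"
    unfolding \<Psi>_def G_def y_ends h_def h'_def H_def p_def \<rho>'_def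
    by (simp add: field_simps power2_eq_square)
  moreover have "3 * (1 - e\<^sup>2) * M pi * b\<^sup>2 \<ge> 0"
    using e Mpi abs_square_le_1[of e] by auto
  ultimately have "integral {0..pi} F \<ge> pi * p\<^sup>2 - 4 * p * integral {0..pi} u"
    by (simp add: P_def)
  then show ?thesis by (simp add: F_def[abs_def] \<rho>'_def)
qed

lemma bounded_bilinear_matrix_vector_mult:
  "bounded_bilinear ((*v) :: real ^ 'n ^ 'm \<Rightarrow> real ^ 'n \<Rightarrow> real ^ 'm)"
proof -
  have "bilinear ((*v) :: real ^ 'n ^ 'm \<Rightarrow> real ^ 'n \<Rightarrow> real ^ 'm)"
    unfolding bilinear_def
    by (auto intro!: linearI simp: matrix_vector_mult_def vec_eq_iff sum.distrib algebra_simps sum_distrib_left)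
  then show ?thesis by (simp add: bilinear_conv_bounded_bilinear)
qed

lemma integral_reflect_period:
  fixes f :: "real \<Rightarrow> real"
  assumes "continuous_on {0..2 * pi} f"
  shows "integral {0..2 * pi} f = integral {0..pi} f + integral {0..pi} (\<lambda>t. f (2 * pi - t))"
proof -
  have "continuous_on {- pi + 2 * pi..0 + 2 * pi} f"
    by (rule continuous_on_subset[OF assms]) auto
  from integral_shift[OF this]
  have "integral {pi..2 * pi} f = integral {- pi..0} (\<lambda>t. f (t + 2 * pi))"
    by (simp add: o_def)
  also have "\<dots> = integral {0..pi} (\<lambda>t. f (2 * pi - t))"
    using Henstock_Kurzweil_Integration.integral_reflect_real[of 0 "- pi" "\<lambda>t. f (t + 2 * pi)"] by simp
  finally have "integral {pi..2 * pi} f = integral {0..pi} (\<lambda>t. f (2 * pi - t))" .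
  moreover have "integral {0..pi} f + integral {pi..2 * pi} f = integral {0..2 * pi} f"
    using assms by (intro Henstock_Kurzweil_Integration.integral_combine integrable_continuous_real) auto
  ultimately show ?thesis by simp
qed

text \<open>Reflecting t to 2 pi - t carries the second half period to the first, with the same cos
  t and, by periodicity, the same end values and hence the same p. The sum of the two bounds is 2 pi
  p^2 - 4 p I with I the integral of u over the period, a quadratic in p with minimum -(2 / pi)
  I^2.\<close>

lemma kepler_form_period:
  fixes u u' :: "real \<Rightarrow> real"
  assumes e: "e \<in> {-1<..<1}"
    and u: "\<And>t. t \<in> {0..2 * pi} \<Longrightarrow> (u has_real_derivative u' t)
        (at t within {0..2 * pi})"
    and u': "continuous_on {0..2 * pi} u'" and per: "u (2 * pi) = u 0"
  shows "integral {0..2 * pi} (\<lambda>t. (u' t)\<^sup>2 - 4 * (u t)\<^sup>2 + 3 * (u t)\<^sup>2 / (1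
      + e * cos t))
    \<ge> - (2 / pi) * (integral {0..2 * pi} u)\<^sup>2"
proof -
  define F where "F t = (u' t)\<^sup>2 - 4 * (u t)\<^sup>2 + 3 * (u t)\<^sup>2 / (1 + e * cos t)" for t
  have uc: "continuous_on {0..2 * pi} u" by (rule DERIV_continuous_on[OF u])
  have Fc: "continuous_on {0..2 * pi} F"
    unfolding F_def[abs_def]
    by (intro continuous_on_add continuous_on_diff continuous_on_inverse_rho[OF e] continuous_on_mult
        continuous_on_power continuous_on_const uc u')
  define \<alpha> where "\<alpha> = (u 0 - u pi) / 2"
  define b where "b = (u 0 - \<alpha> * (1 + e)) / 2"
  define p where "p = e * \<alpha> + b"
  define I1 I2 where "I1 = integral {0..pi} u" and "I2 = integral {0..pi} (\<lambda>t. u (2 * pi - t))"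
  have 1: "integral {0..pi} F \<ge> pi * p\<^sup>2 - 4 * p * I1"
    unfolding F_def[abs_def] p_def b_def \<alpha>_def I1_def
  proof (rule kepler_form_half_period[OF e])
    show "(u has_real_derivative u' t) (at t within {0..pi})" if "t \<in> {0..pi}" for t
      using that by (intro DERIV_subset[OF u]) auto
    show "continuous_on {0..pi} u'" by (rule continuous_on_subset[OF u']) auto
  qed
  have "integral {0..pi} (\<lambda>t. (- u' (2 * pi - t))\<^sup>2 - 4 * (u (2 * pi - t))\<^sup>2
      + 3 * (u (2 * pi - t))\<^sup>2 / (1 + e * cos t))
    \<ge> pi * (e * ((u (2 * pi - 0) - u (2 * pi - pi)) / 2)
        + (u (2 * pi - 0) - (u (2 * pi - 0) - u (2 * pi - pi)) / 2 * (1 + e)) / 2)\<^sup>2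
      - 4 * (e * ((u (2 * pi - 0) - u (2 * pi - pi)) / 2)
          + (u (2 * pi - 0) - (u (2 * pi - 0) - u (2 * pi - pi)) / 2 * (1
          + e)) / 2) * integral {0..pi} (\<lambda>t. u (2 * pi - t))"
  proof (rule kepler_form_half_period[OF e])
    fix t :: real assume t: "t \<in> {0..pi}"
    have "((u \<circ> (\<lambda>t. 2 * pi - t)) has_real_derivative u' (2 * pi - t) * - 1)
        (at t within {0..pi})"
    proof (rule DERIV_image_chain)
      show "(u has_real_derivative u' (2 * pi - t)) (at (2 * pi - t) within (\<lambda>t. 2 * pi - t) ` {0..pi})"
        using t by (intro DERIV_subset[OF u]) auto
    qed (auto intro!: derivative_eq_intros)
    then show "((\<lambda>t. u (2 * pi - t)) has_real_derivative - u' (2 * pi - t)) (at t within {0..pi})"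
      by (simp add: o_def)
  next
    show "continuous_on {0..pi} (\<lambda>t. - u' (2 * pi - t))"
      by (intro continuous_on_minus continuous_on_compose2[OF u'] continuous_intros) auto
  qed
  then have 2: "integral {0..pi} (\<lambda>t. F (2 * pi - t)) \<ge> pi * p\<^sup>2 - 4 * p * I2"
    by (simp add: F_def p_def b_def \<alpha>_def I2_def per cos_diff)
  have "integral {0..2 * pi} F \<ge> 2 * pi * p\<^sup>2 - 4 * p * (I1 + I2)"
    using 1 2 integral_reflect_period[OF Fc] by (simp add: algebra_simps)
  also have "I1 + I2 = integral {0..2 * pi} u"
    using integral_reflect_period[OF uc] by (simp add: I1_def I2_def)
  finally have *: "integral {0..2 * pi} F \<ge> 2 * pi * p\<^sup>2 - 4 * p * integral {0..2 * pi} u" .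
  have "2 * pi * p\<^sup>2 - 4 * p * I = 2 * pi * (p - I / pi)\<^sup>2 - (2 / pi) * I\<^sup>2" for I
    by (simp add: field_simps power2_eq_square)
  moreover have "2 * pi * (p - I / pi)\<^sup>2 \<ge> 0" for I by simp
  ultimately have "2 * pi * p\<^sup>2 - 4 * p * I \<ge> - (2 / pi) * I\<^sup>2" for I
    by (metis add_increasing diff_conv_add_uminus minus_mult_left order_refl)
  then show ?thesis using * unfolding F_def[abs_def] by (meson order_trans)
qed

text \<open>Up to a total derivative the energy at s = 3 is the Kepler form of q1 plus (p2 + q1)^2.
  Since p2 - q1 = q2' has mean zero, p2 + q1 has integral 2 I, with I that of q1, and Cauchy-Schwarz
  supplies exactly the (2 / pi) I^2 that the Kepler form may lack. Only the equations for q' enter,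
  which do not contain \<beta>, so a solution for any \<beta> can be inserted.\<close>

lemma energy_nonneg_beta_0:
  fixes p1 p2 q1 q2 :: "real \<Rightarrow> real"
  assumes e: "e \<in> {-1<..<1}" and sol: "sol_on \<beta> e p1 p2 q1 q2"
    and per: "q1 (2 * pi) = q1 0" "q2 (2 * pi) = q2 0"
  shows "integral {0..2 * pi} (energy_pos e p1 p2 q1 q2)
      + 3 * integral {0..2 * pi} (energy_diff e q1 q2) \<ge> 0"
proof -
  note sc = sol_on_continuous[OF sol]
  let ?T = "{0..2 * pi}"
  have \<rho>: "1 + e * cos t > 0" for t by (rule one_plus_e_cos_pos[OF e])
  define F where "F t = (p1 t + q2 t)\<^sup>2 - 4 * (q1 t)\<^sup>2 + 3 * (q1 t)\<^sup>2 / (1 + e * cos t)" for t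
  define k where "k t = e * sin t / (1 + e * cos t)" for t
  define I where "I = integral ?T q1"
  have dq: "(q1 has_real_derivative p1 t + q2 t) (at t within ?T)"
    "(q2 has_real_derivative p2 t - q1 t) (at t within ?T)" if "t \<in> ?T" for t
    using sol_onD(3,4)[OF sol that] by (simp_all add: has_real_derivative_iff_has_vector_derivative)
  have Fc: "continuous_on ?T F"
    unfolding F_def[abs_def]
    by (intro continuous_on_add continuous_on_diff continuous_on_inverse_rho[OF e] continuous_on_mult
        continuous_on_power continuous_on_const sc)
  have F: "integral ?T F \<ge> - (2 / pi) * I\<^sup>2"
    unfolding F_def[abs_def] I_def
    by (rule kepler_form_period[OF e dq(1)]) (use sc per in \<open>auto intro!: continuous_intros\<close>)
  have q1: "(q1 has_integral I) ?T"
    unfolding I_def using sc by (intro integrable_integral integrable_continuous_real)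
  have "((\<lambda>t. p2 t - q1 t) has_integral q2 (2 * pi) - q2 0) ?T"
    by (rule fundamental_theorem_of_calculus) (use dq in \<open>auto simp:
        has_real_derivative_iff_has_vector_derivative\<close>)
  from has_integral_add[OF this has_integral_mult_right[OF q1, of 2]]
  have pq: "((\<lambda>t. p2 t + q1 t) has_integral 2 * I) ?T"
    using per by (simp add: add.commute)
  have sqc: "continuous_on ?T (\<lambda>t. (p2 t + q1 t)\<^sup>2)" by (intro continuous_intros sc)
  then have sq: "((\<lambda>t. (p2 t + q1 t)\<^sup>2)
      has_integral integral ?T (\<lambda>t. (p2 t + q1 t)\<^sup>2)) ?T"
    by (intro integrable_integral integrable_continuous_real)
  \<comment> \<open>Cauchy-Schwarz by expanding a square; \<open>I / pi\<close> is the mean value of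
    p2 + q1.\<close>
  have "((\<lambda>t. (p2 t + q1 t)\<^sup>2 - 2 * (I / pi) * (p2 t + q1 t) + (I / pi)\<^sup>2) has_integral
      integral ?T (\<lambda>t. (p2 t + q1 t)\<^sup>2) - 2 * (I / pi) * (2 * I)
          + (2 * pi - 0) *\<^sub>R (I / pi)\<^sup>2) ?T"
    using has_integral_const_real[of "(I / pi)\<^sup>2" 0 "2 * pi"]
    by (intro has_integral_add has_integral_diff sq has_integral_mult_right pq) simp
  then have "((\<lambda>t. (p2 t + q1 t - I / pi)\<^sup>2) has_integral
      integral ?T (\<lambda>t. (p2 t + q1 t)\<^sup>2) - 2 * (I / pi) * (2 * I)
          + (2 * pi - 0) *\<^sub>R (I / pi)\<^sup>2) ?T"
    by (rule has_integral_eq[rotated]) (simp add: power2_eq_square algebra_simps add_divide_distrib)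
  then have "integral ?T (\<lambda>t. (p2 t + q1 t)\<^sup>2) - 2 * (I / pi) * (2 * I)
      + (2 * pi - 0) *\<^sub>R (I / pi)\<^sup>2 \<ge> 0"
    by (rule has_integral_nonneg) simp
  then have P: "integral ?T (\<lambda>t. (p2 t + q1 t)\<^sup>2) \<ge> (2 / pi) * I\<^sup>2"
    by (simp add: field_simps power2_eq_square)
  \<comment> \<open>The total derivative relating the two forms: the term with \<open>k\<close>
    undoes the completion in \<open>energy_pos\<close>, and -2 q1 q2 trades p1 and p2 for p1 + q2
    and p2 + q1.\<close>
  let ?K = "\<lambda>t. k t * ((q1 t)\<^sup>2 + (q2 t)\<^sup>2) - 2 * (q1 t * q2 t)"
  have "((\<lambda>t. (energy_pos e p1 p2 q1 q2 t + 3 * energy_diff e q1 q2 t) - (F t + (p2 t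
      + q1 t)\<^sup>2)) has_integral ?K (2 * pi) - ?K 0) ?T"
  proof (rule fundamental_theorem_of_calculus)
    fix t assume t: "t \<in> ?T"
    have dk: "(k has_real_derivative (1 - 1 / (1 + e * cos t) + (k t)\<^sup>2)) (at t within ?T)"
      unfolding k_def[abs_def] by (rule log_deriv_rho[OF e])
    define r where "r = 1 / (1 + e * cos t)"
    have r: "x / (1 + e * cos t) = x * r" "x / (2 * (1 + e * cos t)) = x * r / 2" for x by (simp_all add: r_def)
    have "(?K has_real_derivative
       (k t * (2 * q1 t * (p1 t + q2 t) + 2 * q2 t * (p2 t - q1 t)) + (1 - r
           + (k t)\<^sup>2) * ((q1 t)\<^sup>2 + (q2 t)\<^sup>2))
       - 2 * (q1 t * (p2 t - q1 t) + (p1 t + q2 t) * q2 t)) (at t within ?T)"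
      unfolding r_def by (rule derivative_eq_intros dk dq[OF t] refl | simp)+
    moreover have "(k t * (2 * q1 t * (p1 t + q2 t) + 2 * q2 t * (p2 t - q1 t)) + (1 - r
        + (k t)\<^sup>2) * ((q1 t)\<^sup>2 + (q2 t)\<^sup>2))
       - 2 * (q1 t * (p2 t - q1 t) + (p1 t + q2 t) * q2 t)
       = (energy_pos e p1 p2 q1 q2 t + 3 * energy_diff e q1 q2 t) - (F t + (p2 t + q1 t)\<^sup>2)"
      unfolding energy_pos_def energy_diff_def F_def unfolding k_def[symmetric] unfolding r
      by (simp add: power2_eq_square algebra_simps add_divide_distrib diff_divide_distrib)
    ultimately show "(?K has_vector_derivative
       (energy_pos e p1 p2 q1 q2 t + 3 * energy_diff e q1 q2 t) - (F t + (p2 t + q1 t)\<^sup>2))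
           (at t within ?T)"
      by (simp add: has_real_derivative_iff_has_vector_derivative)
  qed simp
  then have 0: "((\<lambda>t. (energy_pos e p1 p2 q1 q2 t + 3 * energy_diff e q1 q2 t) - (F t + (p2 t
      + q1 t)\<^sup>2)) has_integral 0) ?T"
    using per by (simp add: k_def)
  have "((\<lambda>t. (energy_pos e p1 p2 q1 q2 t + 3 * energy_diff e q1 q2 t) - (F t + (p2 t
      + q1 t)\<^sup>2)) has_integral
      (integral ?T (energy_pos e p1 p2 q1 q2) + 3 * integral ?T (energy_diff e q1 q2))
      - (integral ?T F + integral ?T (\<lambda>t. (p2 t + q1 t)\<^sup>2))) ?T"
    by (intro has_integral_add has_integral_diff has_integral_mult_right integrable_integral
        integrable_continuous_real continuous_on_energy[OF e sol] Fc sqc)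
  from has_integral_unique[OF 0 this] F P show ?thesis by linarith
qed

lemma periodic_solution_zero:
  fixes p1 p2 q1 q2 :: "real \<Rightarrow> real"
  assumes \<beta>: "\<beta> \<in> {0<..9}" and e: "e \<in> {-1<..<1}" and sol: "sol_on \<beta> e p1 p2 q1 q2"
    and per: "p1 (2 * pi) = p1 0" "p2 (2 * pi) = p2 0" "q1 (2 * pi) = q1 0" "q2 (2 * pi) = q2 0"
  shows "p1 0 = 0 \<and> p2 0 = 0 \<and> q1 0 = 0 \<and> q2 0 = 0"
proof -
  define A where "A = integral {0..2 * pi} (energy_pos e p1 p2 q1 q2)"
  define C where "C = integral {0..2 * pi} (energy_diff e q1 q2)"
  define s where "s = sqrt (9 - \<beta>)"
  have AC: "A + s * C = 0"
    unfolding A_def C_def s_def using per by (intro energy_integral[OF e sol]) auto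
  have A3: "A + 3 * C \<ge> 0"
    unfolding A_def C_def using per by (intro energy_nonneg_beta_0[OF e sol]) auto
  have A0: "A \<ge> 0"
    unfolding A_def
    by (intro integral_nonneg integrable_continuous_real continuous_on_energy[OF e sol] energy_pos_nonneg[OF e])
  \<comment> \<open>Here \<beta> > 0 enters: s < 3 leaves A a positive weight in A + s C = (1 - s /
    3) A + (s / 3) (A + 3 C).\<close>
  have "s < sqrt (3\<^sup>2)" unfolding s_def using \<beta> by (intro real_sqrt_less_mono) auto
  then have s: "s < 3" "s \<ge> 0" using \<beta> by (auto simp: s_def)
  have "(3 - s) * A = 3 * (A + s * C) - s * (A + 3 * C)" by (simp add: algebra_simps)
  also have "\<dots> \<le> 0" using AC A3 s by simp
  finally have "A \<le> 0" using s by (simp add: mult_le_0_iff)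
  then have "A = 0" using A0 by simp
  then show ?thesis using energy_pos_integral_zero[OF e sol] by (simp add: A_def)
qed

lemma one_not_in_cspectrum:
  assumes \<beta>: "\<beta> \<in> {0<..9}" and e: "e \<in> {-1<..<1}"
  shows "1 \<notin> cspectrum (gamma \<beta> e (2 * pi))"
proof
  assume "1 \<in> cspectrum (gamma \<beta> e (2 * pi))"
  then obtain v where v: "v \<noteq> 0" "complex_flow \<beta> e v (2 * pi) = v"
    by (auto simp: cspectrum_def)
  have \<beta>': "\<beta> \<in> {0..9}" using \<beta> by auto
  have v0: "complex_flow \<beta> e v 0 = v"
    by (simp add: gamma_0[OF \<beta>' e] complex_matrix_mat)
  note sol = complex_flow_sol_on[OF \<beta>' e, of v]
  have "v = 0"
    using periodic_solution_zero[OF \<beta> e sol_on_bounded_linear[OF bounded_linear_Re sol]]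
      periodic_solution_zero[OF \<beta> e sol_on_bounded_linear[OF bounded_linear_Im sol]] v v0
    by (simp add: vec_eq_iff forall_4 complex_eq_iff)
  then show False using v by simp
qed

text \<open>At \<beta> = 0 the coefficient 3 - sqrt (9 - \<beta>) of q2 is zero, so the constant
  vector with p = (-1, 0) and q = (0, 1) is an equilibrium for every e.\<close>

lemma one_in_cspectrum_0:
  assumes e: "e \<in> {-1<..<1}"
  shows "1 \<in> cspectrum (gamma 0 e (2 * pi))"
proof -
  define v :: "real ^ 4" where "v = vector [-1, 0, 0, 1]"
  have 0: "0 \<in> {0..9 :: real}" by simp
  have "sqrt 9 = (3 :: real)" by (rule real_sqrt_unique) auto
  then have B: "Jmat ** Bmat 0 e t *v v = 0" for t
    by (simp add: vec_eq_iff forall_4 matrix_vector_mult_def matrix_matrix_mult_def sum_4 Jmat_def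
        Bmat_def v_def
        \<open>sqrt 9 = 3\<close>) (use one_plus_e_cos_pos[OF e, of t] in \<open>simp add: field_simps\<close>)
  have b: "bounded_bilinear ((*v) :: real ^ 4 ^ 4 \<Rightarrow> real ^ 4 \<Rightarrow> real ^ 4)"
    by (rule bounded_bilinear_matrix_vector_mult)
  have "gamma 0 e (2 * pi) *v v = v"
  proof (rule linear_ode_unique[OF b continuous_on_JB[OF 0 e order_refl],
        where x = "\<lambda>t. gamma 0 e t *v v" and y = "\<lambda>t. v" and t = "2 * pi"])
    fix t assume t: "t \<in> {0..2 * pi}"
    show "((\<lambda>t. gamma 0 e t *v v) has_vector_derivative Jmat ** Bmat 0 e t *v (gamma 0 e t *v v))
        (at t within {0..2 * pi})"
      using bounded_bilinear.has_vector_derivative[OF b gamma_deriv[OF 0 e t] has_vector_derivative_const]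
      by (simp add: matrix_vector_mul_assoc)
    show "((\<lambda>t. v) has_vector_derivative Jmat ** Bmat 0 e t *v v) (at t within {0..2 * pi})"
      by (simp add: B)
  qed (simp_all add: gamma_0[OF 0 e])
  then have "complex_matrix (gamma 0 e (2 * pi)) *v (\<chi> i. complex_of_real (v $ i))
      = 1 *s (\<chi> i. complex_of_real (v $ i))"
    by (simp add: vec_eq_iff matrix_vector_mult_def flip: of_real_mult of_real_sum)
  moreover have "(\<chi> i. complex_of_real (v $ i)) \<noteq> 0"
    by (auto simp: vec_eq_iff forall_4 v_def)
  ultimately show ?thesis unfolding cspectrum_def by blast
qed

section \<open>Persistence of simple degenerate parameters\<close>

abbreviation char_det :: "real \<Rightarrow> real \<Rightarrow> complex \<Rightarrow> complex" where
  "char_det \<beta> e \<omega> \<equiv> det (complex_matrix (gamma \<beta> e (2 * pi)) - mat \<omega>)"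

lemma continuous_on_det:
  fixes A :: "'b::topological_space \<Rightarrow> 'a::real_normed_field ^ 'n ^ 'n"
  assumes "\<And>i j. continuous_on S (\<lambda>x. A x $ i $ j)"
  shows "continuous_on S (\<lambda>x. det (A x))"
  unfolding det_def by (intro continuous_on_sum continuous_on_mult continuous_on_const continuous_on_prod assms)

lemma continuous_on_gamma_end:
  "continuous_on params (\<lambda>p. gamma (fst p) (snd p) (2 * pi))"
proof -
  have "continuous_on params (\<lambda>p. (\<lambda>(p, t). gamma (fst p) (snd p) t) (p, 2 * pi))"
    by (rule continuous_on_compose2[OF continuous_on_gamma], rule continuous_on_Pair[OF continuous_on_id
        continuous_on_const]) auto
  then show ?thesis by simp
qed

lemma continuous_on_char_det:
  "continuous_on (params \<times> UNIV) (\<lambda>x. char_det (fst (fst x)) (snd (fst x)) (snd x))"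
proof (rule continuous_on_det)
  fix i j :: 4
  have "continuous_on (params \<times> UNIV) (\<lambda>x. gamma (fst (fst x)) (snd (fst x)) (2 * pi))"
    by (rule continuous_on_compose2[OF continuous_on_gamma_end continuous_on_fst[OF continuous_on_id]]) auto
  then have g: "continuous_on (params \<times> UNIV) (\<lambda>x. complex_of_real (gamma (fst (fst x))
      (snd (fst x)) (2 * pi) $ i $ j))"
    by (intro continuous_on_of_real continuous_on_component)
  have "continuous_on (params \<times> UNIV) (\<lambda>x. mat (snd x) $ i $ j :: complex)"
    by (cases "i = j") (auto simp: mat_def intro!: continuous_intros)
  from continuous_on_diff[OF g this] show "continuous_on (params \<times> UNIV)
      (\<lambda>x. (complex_matrix (gamma (fst (fst x)) (snd (fst x)) (2 * pi)) - mat (snd x)) $ i $ j)"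
    by simp
qed

section \<open>Symplectic symmetry of the characteristic determinant\<close>

lemma det_complex_matrix: "det (complex_matrix M) = complex_of_real (det M)"
  by (simp add: det_def)

text \<open>The symplectic identity gives only det^2 = 1; the sign is fixed by continuity in t,
  starting from 1 at time 0.\<close>

lemma det_gamma:
  assumes \<beta>: "\<beta> \<in> {0..9}" and e: "e \<in> {-1<..<1}" and t: "t \<in> {0..2 * pi}"
  shows "det (gamma \<beta> e t) = 1"
proof (rule ccontr)
  assume ne: "det (gamma \<beta> e t) \<noteq> 1"
  have sq: "(det (gamma \<beta> e s))\<^sup>2 = 1" if "s \<in> {0..2 * pi}" for s
  proof -
    have "det Jmat \<noteq> 0" using invertible_Jmat by (simp add: invertible_det_nz)
    moreover have "det (gamma \<beta> e s) * det Jmat * det (gamma \<beta> e s) = det Jmat"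
      using arg_cong[OF gamma_symplectic[OF \<beta> e that], of det] by (simp add: det_mul)
    ultimately show ?thesis by (simp add: power2_eq_square)
  qed
  from continuous_on_gamma_time[OF \<beta> e] have c: "continuous_on {0..t} (\<lambda>s. det (gamma
      \<beta> e s))"
    using t by (intro continuous_on_det continuous_on_component continuous_on_subset[of "{0..2 * pi}"
        "gamma \<beta> e" "{0..t}"]) auto
  have "det (gamma \<beta> e t) = - 1" using sq[OF t] ne by (simp add: power2_eq_1_iff)
  then obtain s where "0 \<le> s" "s \<le> t" "det (gamma \<beta> e s) = 0"
    using IVT2'[of "\<lambda>s. det (gamma \<beta> e s)" t 0 0] c t gamma_0[OF \<beta> e] by auto
  then show False using sq[of s] t by auto
qed

lemma complex_matrix_minus: "complex_matrix (- A) = - complex_matrix A"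
  by (simp add: vec_eq_iff)

lemma complex_matrix_transpose: "complex_matrix (transpose A) = transpose (complex_matrix A)"
  by (simp add: vec_eq_iff transpose_def)

text \<open>The characteristic polynomial of a real symplectic matrix is real and self-reciprocal,
  and in size 4 the power \<omega>^2 is its centre of symmetry. A real quotient can change sign, so
  its zeros are accessible to the intermediate value theorem.\<close>

lemma char_det_reflect:
  assumes \<beta>: "\<beta> \<in> {0..9}" and e: "e \<in> {-1<..<1}" and \<omega>: "cmod \<omega> = 1"
  shows "char_det \<beta> e \<omega> / \<omega>\<^sup>2 \<in> \<real>"
proof -
  define M where "M = gamma \<beta> e (2 * pi)"
  define N where "N = complex_matrix M"
  define K where "K = complex_matrix Jmat"
  have \<omega>0: "\<omega> \<noteq> 0" and c: "\<omega> * cnj \<omega>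
      = 1" using \<omega> complex_norm_square[of \<omega>] by auto
  have symp: "transpose N ** K ** N = K"
    using arg_cong[OF gamma_symplectic[OF \<beta> e, of "2 * pi"], of complex_matrix]
    by (simp add: complex_matrix_mult complex_matrix_transpose N_def K_def M_def)
  have detN: "det N = 1" by (simp add: N_def M_def det_complex_matrix det_gamma[OF \<beta> e])
  have detK: "det K \<noteq> 0"
    unfolding K_def using invertible_complex_matrix[OF invertible_Jmat] invertible_det_nz by blast
  have m: "mat a ** A = A ** mat a" for a :: complex and A :: "complex ^ 4 ^ 4"
    by (simp add: vec_eq_iff forall_4 matrix_matrix_mult_def mat_def sum_4)
  have mm: "mat a ** mat b = (mat (a * b) :: complex ^ 4 ^ 4)" for a b
    by (simp add: vec_eq_iff forall_4 matrix_matrix_mult_def mat_def sum_4)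
  have dm: "det (mat a :: complex ^ 4 ^ 4) = a ^ 4" for a
    by (subst det_diagonal) (simp_all add: mat_def)
  have "transpose (N - mat \<omega>) ** K ** N = transpose N ** K ** N - mat \<omega> ** K ** N"
  proof -
    have "transpose (N - mat \<omega>) = transpose N - mat \<omega>"
      by (auto simp add: vec_eq_iff transpose_def mat_def)
    then show ?thesis by (simp add: matrix_diff_left)
  qed
  also have "\<dots> = K - mat \<omega> ** K ** N" by (simp add: symp)
  also have "\<dots> = mat (- \<omega>) ** K ** (N - mat (cnj \<omega>))"
  proof -
    have "mat (- \<omega>) = - (mat \<omega> :: complex ^ 4 ^ 4)" by (simp add: vec_eq_iff mat_def)
    moreover have "mat \<omega> ** K ** mat (cnj \<omega>) = K"
      by (simp only: m[of \<omega> K] matrix_mul_assoc[symmetric] mm c matrix_mul_rid)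
    ultimately show ?thesis by (simp add: matrix_diff_right matrix_minus_left)
  qed
  finally have "transpose (N - mat \<omega>) ** K ** N = mat (- \<omega>) ** K ** (N - mat (cnj \<omega>))" .
  from arg_cong[OF this, of det]
  have "det (N - mat \<omega>) * det K * det N = (- \<omega>) ^ 4 * det K * det (N - mat (cnj \<omega>))"
    by (simp add: det_mul dm)
  then have 1: "det (N - mat \<omega>) = \<omega> ^ 4 * det (N - mat (cnj \<omega>))"
    using detK detN by simp
  have cnj_det: "cnj (det A) = det (map_matrix cnj A)" for A :: "complex ^ 4 ^ 4"
    by (simp add: det_def)
  have cnj_N: "map_matrix cnj (N - mat \<omega>) = N - mat (cnj \<omega>)"
    by (simp add: vec_eq_iff N_def mat_def)
  have 2: "det (N - mat \<omega>) = \<omega> ^ 4 * cnj (det (N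
      - mat \<omega>))" unfolding cnj_det cnj_N by (rule 1)
  have "cnj (det (N - mat \<omega>) / \<omega>\<^sup>2) = cnj (det (N - mat \<omega>)) * \<omega>\<^sup>2"
  proof -
    have "cnj \<omega> = 1 / \<omega>" using c \<omega>0 by (simp add: field_simps)
    then show ?thesis by (simp add: power_divide)
  qed
  also have "\<dots> = det (N - mat \<omega>) / \<omega>\<^sup>2"
    using 2 \<omega>0 by (simp add: field_simps flip: power_add)
  finally show ?thesis by (simp add: N_def M_def Reals_cnj_iff)
qed

text \<open>Minus the derivative of \<open>Bmat\<close> in s = sqrt (9 - \<beta>). As
  \<open>Bmat\<close> is affine in s, differences over two values of \<beta> are exact multiples of
  it.\<close>

definition Emat :: "real \<Rightarrow> real \<Rightarrow> real ^ 4 ^ 4" where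
  "Emat e t = vector
     [vector [0, 0, 0, 0],
      vector [0, 0, 0, 0],
      vector [0, 0, 1 / (2 * (1 + e * cos t)), 0],
      vector [0, 0, 0, - 1 / (2 * (1 + e * cos t))]]"

lemma Bmat_diff_beta:
  assumes "e \<in> {-1<..<1}"
  shows "Bmat \<beta>0 e t - Bmat \<beta> e t = (sqrt (9 - \<beta>) - sqrt (9 - \<beta>0)) *\<^sub>R Emat e t"
  unfolding Bmat_def Emat_def Bmat_entry[OF assms]
  by (simp add: vec_eq_iff forall_4 diff_divide_distrib add_divide_distrib algebra_simps)

lemma continuous_on_Emat:
  assumes e: "e \<in> {-1<..<1}"
  shows "continuous_on S (Emat e)"
proof -
  have "1 / (2 * (1 + e * cos t)) = (1 / 2) / (1 + e * cos t)" "- 1 / (2 * (1 + e * cos t))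
      = (- 1 / 2) / (1 + e * cos t)" for t
    by simp_all
  then show ?thesis
    unfolding Emat_def[abs_def]
    by (simp only:) (intro continuous_on_vector_4 continuous_on_inverse_rho[OF e] continuous_on_const)
qed

text \<open>Two parameters are kept, so that the difference of two monodromy matrices is given
  exactly, without a remainder; on the diagonal this is the matrix of the crossing form.\<close>

definition Wmat :: "real \<Rightarrow> real \<Rightarrow> real \<Rightarrow> real ^ 4 ^ 4" where
  "Wmat \<beta>0 \<beta> e = integral {0..2 * pi} (\<lambda>t. transpose (gamma \<beta>0 e t) ** Emat e t
      ** gamma \<beta> e t)"

lemma continuous_on_transpose: "continuous_on S f \<Longrightarrow> continuous_on S (\<lambda>x.
    transpose (f x :: real ^ 'n ^ 'm))"
  by (rule bounded_linear.continuous_on[OF bounded_linear_transpose])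

text \<open>Integrating the variation formula over a period gives M^T J (N - M), where M and N are
  the two monodromy matrices, and by the symplectic identity M^T J has the inverse - M J.\<close>

lemma gamma_end_diff:
  assumes \<beta>0: "\<beta>0 \<in> {0..9}" and \<beta>: "\<beta> \<in> {0..9}" and e: "e \<in> {-1<..<1}"
  shows "gamma \<beta> e (2 * pi) - gamma \<beta>0 e (2 * pi) =
    - ((sqrt (9 - \<beta>) - sqrt (9 - \<beta>0)) *\<^sub>R (gamma \<beta>0 e (2 * pi) ** Jmat ** Wmat
        \<beta>0 \<beta> e))"
proof -
  define d where "d = sqrt (9 - \<beta>) - sqrt (9 - \<beta>0)"
  define M where "M = gamma \<beta>0 e (2 * pi)"
  define N where "N = gamma \<beta> e (2 * pi)"
  have symp: "transpose M ** Jmat ** M = Jmat"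
    unfolding M_def by (rule gamma_symplectic[OF \<beta>0 e]) simp
  have "((\<lambda>t. transpose (gamma \<beta>0 e t) ** (Bmat \<beta>0 e t
      - Bmat \<beta> e t) ** gamma \<beta> e t) has_integral
      transpose (gamma \<beta>0 e (2 * pi)) ** Jmat ** gamma \<beta> e (2 * pi)
          - transpose (gamma \<beta>0 e 0) ** Jmat ** gamma \<beta> e 0) {0..2 * pi}"
    by (rule fundamental_theorem_of_calculus)
       (auto intro!: symplectic_product_deriv gamma_deriv \<beta>0 \<beta> e[simplified])
  moreover have "transpose A ** (c *\<^sub>R E) ** B
      = c *\<^sub>R (transpose A ** E ** B)" for A B E :: "real ^ 4 ^ 4" and c
    by (simp add: matrix_scalar_ac flip: scalar_matrix_assoc)
  ultimately have "((\<lambda>t. d *\<^sub>R (transpose (gamma \<beta>0 e t) ** Emat e t ** gamma \<beta>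
      e t)) has_integral
      transpose M ** Jmat ** N - Jmat) {0..2 * pi}"
    by (simp add: Bmat_diff_beta[OF e] d_def M_def N_def gamma_0[OF \<beta>0 e] gamma_0[OF \<beta> e]
        transpose_mat)
  moreover have "((\<lambda>t. d *\<^sub>R (transpose (gamma \<beta>0 e t) ** Emat e t ** gamma \<beta> e
      t)) has_integral d *\<^sub>R Wmat \<beta>0 \<beta> e) {0..2 * pi}"
    unfolding Wmat_def
    by (intro has_integral_cmul integrable_integral integrable_continuous_real continuous_on_matrix_mult
        continuous_on_transpose continuous_on_gamma_time \<beta>0 \<beta> e continuous_on_Emat)
  ultimately have "transpose M ** Jmat ** N - Jmat = d *\<^sub>R Wmat \<beta>0 \<beta> e"
    by (rule has_integral_unique)
  then have W: "transpose M ** Jmat ** (N - M) = d *\<^sub>R Wmat \<beta>0 \<beta> e"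
    by (simp add: matrix_diff_right symp)
  have "(transpose M ** Jmat) ** (- (M ** Jmat)) = mat 1"
    by (simp add: matrix_minus_right matrix_mul_assoc symp Jmat_sq)
  then have "(- (M ** Jmat)) ** (transpose M ** Jmat) = mat 1"
    using matrix_left_right_inverse by blast
  then have "N - M = (- (M ** Jmat)) ** (transpose M ** Jmat ** (N - M))"
    by (metis matrix_mul_assoc matrix_mul_lid)
  also have "\<dots> = - (d *\<^sub>R (M ** Jmat ** Wmat \<beta>0 \<beta> e))"
    unfolding W by (simp add: matrix_minus_left matrix_scalar_ac scalar_matrix_assoc)
  finally show ?thesis by (simp add: d_def M_def N_def)
qed

lemma continuous_on_Wmat:
  assumes \<beta>0: "\<beta>0 \<in> {0..9}" and e: "e \<in> {-1<..<1}"
  shows "continuous_on {0..9} (\<lambda>\<beta>. Wmat \<beta>0 \<beta> e)"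
proof -
  have "continuous_on ({0..9::real} \<times> {0..2 * pi}) (\<lambda>x. (\<lambda>(p, t). gamma (fst p)
      (snd p) t) ((fst x, e), snd x))"
    using e by (intro continuous_on_compose2[OF continuous_on_gamma] continuous_intros) auto
  moreover have "continuous_on ({0..9::real} \<times> {0..2 * pi}) (\<lambda>x. gamma \<beta>0 e (snd x))"
    by (rule continuous_on_compose2[OF continuous_on_gamma_time[OF \<beta>0 e] continuous_on_snd[OF
        continuous_on_id]]) auto
  moreover have "continuous_on ({0..9::real} \<times> {0..2 * pi}) (\<lambda>x. Emat e (snd x))"
    by (rule continuous_on_compose2[OF continuous_on_Emat[OF e, of UNIV] continuous_on_snd[OF
        continuous_on_id]]) auto
  ultimately have "continuous_on ({0..9::real} \<times> cbox 0 (2 * pi))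
      (\<lambda>(\<beta>, t). transpose (gamma \<beta>0 e t) ** Emat e t ** gamma \<beta> e t)"
    unfolding split_beta
    by (simp add: continuous_on_matrix_mult continuous_on_transpose)
  from integral_continuous_on_param[OF this] show ?thesis
    unfolding Wmat_def by simp
qed

text \<open>Bilinear and not Hermitian, so that matrices move across by plain transposition; the
  conjugation is made explicit by \<open>vcnj\<close>.\<close>

definition cdot :: "complex ^ 'n \<Rightarrow> complex ^ 'n \<Rightarrow> complex" where
  "cdot u x = (\<Sum>i\<in>UNIV. u $ i * x $ i)"

definition vcnj :: "complex ^ 'n \<Rightarrow> complex ^ 'n" where
  "vcnj v = (\<chi> i. cnj (v $ i))"

lemma cdot_matrix_left: "cdot (A *v u) x = cdot u (transpose A *v x)"
  unfolding cdot_def matrix_vector_mult_def transpose_def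
  by (simp add: sum_distrib_left sum_distrib_right mult_ac) (rule sum.swap)

lemma complex_matrix_vcnj: "complex_matrix M *v vcnj v = vcnj (complex_matrix M *v v)"
  by (simp add: vec_eq_iff vcnj_def matrix_vector_mult_def)

lemma cdot_scale: "cdot (a *s u) x = a * cdot u x" "cdot u (a *s x) = a * cdot u x"
  by (simp_all add: cdot_def sum_distrib_left mult_ac)

lemma cdot_diff: "cdot u (x - y) = cdot u x - cdot u y"
  by (simp add: cdot_def sum_subtractf right_diff_distrib)

lemma cdot_minus: "cdot u (- x) = - cdot u x"
  by (simp add: cdot_def sum_negf)

lemma cdot_add: "cdot u (x + y) = cdot u x + cdot u y"
  by (simp add: cdot_def sum.distrib distrib_left)

lemma inner_unit_mult:
  assumes "cmod \<omega> = 1"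
  shows "(\<omega> * x) \<bullet> (\<omega> * y) = x \<bullet> y"
proof -
  have "(Re \<omega>)\<^sup>2 + (Im \<omega>)\<^sup>2 = 1" using assms cmod_power2[of \<omega>] by simp
  then show ?thesis unfolding inner_complex_def times_complex.sel inner_real_def by algebra
qed

text \<open>On an eigenvector with a unit multiplier the real part of the form is the integral of
  \<open>energy_diff\<close> along its orbit. If it were zero, the energy identity would make the
  integral of \<open>energy_pos\<close> zero as well, and with it the vector.\<close>

lemma crossing_form_nonzero:
  assumes \<beta>: "\<beta> \<in> {0..9}" and e: "e \<in> {-1<..<1}" and \<omega>: "cmod \<omega> = 1"
    and v: "v \<noteq> 0" "complex_flow \<beta> e v (2 * pi) = \<omega> *s v"
  shows "cdot (vcnj v) (complex_matrix (Wmat \<beta> \<beta> e) *v v) \<noteq> 0"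
proof
  assume zero: "cdot (vcnj v) (complex_matrix (Wmat \<beta> \<beta> e) *v v) = 0"
  let ?Z = "complex_flow \<beta> e v"
  define f where "f M = Re (cdot (vcnj v) (complex_matrix M *v v))" for M :: "real ^ 4 ^ 4"
  have f: "bounded_linear f"
    unfolding f_def cdot_def Re_sum
    by (intro bounded_linear_sum bounded_linear_compose[OF bounded_linear_Re]
        bounded_linear_compose[OF bounded_linear_mult_right bounded_linear_complex_matrix_component])
  have fe: "f (transpose (gamma \<beta> e t) ** Emat e t ** gamma \<beta> e t)
      = energy_diff e (\<lambda>t. ?Z t $ 3) (\<lambda>t. ?Z t $ 4) t" for t
  proof -
    have "f (transpose (gamma \<beta> e t) ** Emat e t ** gamma \<beta> e t)
        = Re (cdot (vcnj (?Z t)) (complex_matrix (Emat e t) *v ?Z t))"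
      by (simp add: f_def complex_matrix_mult complex_matrix_transpose matrix_vector_mul_assoc[symmetric]
          cdot_matrix_left[symmetric] complex_matrix_vcnj del: transpose_matrix_vector)
    also have "Re (cdot (vcnj z) (complex_matrix (Emat e t) *v z))
        = (z $ 3 \<bullet> z $ 3 - z $ 4 \<bullet> z $ 4) / (2 * (1 + e * cos t))" for z
      by (simp add: cdot_def sum_4 Emat_def matrix_vector_mult_def vcnj_def inner_complex_def
          add_divide_distrib diff_divide_distrib)
    finally show ?thesis by (simp add: energy_diff_def)
  qed
  have "f (Wmat \<beta> \<beta> e) = integral {0..2 * pi} (f \<circ> (\<lambda>t. transpose (gamma
      \<beta> e t) ** Emat e t ** gamma \<beta> e t))"
    unfolding Wmat_def
    by (rule integral_linear[OF _ f, symmetric])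
       (intro integrable_continuous_real continuous_on_matrix_mult
        continuous_on_transpose continuous_on_gamma_time \<beta> e continuous_on_Emat)
  then have 0: "integral {0..2 * pi} (energy_diff e (\<lambda>t. ?Z t $ 3) (\<lambda>t. ?Z t $ 4)) = 0"
    using zero by (simp add: o_def fe) (simp add: f_def)
  note sol = complex_flow_sol_on[OF \<beta> e, of v]
  have Z0: "?Z 0 = v" by (simp add: gamma_0[OF \<beta> e] complex_matrix_mat)
  have "integral {0..2 * pi} (energy_pos e (\<lambda>t. ?Z t $ 1) (\<lambda>t. ?Z t $ 2) (\<lambda>t. ?Z
      t $ 3) (\<lambda>t. ?Z t $ 4)) = 0"
    using energy_integral[OF e sol] unfolding v(2) Z0 by (simp add: inner_unit_mult[OF \<omega>] 0)
  from energy_pos_integral_zero[OF e sol this] have "v = 0"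
    unfolding Z0 by (simp add: vec_eq_iff forall_4)
  then show False using v by simp
qed

lemma eigen_dim_1_obtain:
  assumes "eigen_dim M \<omega> = 1"
  obtains v where "v \<noteq> 0" "complex_matrix M *v v = \<omega> *s v"
    "\<And>x. complex_matrix M *v x = \<omega> *s x \<Longrightarrow> \<exists>c. x = c *s v"
proof -
  let ?K = "{v. complex_matrix M *v v = \<omega> *s v}"
  have d: "vec.dim ?K = 1" using assms by (simp add: eigen_dim_def eigenspace_eq)
  obtain B where B: "B \<subseteq> ?K" "vec.independent B" "?K \<subseteq> vec.span B" "card B = vec.dim ?K"
    using vec.basis_exists by blast
  then obtain v where v: "B = {v}" using d card_1_singletonE by metis
  have "v \<noteq> 0" using B v vec.dependent_zero by blast
  then show thesis using that B v by (auto simp: vec.span_singleton)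
qed

lemma det_column_scale:
  fixes A :: "'a::comm_ring_1 ^ 'n ^ 'n"
  shows "det (\<chi> i j. if j = k then c * w $ i else A $ i $ j) = c * det (\<chi> i j. if j
      = k then w $ i else A $ i $ j)"
proof -
  have "transpose (\<chi> i j. if j = k then c * w $ i else A $ i $ j) = (\<chi> i. if i
      = k then c *s w else transpose A $ i)"
    "transpose (\<chi> i j. if j = k then w $ i else A $ i $ j) = (\<chi> i. if i
        = k then w else transpose A $ i)"
    by (simp_all add: transpose_def vec_eq_iff)
  then show ?thesis
    using det_row_mul[of k c "\<lambda>i. w" "\<lambda>i. transpose A $ i"]
    by (metis (no_types, lifting) det_transpose)
qed

text \<open>Put A = N - \<omega> and let v span the kernel at \<beta>0. Since A v = d w with d the
  difference of the values of s, Cramer's rule extracts the factor d: \<open>v $ k\<close> det A = d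
  det L, where L has w in column k. It remains to see that det L does not vanish at \<beta>0, which
  is where the crossing form and the one-dimensionality of the kernel are used.\<close>

lemma char_det_simple_zero:
  assumes \<beta>0: "\<beta>0 \<in> {0..9}" and e: "e \<in> {-1<..<1}" and \<omega>: "cmod \<omega> = 1"
    and dim: "eigen_dim (gamma \<beta>0 e (2 * pi)) \<omega> = 1"
  shows "\<exists>l. l \<noteq> 0 \<and> ((\<lambda>\<beta>. char_det \<beta> e \<omega> /
      complex_of_real (sqrt (9 - \<beta>) - sqrt (9 - \<beta>0))) \<longlongrightarrow> l)
      (at \<beta>0 within {0..9})"
proof -
  define N where "N \<beta> = complex_matrix (gamma \<beta> e (2 * pi))" for \<beta>
  define K where "K = complex_matrix Jmat"
  obtain v where v: "v \<noteq> 0" "N \<beta>0 *v v = \<omega> *s v" and ker: "\<And>x. N \<beta>0 *v x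
      = \<omega> *s x \<Longrightarrow> \<exists>c. x = c *s v"
    using eigen_dim_1_obtain[OF dim] unfolding N_def by blast
  obtain k where k: "v $ k \<noteq> 0" using v by (auto simp: vec_eq_iff)
  define w where "w \<beta> = - (N \<beta>0 *v (K *v (complex_matrix (Wmat \<beta>0 \<beta> e) *v v)))"
      for \<beta>
  define A where "A \<beta> = N \<beta> - mat \<omega>" for \<beta>
  define L where "L \<beta> = (\<chi> i j. if j = k then w \<beta> $ i else A \<beta> $ i $ j)" for \<beta>
  define d where "d \<beta> = sqrt (9 - \<beta>) - sqrt (9 - \<beta>0)" for \<beta>
  have \<omega>c: "cnj \<omega> * \<omega> = 1"
      using \<omega> complex_norm_square[of \<omega>] by (simp add: mult.commute)
  have A_vec: "A \<beta> *v x = N \<beta> *v x - \<omega> *s x" for \<beta> x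
    by (simp add: A_def matrix_vector_mult_diff_rdistrib mat_mult_vec)
  have Av: "A \<beta> *v v = complex_of_real (d \<beta>) *s w \<beta>" if \<beta>: "\<beta> \<in> {0..9}"
      for \<beta>
  proof -
    have cm: "complex_matrix (A - B) = complex_matrix A - complex_matrix B" "complex_matrix (- A)
        = - complex_matrix A"
      "complex_matrix (c *\<^sub>R A) = mat (complex_of_real c) ** complex_matrix A"
          for A B :: "real ^ 4 ^ 4" and c
      by (simp_all add: vec_eq_iff matrix_matrix_mult_def mat_def if_distrib if_distribR cong: if_cong)
    have "A \<beta> *v v = N \<beta> *v v - N \<beta>0 *v v" by (simp add: A_vec v(2))
    also have "\<dots> = complex_matrix (gamma \<beta> e (2 * pi) - gamma \<beta>0 e (2 * pi)) *v v"
      by (simp add: N_def cm matrix_vector_mult_diff_rdistrib)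
    also have "\<dots> = complex_of_real (d \<beta>) *s w \<beta>"
    proof -
      have neg: "(- B) *v x = - (B *v x)" for B :: "complex ^ 4 ^ 4" and x
        by (simp add: vec_eq_iff matrix_vector_mult_def sum_negf)
      have sneg: "c *s (- x) = - (c *s x)" for c and x :: "complex ^ 4"
        by (simp add: vec_eq_iff)
      show ?thesis
        unfolding gamma_end_diff[OF \<beta>0 \<beta> e] d_def[symmetric]
        by (simp add: cm complex_matrix_mult matrix_vector_mul_assoc[symmetric] mat_mult_vec w_def N_def
            K_def neg sneg)
    qed
    finally show ?thesis .
  qed
  have det: "v $ k * det (A \<beta>) = complex_of_real (d \<beta>) * det (L \<beta>)" if "\<beta> \<in>
      {0..9}" for \<beta>
    using cramer_lemma[of k "A \<beta>" v] unfolding Av[OF that] L_def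
    by (simp only: vector_smult_component det_column_scale)
  have symp: "transpose (N \<beta>0) *v (K *v (N \<beta>0 *v x)) = K *v x" for x
    using arg_cong[OF gamma_symplectic[OF \<beta>0 e, of "2 * pi"], of complex_matrix]
    by (simp add: N_def K_def complex_matrix_mult complex_matrix_transpose matrix_vector_mul_assoc
        matrix_mul_assoc)
  \<comment> \<open>The symplectic pairing with the conjugate eigenvector. It annihilates the range
    of \<open>A \<beta>0\<close>, because the monodromy matrix preserves \<open>K\<close> and
    \<open>cnj \<omega> * \<omega> = 1\<close>, and on \<open>w \<beta>0\<close> it is the crossing
    form.\<close>
  define h where "h x = cdot (N \<beta>0 *v vcnj v) (K *v x)" for x
  have Nv: "N \<beta>0 *v vcnj v = cnj \<omega> *s vcnj v"
    using v(2) by (simp add: N_def complex_matrix_vcnj) (simp add: vcnj_def vec_eq_iff)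
  have h_range: "h (A \<beta>0 *v x) = 0" for x
  proof -
    have "h (A \<beta>0 *v x) = cdot (N \<beta>0 *v vcnj v) (K *v (N \<beta>0 *v x))
        - \<omega> * cdot (N \<beta>0 *v vcnj v) (K *v x)"
      by (simp add: h_def A_vec matrix_vector_mult_diff_distrib cdot_diff vec.scale cdot_scale)
    also have "cdot (N \<beta>0 *v vcnj v) (K *v (N \<beta>0 *v x)) = cdot (vcnj v) (K *v x)"
      by (simp add: cdot_matrix_left symp del: transpose_matrix_vector)
    also have "\<omega> * cdot (N \<beta>0 *v vcnj v) (K *v x)
        = (cnj \<omega> * \<omega>) * cdot (vcnj v) (K *v x)"
      by (simp add: Nv cdot_scale)
    finally show ?thesis by (simp add: \<omega>c)
  qed
  have h_w: "h (w \<beta>0) \<noteq> 0"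
  proof -
    have "K ** K = - mat 1"
      by (simp add: K_def Jmat_sq complex_matrix_minus complex_matrix_mat flip: complex_matrix_mult)
    then have KK: "K *v (K *v x) = - x" for x
      by (simp add: matrix_vector_mul_assoc) (simp add: vec_eq_iff forall_4 matrix_vector_mult_def sum_4
          mat_def)
    have neg: "B *v (- x) = - (B *v x)" for B :: "complex ^ 4 ^ 4" and x
      by (simp add: vec_eq_iff matrix_vector_mult_def sum_negf)
    have "h (w \<beta>0) = cdot (vcnj v) (complex_matrix (Wmat \<beta>0 \<beta>0 e) *v v)"
      by (simp add: h_def w_def neg cdot_minus cdot_matrix_left symp KK del: transpose_matrix_vector)
    then show ?thesis using crossing_form_nonzero[OF \<beta>0 e \<omega> v(1)] v(2) by (simp add: N_def)
  qed
  have "det (L \<beta>0) \<noteq> 0"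
  proof
    assume "det (L \<beta>0) = 0"
    then have "\<not> inj ((*v) (L \<beta>0))"
      using det_nz_iff_inj_gen[OF matrix_vector_mul_linear_gen[of "L \<beta>0"]] by simp
    then obtain x where x: "x \<noteq> 0" "L \<beta>0 *v x = 0"
      by (metis vec.inj_iff_eq_0 matrix_vector_mul_linear_gen)
    \<comment> \<open>The image of x under L splits into the k-th coordinate of x times w and the
      image of \<open>x'\<close> under A. The pairing \<open>h\<close> kills the second part, so the
      k-th coordinate is zero; then x lies in the kernel of A, which is spanned by v with
      \<open>v $ k\<close> nonzero, so x = 0.\<close>
    define x' where "x' = (\<chi> j. if j = k then 0 else x $ j)"
    have "L \<beta>0 *v x = x $ k *s w \<beta>0 + A \<beta>0 *v x'"
    proof -
      have "(\<Sum>j\<in>UNIV. L \<beta>0 $ i $ j * x $ j)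
          = x $ k * w \<beta>0 $ i + (\<Sum>j\<in>UNIV. A \<beta>0 $ i $ j * x' $ j)" for i
        by (subst (1 2) sum.remove[of UNIV k]) (auto simp: L_def x'_def intro!: sum.cong)
      then show ?thesis by (simp add: vec_eq_iff matrix_vector_mult_def)
    qed
    then have *: "x $ k *s w \<beta>0 + A \<beta>0 *v x' = 0" using x by simp
    have "x $ k * h (w \<beta>0) + h (A \<beta>0 *v x') = h (x $ k *s w \<beta>0 + A \<beta>0 *v x')"
      by (simp add: h_def matrix_vector_right_distrib cdot_add vec.scale cdot_scale)
    also have "\<dots> = 0" unfolding * by (simp add: h_def cdot_def)
    finally have xk: "x $ k = 0" using h_w h_range by simp
    then have "x' = x" by (simp add: x'_def vec_eq_iff)
    then have "A \<beta>0 *v x = 0" using * xk by simp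
    then obtain c where "x = c *s v" using ker[of x] by (auto simp: A_vec)
    then show False using xk k x by simp
  qed
  moreover have "((\<lambda>\<beta>. det (L \<beta>) / v $ k) \<longlongrightarrow> det (L \<beta>0) / v
      $ k) (at \<beta>0 within {0..9})"
  proof -
    have W: "continuous_on {0..9} (\<lambda>\<beta>. (complex_matrix (Wmat \<beta>0 \<beta> e) *v v) $ i)" for i
      by (rule bounded_linear.continuous_on[OF bounded_linear_complex_matrix_component
          continuous_on_Wmat[OF \<beta>0 e]])
    have mv: "continuous_on {0..9} (\<lambda>\<beta>. (B *v f \<beta>) $ i)" if "\<And>i. continuous_on
        {0..9} (\<lambda>\<beta>. f \<beta> $ i)"
      for B :: "complex ^ 4 ^ 4" and f :: "real \<Rightarrow> complex ^ 4" and i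
      unfolding matrix_vector_mult_def vec_lambda_beta
      by (intro continuous_on_sum continuous_on_mult continuous_on_const that)
    have wc: "continuous_on {0..9} (\<lambda>\<beta>. w \<beta> $ i)" for i
      unfolding w_def by (simp, intro continuous_on_minus mv W)
    have "continuous_on {0..9} (\<lambda>\<beta>. gamma \<beta> e (2 * pi))"
    proof -
      have "continuous_on {0..9} (\<lambda>\<beta>. gamma (fst (\<beta>, e)) (snd (\<beta>, e)) (2 * pi))"
        using e by (intro continuous_on_compose2[OF continuous_on_gamma_end] continuous_intros) auto
      then show ?thesis by simp
    qed
    then have Ac: "continuous_on {0..9} (\<lambda>\<beta>. A \<beta> $ i $ j)" for i j
      by (simp add: A_def N_def) (intro continuous_on_diff continuous_on_const continuous_on_of_real
          continuous_on_component)
    have "continuous_on {0..9} (\<lambda>\<beta>. L \<beta> $ i $ j)" for i j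
      using wc Ac by (cases "j = k") (simp_all add: L_def)
    then have "continuous_on {0..9} (\<lambda>\<beta>. det (L \<beta>))" by (rule continuous_on_det)
    then show ?thesis using \<beta>0 k unfolding continuous_on_def by (intro tendsto_divide tendsto_const) auto
  qed
  then have "((\<lambda>\<beta>. char_det \<beta> e \<omega> / complex_of_real (d \<beta>))
      \<longlongrightarrow> det (L \<beta>0) / v $ k) (at \<beta>0 within {0..9})"
  proof (rule Lim_transform_eventually)
    have "\<forall>\<^sub>F \<beta> in at \<beta>0 within {0..9}. \<beta> \<in> {0..9}
        \<and> \<beta> \<noteq> \<beta>0"
      by (simp add: eventually_at_filter)
    then show "\<forall>\<^sub>F \<beta> in at \<beta>0 within {0..9}. det (L \<beta>) / v $ k
        = char_det \<beta> e \<omega> / complex_of_real (d \<beta>)"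
    proof eventually_elim
      case (elim \<beta>)
      then have "d \<beta> \<noteq> 0" by (auto simp: d_def)
      then show ?case using det[of \<beta>] elim k by (simp add: A_def N_def field_simps)
    qed
  qed
  ultimately show ?thesis using k unfolding d_def by (intro exI[of _ "det (L \<beta>0) / v $ k"]) auto
qed

text \<open>By the nonzero quotient limit, the real function of \<beta> obtained from
  \<open>char_det\<close> by dividing by \<omega>0^2 changes sign at \<beta>0. The opposite signs at
  two fixed parameters next to \<beta>0 persist for \<omega> near \<omega>0 on the circle, and a
  zero lies between them.\<close>

lemma degenerate_parameter_persists:
  assumes \<beta>0: "\<beta>0 \<in> {0<..<9}" and e: "e \<in> {-1<..<1}" and \<omega>0: "cmod \<omega>0 = 1"
    and dim: "eigen_dim (gamma \<beta>0 e (2 * pi)) \<omega>0 = 1" and \<epsilon>: "\<epsilon> > 0"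
  shows "\<forall>\<^sub>F \<omega> in at \<omega>0 within sphere 0 1. \<exists>\<beta>\<in>{0..9}.
      \<bar>\<beta> - \<beta>0\<bar> < \<epsilon> \<and> \<omega> \<in> cspectrum (gamma \<beta> e (2 * pi))"
proof -
  have \<beta>0': "\<beta>0 \<in> {0..9}" using \<beta>0 by auto
  have \<omega>ne: "\<omega>0 \<noteq> 0" using \<omega>0 by auto
  define d where "d \<beta> = sqrt (9 - \<beta>) - sqrt (9 - \<beta>0)" for \<beta>
  define g where "g \<beta> \<omega> = Re (char_det \<beta> e \<omega> / \<omega>\<^sup>2)" for \<beta> \<omega>
  have real: "char_det \<beta> e \<omega> / \<omega>\<^sup>2
      = complex_of_real (g \<beta> \<omega>)" if "\<beta> \<in> {0..9}" "cmod \<omega> = 1" for \<beta> \<omega>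
    using char_det_reflect[OF that(1) e that(2)] by (simp add: g_def)
  obtain l where l: "l \<noteq> 0"
    "((\<lambda>\<beta>. char_det \<beta> e \<omega>0 / complex_of_real (d \<beta>))
        \<longlongrightarrow> l) (at \<beta>0 within {0..9})"
    using char_det_simple_zero[OF \<beta>0' e \<omega>0 dim] unfolding d_def by blast
  have lim: "((\<lambda>\<beta>. complex_of_real (g \<beta> \<omega>0 / d \<beta>)) \<longlongrightarrow>
      l / \<omega>0\<^sup>2) (at \<beta>0 within {0..9})"
  proof (rule Lim_transform_eventually)
    show "((\<lambda>\<beta>. char_det \<beta> e \<omega>0 / complex_of_real (d \<beta>) /
        \<omega>0\<^sup>2) \<longlongrightarrow> l / \<omega>0\<^sup>2) (at \<beta>0 within {0..9})"
      using \<omega>ne by (intro tendsto_divide l tendsto_const) simp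
    have "\<forall>\<^sub>F \<beta> in at \<beta>0 within {0..9}. \<beta> \<in> {0..9}"
        by (simp add: eventually_at_filter)
    then show "\<forall>\<^sub>F \<beta> in at \<beta>0 within {0..9}. char_det \<beta> e \<omega>0 /
        complex_of_real (d \<beta>) / \<omega>0\<^sup>2 = complex_of_real (g \<beta> \<omega>0 / d \<beta>)"
    proof eventually_elim
      case (elim \<beta>)
      have "char_det \<beta> e \<omega>0 / complex_of_real (d \<beta>) / \<omega>0\<^sup>2
          = char_det \<beta> e \<omega>0 / \<omega>0\<^sup>2 / complex_of_real (d \<beta>)"
        by (simp add: mult.commute)
      then show ?case unfolding real[OF elim \<omega>0] by simp
    qed
  qed
  \<comment> \<open>A limit of real values is real, so taking the real part loses nothing and
    \<open>L\<close> is nonzero. Multiplying by \<open>L\<close> below normalizes the signs.\<close>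
  define L where "L = Re (l / \<omega>0\<^sup>2)"
  have limR: "((\<lambda>\<beta>. g \<beta> \<omega>0 / d \<beta>) \<longlongrightarrow> L)
      (at \<beta>0 within {0..9})"
    using tendsto_Re[OF lim] by (simp add: L_def)
  have "((\<lambda>\<beta>. 0) \<longlongrightarrow> Im (l / \<omega>0\<^sup>2)) (at \<beta>0 within {0..9})"
    using tendsto_Im[OF lim] by simp
  moreover have nt: "at \<beta>0 within {0..9} \<noteq> bot"
    using \<beta>0 at_within_interior[of \<beta>0 "{0..9}"] by simp
  ultimately have "Im (l / \<omega>0\<^sup>2) = 0" using tendsto_unique[OF nt _ tendsto_const] by metis
  moreover have "l / \<omega>0\<^sup>2 \<noteq> 0" using l(1) \<omega>ne by simp
  ultimately have L0: "L \<noteq> 0" unfolding L_def by (metis complex_eq_iff zero_complex.sel)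
  have "\<forall>\<^sub>F \<beta> in at \<beta>0 within {0..9}. 0 < g \<beta> \<omega>0 / d \<beta> * L"
    using tendsto_mult[OF limR tendsto_const[of L]] L0
        by (intro order_tendstoD(1)[of _ "L * L"]) (auto simp: zero_less_mult_iff linorder_neq_iff)
  then have "\<forall>\<^sub>F \<beta> in at \<beta>0. 0 < g \<beta> \<omega>0 / d \<beta> * L"
    using \<beta>0 at_within_interior[of \<beta>0 "{0..9}"] by simp
  then obtain \<delta> where \<delta>: "\<delta> > 0" "\<And>\<beta>. \<beta> \<noteq> \<beta>0
      \<Longrightarrow> \<bar>\<beta> - \<beta>0\<bar> < \<delta> \<Longrightarrow> 0 < g \<beta>
      \<omega>0 / d \<beta> * L"
    by (auto simp: eventually_at dist_real_def)
  \<comment> \<open>Half the minimum, so that both test parameters lie strictly inside (0, 9),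
    within \<epsilon> of \<beta>0, and where the quotient already has the sign of its limit.\<close>
  define \<eta> where "\<eta> = Min {\<delta>, \<epsilon>, \<beta>0, 9 - \<beta>0} / 2"
  have \<eta>: "\<eta> > 0" "\<eta> < \<delta>" "\<eta> < \<epsilon>" "\<eta> < \<beta>0" "\<eta> < 9
      - \<beta>0"
    using \<delta>(1) \<epsilon> \<beta>0 by (auto simp: \<eta>_def)
  define a where "a = \<beta>0 - \<eta>"
  define b where "b = \<beta>0 + \<eta>"
  have ab: "a \<in> {0..9}" "b \<in> {0..9}" "a < \<beta>0" "\<beta>0 < b"
      using \<eta> by (auto simp: a_def b_def)
  have da: "d a > 0" and db: "d b < 0" using ab by (auto simp: d_def)
  have "0 < g a \<omega>0 / d a * L" "0 < g b \<omega>0 / d b * L"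
    using \<delta>(2)[of a] \<delta>(2)[of b] \<eta> by (auto simp: a_def b_def)
  then have ga: "0 < g a \<omega>0 * L" and gb: "g b \<omega>0 * L < 0"
    using da db by (auto simp: zero_less_mult_iff mult_less_0_iff zero_less_divide_iff divide_less_0_iff)
  have gc: "continuous_on ({0..9} \<times> sphere 0 1) (\<lambda>x. g (fst x) (snd x))"
  proof -
    have "continuous_on ({0..9} \<times> sphere 0 1) (\<lambda>x. char_det (fst (fst ((fst x, e), snd
        x))) (snd (fst ((fst x, e), snd x))) (snd ((fst x, e), snd x)))"
      using e by (intro continuous_on_compose2[OF continuous_on_char_det] continuous_intros) auto
    then have "continuous_on ({0..9} \<times> sphere 0 1) (\<lambda>x. char_det (fst x) e (snd x))" by simp
    then show ?thesis unfolding g_def by (intro continuous_intros) auto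
  qed
  have gw: "((\<lambda>\<omega>. g \<beta> \<omega> * L) \<longlongrightarrow> g \<beta> \<omega>0 * L)
      (at \<omega>0 within sphere 0 1)" if "\<beta> \<in> {0..9}" for \<beta>
  proof -
    have "continuous_on (sphere 0 1) (\<lambda>\<omega>. g (fst (\<beta>, \<omega>)) (snd (\<beta>, \<omega>)))"
      using that by (intro continuous_on_compose2[OF gc] continuous_intros) auto
    then have "((\<lambda>\<omega>. g \<beta> \<omega>) \<longlongrightarrow> g \<beta> \<omega>0)
        (at \<omega>0 within sphere 0 1)"
      using \<omega>0 by (simp add: continuous_on_def)
    then show ?thesis by (intro tendsto_intros)
  qed
  have "\<forall>\<^sub>F \<omega> in at \<omega>0 within sphere 0 1. \<omega> \<in> sphere 0 1"
      by (simp add: eventually_at_filter)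
  moreover note order_tendstoD(1)[OF gw[OF ab(1)] ga] order_tendstoD(2)[OF gw[OF ab(2)] gb]
  ultimately show ?thesis
  proof eventually_elim
    case (elim \<omega>)
    have \<omega>: "cmod \<omega> = 1" using elim(1) by simp
    have "continuous_on {a..b} (\<lambda>\<beta>. g (fst (\<beta>, \<omega>)) (snd (\<beta>, \<omega>)))"
      using ab \<omega> by (intro continuous_on_compose2[OF gc] continuous_intros) auto
    then have "continuous_on {a..b} (\<lambda>\<beta>. g \<beta> \<omega> * L)"
        by (intro continuous_intros) simp
    then obtain \<beta> where \<beta>: "a \<le> \<beta>" "\<beta> \<le> b" "g \<beta> \<omega> * L = 0"
      using IVT2'[of "\<lambda>\<beta>. g \<beta> \<omega> * L" b 0 a] elim ab by auto
    then have "\<beta> \<in> {0..9}" using ab by auto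
    moreover have "char_det \<beta> e \<omega> = 0"
        using real[OF \<open>\<beta> \<in> {0..9}\<close> \<omega>] \<beta>(3) L0 \<omega> by auto
    moreover have "\<bar>\<beta> - \<beta>0\<bar> < \<epsilon>"
        using \<beta> \<eta> by (auto simp: a_def b_def abs_if)
    ultimately show ?case by (auto simp: mem_cspectrum_iff_det)
  qed
qed

section \<open>The circular case \<open>e = 0\<close>\<close>

abbreviation Xmat :: "real \<Rightarrow> real ^ 4 ^ 4" where
  "Xmat \<beta> \<equiv> Jmat ** Bmat \<beta> 0 0"

text \<open>The factor X - \<mu> acting on vectors; a list of such factors, applied by
  \<open>fold\<close>, represents a polynomial in X through its roots.\<close>

definition Top :: "real \<Rightarrow> complex \<Rightarrow> complex ^ 4 \<Rightarrow> complex ^ 4" where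
  "Top \<beta> \<mu> v = complex_matrix (Xmat \<beta>) *v v - \<mu> *s v"

lemma Bmat_circular: "Bmat \<beta> 0 t = Bmat \<beta> 0 0"
  by (simp add: Bmat_def)

lemma Xmat_vec:
  fixes v :: "complex ^ 4"
  shows "(complex_matrix (Xmat \<beta>) *v v) $ 1
      = v $ 2 + complex_of_real ((1 + sqrt (9 - \<beta>)) / 2) * v $ 3"
    "(complex_matrix (Xmat \<beta>) *v v) $ 2 = - v $ 1
        + complex_of_real ((1 - sqrt (9 - \<beta>)) / 2) * v $ 4"
    "(complex_matrix (Xmat \<beta>) *v v) $ 3 = v $ 1 + v $ 4"
    "(complex_matrix (Xmat \<beta>) *v v) $ 4 = v $ 2 - v $ 3"
  by (simp_all add: matrix_vector_mult_def matrix_matrix_mult_def sum_4 Jmat_def Bmat_def field_simps)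

lemma Top_commute: "Top \<beta> a (Top \<beta> b v) = Top \<beta> b (Top \<beta> a v)"
  by (simp add: Top_def matrix_vector_mult_diff_distrib vec.scale vec.scale_right_diff_distrib mult.commute)

lemma Top_zero: "Top \<beta> a 0 = 0"
  by (simp add: Top_def)

text \<open>Cayley-Hamilton for the constant matrix X, whose characteristic polynomial x^4 + x^2 +
  \<beta> / 4 has the roots a, -a, b, -b.\<close>

lemma Top_characteristic:
  assumes "\<beta> \<le> 9" "a\<^sup>2 + b\<^sup>2 = -1" "a\<^sup>2 * b\<^sup>2 = complex_of_real (\<beta> / 4)"
  shows "fold (Top \<beta>) [a, - a, b, - b] v = 0"
proof -
  let ?X = "\<lambda>v. complex_matrix (Xmat \<beta>) *v v"
  have sq: "Top \<beta> (- c) (Top \<beta> c u) = ?X (?X u) - c\<^sup>2 *s u" for c u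
    by (simp add: Top_def matrix_vector_mult_diff_distrib vec.scale vec.scale_right_diff_distrib
        vec.scale_left_distrib power2_eq_square algebra_simps)
  define B where "B = complex_of_real ((1 + sqrt (9 - \<beta>)) / 2)"
  have C: "complex_of_real ((1 - sqrt (9 - \<beta>)) / 2) = 1 - B"
    by (simp add: B_def field_simps)
  have "\<beta> / 4 = 2 + (1 + sqrt (9 - \<beta>)) / 2 * ((1 - sqrt (9 - \<beta>)) / 2)"
    using assms(1) by (simp add: field_simps)
  then have "complex_of_real (\<beta> / 4) = 2 + complex_of_real ((1
      + sqrt (9 - \<beta>)) / 2) * complex_of_real ((1 - sqrt (9 - \<beta>)) / 2)"
    by (simp only: of_real_add of_real_mult of_real_numeral)
  then have \<beta>4: "complex_of_real (\<beta> / 4) = 2 + B * (1 - B)"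
    unfolding C B_def[symmetric] .
  have X2: "?X (?X u) $ 1 = (B - 1) * u $ 1 + u $ 4" "?X (?X u) $ 2 = - B * u $ 2 - u $ 3"
    "?X (?X u) $ 3 = 2 * u $ 2 + (B - 1) * u $ 3" "?X (?X u) $ 4 = - 2 * u $ 1 - B * u $ 4" for u
    unfolding Xmat_vec C B_def[symmetric] by (simp_all add: algebra_simps)
  have "?X (?X (?X (?X v))) + ?X (?X v) + complex_of_real (\<beta> / 4) *s v = 0"
    unfolding vec_eq_iff forall_4 vector_add_component vector_smult_component X2 \<beta>4
    by (simp add: algebra_simps)
  moreover have "fold (Top \<beta>) [a, - a, b, - b] v
      = ?X (?X (?X (?X v) - a\<^sup>2 *s v)) - b\<^sup>2 *s (?X (?X v) - a\<^sup>2 *s v)"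
    by (simp add: sq)
  moreover have "\<dots> = ?X (?X (?X (?X v))) - (a\<^sup>2 + b\<^sup>2) *s ?X (?X v)
      + (a\<^sup>2 * b\<^sup>2) *s v"
    by (simp add: matrix_vector_mult_diff_distrib vec.scale vec_eq_iff algebra_simps)
  moreover have "x - (-1) *s y + z = x + y + z" for x y z :: "complex ^ 4"
    by (simp add: vec_eq_iff)
  ultimately show ?thesis unfolding assms(2,3) by simp
qed

section \<open>The circular flow as the exponential of a constant matrix\<close>

context
  fixes \<beta> :: real
  assumes \<beta>: "\<beta> \<in> {0..9}"
begin

lemma gamma_circular_commute:
  assumes t: "t \<in> {0..2 * pi}"
  shows "Xmat \<beta> ** gamma \<beta> 0 t = gamma \<beta> 0 t ** Xmat \<beta>"
proof -
  have 0: "0 \<in> {-1<..<1 :: real}" by simp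
  have d: "(gamma \<beta> 0 has_vector_derivative Xmat \<beta> ** gamma \<beta> 0 t)
      (at t within {0..2 * pi})" if "t \<in> {0..2 * pi}" for t
    using gamma_deriv[OF \<beta> 0 that] unfolding Bmat_circular[of \<beta> t] .
  show ?thesis
  proof (rule linear_ode_unique[OF bounded_bilinear_matrix_matrix_mult, where X
      = "\<lambda>t. Xmat \<beta>" and T = "2 * pi"
        and x = "\<lambda>t. Xmat \<beta> ** gamma \<beta> 0 t" and y
            = "\<lambda>t. gamma \<beta> 0 t ** Xmat \<beta>"])
    fix t assume "t \<in> {0..2 * pi}"
    note d = d[OF this]
    show "((\<lambda>t. Xmat \<beta> ** gamma \<beta> 0 t)
        has_vector_derivative Xmat \<beta> ** (Xmat \<beta> ** gamma \<beta> 0 t)) (at t within {0..2 * pi})"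
      using has_vector_derivative_matrix_mult[OF has_vector_derivative_const d] by simp
    show "((\<lambda>t. gamma \<beta> 0 t ** Xmat \<beta>)
        has_vector_derivative Xmat \<beta> ** (gamma \<beta> 0 t ** Xmat \<beta>)) (at t within {0..2 * pi})"
      using has_vector_derivative_matrix_mult[OF d has_vector_derivative_const]
          by (simp add: matrix_mul_assoc[symmetric])
  qed (use t gamma_0[OF \<beta> 0] in auto)
qed

lemma complex_flow_Top:
  assumes "t \<in> {0..2 * pi}"
  shows "complex_flow \<beta> 0 (Top \<beta> \<mu> v) t = Top \<beta> \<mu> (complex_flow \<beta> 0 v t)"
proof -
  have "complex_matrix (gamma \<beta> 0 t) *v (complex_matrix (Xmat \<beta>) *v v)
      = complex_matrix (Xmat \<beta>) *v (complex_matrix (gamma \<beta> 0 t) *v v)"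
    by (simp add: matrix_vector_mul_assoc gamma_circular_commute[OF assms] flip: complex_matrix_mult)
  then show ?thesis
    by (simp add: Top_def matrix_vector_mult_diff_distrib vec.scale)
qed

text \<open>Differentiating exp (- \<mu> t) times the flow of v replaces v by (X - \<mu>) v.
  Eigenvectors thus give constants, and Jordan chains of length two give affine functions of
  t.\<close>

lemma complex_flow_exp_deriv:
  assumes t: "t \<in> {0..2 * pi}"
  shows "((\<lambda>t. exp (t *\<^sub>R (- \<mu>)) * complex_flow \<beta> 0 v t $ i) has_vector_derivative
    exp (t *\<^sub>R (- \<mu>)) * complex_flow \<beta> 0 (Top \<beta> \<mu> v) t $ i) (at t within {0..2 * pi})"
proof -
  have 0: "0 \<in> {-1<..<1 :: real}" by simp
  have "((\<lambda>t. complex_flow \<beta> 0 v t $ i) has_vector_derivative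
     (complex_matrix (Xmat \<beta>) *v complex_flow \<beta> 0 v t) $ i) (at t within {0..2 * pi})"
    using bounded_linear.has_vector_derivative[OF bounded_linear_complex_matrix_component gamma_deriv[OF
        \<beta> 0 t]]
    unfolding Bmat_circular[of \<beta> t] by (simp add: complex_matrix_mult matrix_vector_mul_assoc)
  from bounded_bilinear.has_vector_derivative[OF bounded_bilinear_mult
      exp_scaleR_has_vector_derivative_right this, of "- \<mu>"]
  show ?thesis
    unfolding complex_flow_Top[OF t] by (simp add: Top_def algebra_simps)
qed

lemma has_vector_derivative_zero_const:
  assumes "\<And>t. t \<in> {0..2 * pi} \<Longrightarrow> (f has_vector_derivative 0) (at t within {0..2 * pi})"
  shows "f (2 * pi) = f 0"
proof -
  have "(f has_derivative (\<lambda>h. 0)) (at t within {0..2 * pi})" if "t \<in> {0..2 * pi}" for t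
    using assms[OF that] by (simp add: has_vector_derivative_def)
  from has_derivative_zero_constant[OF _ this] show ?thesis by force
qed

lemma complex_flow_eigenvector:
  assumes v: "Top \<beta> \<mu> v = 0" and t: "t \<in> {0..2 * pi}"
  shows "complex_flow \<beta> 0 v t = exp (t *\<^sub>R \<mu>) *s v"
proof -
  have 0: "0 \<in> {-1<..<1 :: real}" by simp
  have "exp (t *\<^sub>R (- \<mu>)) * complex_flow \<beta> 0 v t $ i = v $ i" for i
  proof -
    have "((\<lambda>t. exp (t *\<^sub>R (- \<mu>)) * complex_flow \<beta> 0 v t $ i) has_derivative
        (\<lambda>h. 0)) (at t within {0..2 * pi})"
      if "t \<in> {0..2 * pi}" for t
      using complex_flow_exp_deriv[OF that, of \<mu> v i] v by (simp add: has_vector_derivative_def)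
    from has_derivative_zero_constant[OF _ this]
    obtain c where "\<And>t. t \<in> {0..2 * pi} \<Longrightarrow> exp (t *\<^sub>R (- \<mu>)) *
        complex_flow \<beta> 0 v t $ i = c" by auto
    from this[OF t] this[of 0] show ?thesis by (simp add: gamma_0[OF \<beta> 0] complex_matrix_mat)
  qed
  moreover have "complex_flow \<beta> 0 v t $ i
      = exp (t *\<^sub>R \<mu>) * (exp (t *\<^sub>R (- \<mu>)) * complex_flow \<beta> 0 v t $ i)" for i
    by (simp add: exp_minus)
  ultimately show ?thesis by (simp add: vec_eq_iff)
qed

text \<open>Over a period the flow multiplies an eigenvector of X by exp (2 pi \<mu>). Hence on the
  \<omega>-eigenspace a factor X - \<mu> with a different exponential is injective and may be
  cancelled.\<close>

lemma eigenspace_strip: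
  assumes v: "Top \<beta> \<mu> v = 0" and K: "complex_flow \<beta> 0 v (2 * pi)
      = \<omega> *s v" and \<omega>: "exp ((2 * pi) *\<^sub>R \<mu>) \<noteq> \<omega>"
  shows "v = 0"
proof -
  have "complex_flow \<beta> 0 v (2 * pi) = exp ((2 * pi) *\<^sub>R \<mu>) *s v"
    by (rule complex_flow_eigenvector[OF v]) simp
  from this[symmetric] K have "exp ((2 * pi) *\<^sub>R \<mu>) *s v = \<omega> *s v" by (rule trans)
  then show ?thesis using \<omega> by simp
qed

lemma eigenspace_invariant:
  assumes "complex_flow \<beta> 0 v (2 * pi) = \<omega> *s v"
  shows "complex_flow \<beta> 0 (Top \<beta> \<mu> v) (2 * pi) = \<omega> *s Top \<beta> \<mu> v"
  unfolding complex_flow_Top[of "2 * pi", simplified] assms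
  by (simp add: Top_def vec.scale vec.scale_right_diff_distrib mult.commute)

text \<open>A Jordan chain of \<open>X\<close> of length two yields one of \<open>exp (2\<pi>X)\<close>.\<close>

lemma eigenspace_no_jordan:
  assumes v: "Top \<beta> \<mu> (Top \<beta> \<mu> v) = 0" and K: "complex_flow \<beta> 0 v (2 * pi)
      = \<omega> *s v"
  shows "Top \<beta> \<mu> v = 0"
proof (cases "exp ((2 * pi) *\<^sub>R \<mu>) = \<omega>")
  case True
  have 0: "0 \<in> {-1<..<1 :: real}" by simp
  define u where "u = Top \<beta> \<mu> v"
  have fu: "complex_flow \<beta> 0 u t = exp (t *\<^sub>R \<mu>) *s u" if "t \<in> {0..2 * pi}" for t
    using complex_flow_eigenvector[OF _ that] v by (simp add: u_def)
  have "u $ i = 0" for i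
  proof -
    let ?f = "\<lambda>t. exp (t *\<^sub>R (- \<mu>)) * complex_flow \<beta> 0 v t $ i - t *\<^sub>R u $ i"
    have "(?f has_vector_derivative 0) (at t within {0..2 * pi})" if t: "t \<in> {0..2 * pi}" for t
    proof -
      have "exp (t *\<^sub>R (- \<mu>)) * complex_flow \<beta> 0 u t $ i = u $ i"
        unfolding fu[OF t] by (simp add: exp_minus)
      then have "((\<lambda>t. exp (t *\<^sub>R (- \<mu>)) * complex_flow \<beta> 0 v t $ i)
          has_vector_derivative u $ i) (at t within {0..2 * pi})"
        using complex_flow_exp_deriv[OF t, of \<mu> v i] by (simp add: u_def)
      moreover have "((\<lambda>t. t *\<^sub>R u $ i) has_vector_derivative u $ i) (at t within {0..2 * pi})"
        by (auto intro!: derivative_eq_intros)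
      ultimately show ?thesis using has_vector_derivative_diff by fastforce
    qed
    from has_vector_derivative_zero_const[OF this]
    have "exp (- ((2 * pi) *\<^sub>R \<mu>)) * (\<omega> * v $ i) - (2 * pi) *\<^sub>R u $ i = v $ i"
      unfolding K by (simp add: gamma_0[OF \<beta> 0] complex_matrix_mat)
    moreover have "exp (- ((2 * pi) *\<^sub>R \<mu>)) * (\<omega> * v $ i) = v $ i"
      unfolding True[symmetric] by (simp add: exp_minus mult.assoc[symmetric])
    ultimately show ?thesis by simp
  qed
  then show ?thesis by (simp add: u_def vec_eq_iff)
next
  case False
  have "complex_flow \<beta> 0 (Top \<beta> \<mu> v) (2 * pi) = \<omega> *s Top \<beta> \<mu> v"
    by (rule eigenspace_invariant[OF K])
  then show ?thesis using eigenspace_strip[OF v _ False] by simp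
qed

lemma eigenspace_fold_strip:
  assumes "fold (Top \<beta>) rs v = 0" "complex_flow \<beta> 0 v (2 * pi) = \<omega> *s v"
    "\<And>r. r \<in> set rs \<Longrightarrow> exp ((2 * pi) *\<^sub>R r) \<noteq> \<omega>"
  shows "v = 0"
  using assms
proof (induction rs arbitrary: v)
  case (Cons r rs)
  have "Top \<beta> r v = 0"
    by (rule Cons.IH[OF _ eigenspace_invariant[OF Cons.prems(2)]]) (use Cons.prems(1,3) in auto)
  then show ?case by (rule eigenspace_strip[OF _ Cons.prems(2)]) (use Cons.prems(3)[of r] in simp)
qed simp

text \<open>Factors whose exponential is not \<omega> are cancelled, and repeated factors X - \<mu>
  reduce to a single one because the eigenspace contains no Jordan chain. So Cayley-Hamilton shrinks
  to (X - \<mu>) v = 0.\<close>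

lemma eigenspace_fold:
  assumes "fold (Top \<beta>) rs v = 0" "complex_flow \<beta> 0 v (2 * pi) = \<omega> *s v"
    "\<And>r. r \<in> set rs \<Longrightarrow> exp ((2 * pi) *\<^sub>R r)
        = \<omega> \<Longrightarrow> r = \<mu>"
  shows "Top \<beta> \<mu> v = 0"
  using assms
proof (induction rs arbitrary: v)
  case Nil
  then show ?case by (simp add: Top_zero)
next
  case (Cons r rs)
  have *: "Top \<beta> \<mu> (Top \<beta> r v) = 0"
    by (rule Cons.IH[OF _ eigenspace_invariant[OF Cons.prems(2)]]) (use Cons.prems(1,3) in auto)
  show ?case
  proof (cases "r = \<mu>")
    case True
    then show ?thesis using eigenspace_no_jordan[OF _ Cons.prems(2)] * by simp
  next
    case False
    then have "exp ((2 * pi) *\<^sub>R r) \<noteq> \<omega>" using Cons.prems(3)[of r] by auto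
    moreover have "Top \<beta> r (Top \<beta> \<mu> v) = 0" using * Top_commute by metis
    ultimately show ?thesis using eigenspace_strip eigenspace_invariant[OF Cons.prems(2)] by blast
  qed
qed

end

text \<open>A unit multiplier makes the exponent purely imaginary, m = i y, and the quartic becomes
  y^2 (1 - y^2) = \<beta> / 4, whose positivity confines y to 0 < |y| < 1.\<close>

lemma unit_root:
  assumes m: "m ^ 4 + m\<^sup>2 + complex_of_real (\<beta> / 4) = 0" and \<beta>: "\<beta> > 0"
    and \<omega>: "exp ((2 * pi) *\<^sub>R m) = \<omega>" "cmod \<omega> = 1"
  obtains y where "m = \<i> * complex_of_real y" "y\<^sup>2 * (1 - y\<^sup>2)
      = \<beta> / 4" "0 < \<bar>y\<bar>" "\<bar>y\<bar> < 1" "\<omega> = cis (2 * pi * y)"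
proof -
  have "exp (Re ((2 * pi) *\<^sub>R m)) = 1" using \<omega> by (metis norm_exp_eq_Re)
  then have "Re m = 0" by simp
  then obtain y where y: "m = \<i> * complex_of_real y"
    by (metis complex_eq complex_of_real_def mult.commute of_real_0 add_0 scaleR_conv_of_real)
  have "complex_of_real (y ^ 4 - y\<^sup>2 + \<beta> / 4) = m ^ 4 + m\<^sup>2 + complex_of_real (\<beta> / 4)"
    unfolding y by (simp add: power_mult_distrib)
  then have "y ^ 4 - y\<^sup>2 + \<beta> / 4 = 0" unfolding m by (simp only: of_real_eq_0_iff)
  then have eq: "y\<^sup>2 * (1 - y\<^sup>2) = \<beta> / 4" by (simp add: algebra_simps flip: power_add)
  then have "0 < y\<^sup>2 * (1 - y\<^sup>2)" using \<beta> by simp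
  then have "0 < y\<^sup>2" "y\<^sup>2 < 1" by (auto simp: zero_less_mult_iff)
  then have "0 < \<bar>y\<bar>" "\<bar>y\<bar> < 1" by (simp_all add: abs_square_less_1)
  moreover have "\<omega> = cis (2 * pi * y)"
    unfolding \<omega>(1)[symmetric] y cis_conv_exp by (simp add: scaleR_conv_of_real mult_ac)
  ultimately show thesis using that y eq by blast
qed

lemma cis_2pi_eq_iff: "cis (2 * pi * x) = cis (2 * pi * y) \<longleftrightarrow> x - y \<in> \<int>"
proof -
  have "cis (2 * pi * x) = cis (2 * pi * y) \<longleftrightarrow> cis (2 * pi * (x - y)) = 1"
    by (simp add: right_diff_distrib cis_divide[symmetric])
  also have "\<dots> \<longleftrightarrow> (\<exists>n::int. 2 * pi * (x - y) = of_int (2 * n) * pi)"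
    unfolding cis_conv_exp exp_eq_1 by simp
  also have "\<dots> \<longleftrightarrow> (\<exists>n::int. x - y = of_int n)"
  proof -
    have "2 * pi * (x - y) = of_int (2 * n) * pi \<longleftrightarrow> (2 * pi) * (x - y)
        = (2 * pi) * of_int n" for n :: int
      by (simp add: mult_ac)
    then show ?thesis unfolding mult_cancel_left by simp
  qed
  also have "\<dots> \<longleftrightarrow> x - y \<in> \<int>" by (auto elim: Ints_cases)
  finally show ?thesis .
qed

lemma small_Ints:
  assumes "x \<in> \<int>" "\<bar>x\<bar> < 2"
  shows "x = 0 \<or> x = 1 \<or> x = (-1::real)"
proof -
  obtain n :: int where n: "x = of_int n" using assms(1) by (auto simp: Ints_def)
  then have "\<bar>n\<bar> < 2" using assms(2) by simp
  then have "n = 0 \<or> n = 1 \<or> n = -1" by auto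
  then show ?thesis using n by auto
qed

text \<open>Write the roots as i y and i y'. Equal exponentials make y - y' one of 0, 1, -1, and the
  quartic gives y^2 = y'^2 or y^2 + y'^2 = 1. The latter with |y - y'| = 1 forces y y' = 0, which is
  impossible; y' = -y leads to y = 1/2 or y = -1/2, that is to the excluded \<omega> = -1.\<close>

lemma unit_root_unique:
  assumes m: "m ^ 4 + m\<^sup>2 + complex_of_real (\<beta> / 4)
      = 0" and m': "m' ^ 4 + m'\<^sup>2 + complex_of_real (\<beta> / 4) = 0"
    and \<beta>: "\<beta> > 0" and \<omega>: "exp ((2 * pi) *\<^sub>R m)
        = \<omega>" "exp ((2 * pi) *\<^sub>R m') = \<omega>" "cmod \<omega> = 1" "\<omega> \<noteq> -1"
  shows "m = m'"
proof -
  obtain y where y: "m = \<i> * complex_of_real y" "y\<^sup>2 * (1 - y\<^sup>2)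
      = \<beta> / 4" "0 < \<bar>y\<bar>" "\<bar>y\<bar> < 1" "\<omega> = cis (2 * pi * y)"
    using unit_root[OF m \<beta> \<omega>(1,3)] .
  obtain y' where y': "m' = \<i> * complex_of_real y'" "y'\<^sup>2 * (1 - y'\<^sup>2)
      = \<beta> / 4" "0 < \<bar>y'\<bar>" "\<bar>y'\<bar> < 1" "\<omega> = cis (2 * pi * y')"
    using unit_root[OF m' \<beta> \<omega>(2,3)] .
  have "y - y' \<in> \<int>" using y(5) y'(5) cis_2pi_eq_iff by metis
  then have d: "y - y' = 0 \<or> y - y' = 1 \<or> y - y' = -1"
    by (rule small_Ints) (use y(4) y'(4) in linarith)
  have "(y\<^sup>2 - y'\<^sup>2) * (y\<^sup>2 + y'\<^sup>2 - 1)
      = y'\<^sup>2 * (1 - y'\<^sup>2) - y\<^sup>2 * (1 - y\<^sup>2)" by (simp add: algebra_simps)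
  then have "y\<^sup>2 = y'\<^sup>2 \<or> y\<^sup>2 + y'\<^sup>2 = 1" using y(2) y'(2) by auto
  then show ?thesis
  proof
    assume "y\<^sup>2 = y'\<^sup>2"
    then consider "y = y'" | "y' = - y" by (auto simp: power2_eq_iff)
    then show ?thesis
    proof cases
      case 2
      then have "y = 1 / 2 \<or> y = - 1 / 2" using d y(3) by auto
      then have "2 * pi * y = pi \<or> 2 * pi * y = - pi" by auto
      moreover have "cis pi = -1" "cis (- pi) = -1" by (simp_all add: complex_eq_iff)
      ultimately have "\<omega> = -1" unfolding y(5) by (elim disjE) (simp_all only:)
      then show ?thesis using \<omega> by simp
    qed (use y y' in simp)
  next
    assume "y\<^sup>2 + y'\<^sup>2 = 1"
    then have "(y - y')\<^sup>2 = 1 - 2 * (y * y')" by (simp add: power2_diff)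
    moreover have "y = y' \<or> (y - y')\<^sup>2 = 1" using d by auto
    ultimately have "y = y' \<or> y * y' = 0" by auto
    then show ?thesis using y y' by auto
  qed
qed

lemma characteristic_roots:
  obtains a b :: complex where "a\<^sup>2 + b\<^sup>2 = -1" "a\<^sup>2 * b\<^sup>2
      = complex_of_real (\<beta> / 4)"
    "\<And>r. r \<in> {a, - a, b, - b} \<Longrightarrow> r ^ 4 + r\<^sup>2 + complex_of_real (\<beta> / 4) = 0"
proof -
  define d where "d = csqrt (1 - complex_of_real \<beta>)"
  define a where "a = csqrt ((- 1 + d) / 2)"
  define b where "b = csqrt ((- 1 - d) / 2)"
  have d2: "d * d = 1 - complex_of_real \<beta>"
      using power2_csqrt[of "1 - complex_of_real \<beta>"] by (simp add: d_def power2_eq_square)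
  have a2: "a\<^sup>2 = (- 1 + d) / 2" and b2: "b\<^sup>2 = (- 1 - d) / 2" by (simp_all add: a_def b_def)
  have s: "a\<^sup>2 + b\<^sup>2 = -1" unfolding a2 b2 by (simp add: field_simps)
  have p: "a\<^sup>2 * b\<^sup>2 = complex_of_real (\<beta> / 4)" 
  proof -
    have "(- 1 + d) / 2 * ((- 1 - d) / 2) = (1 - d * d) / 4" by (simp add: field_simps)
    then show ?thesis unfolding a2 b2 d2 by simp
  qed
  have fac: "r ^ 4 + r\<^sup>2 + complex_of_real (\<beta> / 4)
      = (r\<^sup>2 - a\<^sup>2) * (r\<^sup>2 - b\<^sup>2)" for r
  proof -
    have "(r\<^sup>2 - a\<^sup>2) * (r\<^sup>2 - b\<^sup>2)
        = r ^ 4 - (a\<^sup>2 + b\<^sup>2) * r\<^sup>2 + a\<^sup>2 * b\<^sup>2"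
      by (simp add: algebra_simps flip: power_add)
    then show ?thesis unfolding s p by simp
  qed
  show thesis
    by (rule that[OF s p]) (auto simp only: fac insert_iff empty_iff power2_minus diff_self
        mult_zero_left mult_zero_right)
qed

text \<open>The equations for q' express \<open>v $ 1\<close> and \<open>v $ 2\<close> through the
  other components, and the equation for p1' then determines \<open>v $ 4\<close> from
  \<open>v $ 3\<close>, since \<mu> \<noteq> 0. The vector \<open>z\<close> is the only candidate
  with third component 1.\<close>

lemma Top_kernel_one_dim:
  assumes \<mu>: "\<mu> \<noteq> 0"
  shows "\<exists>z. \<forall>v. Top \<beta> \<mu> v = 0 \<longrightarrow> v \<in> vec.span {z}"
proof -
  define c where "c = (\<mu>\<^sup>2 - 1 - complex_of_real ((1 + sqrt (9 - \<beta>)) / 2)) / (2 * \<mu>)"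
  define z :: "complex ^ 4" where "z = vector [\<mu> - c, 1 + \<mu> * c, 1, c]"
  have "v = v $ 3 *s z" if v: "Top \<beta> \<mu> v = 0" for v
  proof -
    have e: "(complex_matrix (Xmat \<beta>) *v v) $ i = \<mu> * v $ i" for i
      using v by (simp add: Top_def vec_eq_iff)
    have v1: "v $ 1 = \<mu> * v $ 3 - v $ 4" using e[of 3] unfolding Xmat_vec by (simp add: algebra_simps)
    have v2: "v $ 2 = v $ 3 + \<mu> * v $ 4" using e[of 4] unfolding Xmat_vec by (simp add: algebra_simps)
    have "2 * \<mu> * v $ 4 = (\<mu>\<^sup>2 - 1 - complex_of_real ((1 + sqrt (9 - \<beta>)) / 2)) * v $ 3"
      using e[of 1] unfolding Xmat_vec v1 v2 by (simp add: algebra_simps power2_eq_square)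
    then have v4: "v $ 4 = c * v $ 3" using \<mu> by (simp add: c_def field_simps)
    show ?thesis
      unfolding vec_eq_iff forall_4 using v1 v2 v4 by (simp add: z_def algebra_simps)
  qed
  then show ?thesis by (metis vec.span_base vec.span_scale singletonI)
qed

lemma eigen_dim_circular:
  assumes \<beta>: "\<beta> \<in> {0<..9}" and \<omega>: "cmod \<omega> = 1" "\<omega> \<noteq> -1"
  shows "eigen_dim (gamma \<beta> 0 (2 * pi)) \<omega> \<le> 1"
proof -
  have \<beta>': "\<beta> \<in> {0..9}" and \<beta>0: "\<beta> > 0" using \<beta> by auto
  obtain a b :: complex where ab: "a\<^sup>2 + b\<^sup>2 = -1" "a\<^sup>2 * b\<^sup>2
      = complex_of_real (\<beta> / 4)"
    "\<And>r. r \<in> {a, - a, b, - b} \<Longrightarrow> r ^ 4 + r\<^sup>2 + complex_of_real (\<beta> / 4) = 0"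
    using characteristic_roots by blast
  \<comment> \<open>If no root has the exponential \<omega>, the uniqueness condition is vacuous and
    the default \<open>a\<close> serves.\<close>
  obtain \<mu> where \<mu>: "\<mu> \<in> {a, - a, b, - b}" "\<And>r. r \<in> {a, - a, b,
      - b} \<Longrightarrow> exp ((2 * pi) *\<^sub>R r) = \<omega> \<Longrightarrow> r = \<mu>"
  proof (cases "\<exists>r\<in>{a, - a, b, - b}. exp ((2 * pi) *\<^sub>R r) = \<omega>")
    case True
    then obtain \<mu> where "\<mu> \<in> {a, - a, b, - b}" "exp ((2 * pi) *\<^sub>R \<mu>) = \<omega>" by blast
    then show thesis using that unit_root_unique[OF ab(3) ab(3) \<beta>0 _ _ \<omega>] by blast
  next
    case False
    then show thesis using that[of a] by blast
  qed
  have "\<mu> \<noteq> 0" using ab(3)[OF \<mu>(1)] \<beta>0 by auto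
  then obtain z where z: "\<And>v. Top \<beta> \<mu> v
      = 0 \<Longrightarrow> v \<in> vec.span {z}" using Top_kernel_one_dim by blast
  have "{v. complex_matrix (gamma \<beta> 0 (2 * pi)) *v v = \<omega> *s v} \<subseteq> vec.span {z}"
  proof safe
    fix v assume K: "complex_flow \<beta> 0 v (2 * pi) = \<omega> *s v"
    show "v \<in> vec.span {z}"
      by (rule z, rule eigenspace_fold[OF \<beta>' Top_characteristic[OF _ ab(1,2)] K]) (use \<beta>
          \<mu>(2) in auto)
  qed
  from vec.dim_le_card[OF this] show ?thesis by (simp add: eigen_dim_def eigenspace_eq)
qed

section \<open>The eigenvalue \<open>-1\<close>\<close>

text \<open>cis (2 pi y) = -1 with |y| < 1 leaves y = 1/2 and y = -1/2, and then \<beta> = 4 (1/4)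
  (3/4) = 3/4.\<close>

lemma unit_root_minus_one:
  assumes m: "m ^ 4 + m\<^sup>2 + complex_of_real (\<beta> / 4) = 0" and \<beta>: "\<beta> > 0"
    and e: "exp ((2 * pi) *\<^sub>R m) = -1"
  shows "\<beta> = 3 / 4" "m = \<i> / 2 \<or> m = - (\<i> / 2)"
proof -
  obtain y where y: "m = \<i> * complex_of_real y" "y\<^sup>2 * (1 - y\<^sup>2)
      = \<beta> / 4" "0 < \<bar>y\<bar>" "\<bar>y\<bar> < 1" "-1 = cis (2 * pi * y)"
    by (rule unit_root[OF m \<beta> e]) simp
  have "cis (2 * pi * y) = cis (2 * pi * (1 / 2))"
    unfolding y(5)[symmetric] by (simp add: complex_eq_iff)
  then have "y - 1 / 2 \<in> \<int>" by (simp only: cis_2pi_eq_iff)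
  then have "y - 1 / 2 = 0 \<or> y - 1 / 2 = 1 \<or> y - 1 / 2 = -1"
    by (rule small_Ints) (use y(4) in linarith)
  then have y': "y = 1 / 2 \<or> y = - 1 / 2" using y(4) by auto
  then have "\<bar>y\<bar> = 1 / 2" by linarith
  then have "\<bar>y\<bar>\<^sup>2 = (1 / 2)\<^sup>2" by (simp only:)
  then have y2: "y\<^sup>2 = 1 / 4" by (simp add: power_divide)
  show "\<beta> = 3 / 4" using y(2) unfolding y2 by simp
  show "m = \<i> / 2 \<or> m = - (\<i> / 2)" using y' unfolding y(1) by (elim disjE) (simp_all only:, simp_all)
qed

text \<open>At \<beta> = 3/4 the roots are plus or minus i / 2 and plus or minus i sqrt 3 / 2. The
  second pair does not have the exponential -1, so its factors are cancelled and X^2 + 1/4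
  remains.\<close>

lemma minus_one_eigenvector_circular:
  assumes \<beta>: "\<beta> \<in> {0<..9}" and K: "complex_flow \<beta> 0 v (2 * pi)
      = (-1) *s v" and v: "v \<noteq> 0"
  shows "\<beta> = 3 / 4" "complex_matrix (Xmat \<beta>) *v (complex_matrix (Xmat \<beta>) *v v)
      = - (1 / 4) *s v"
proof -
  have \<beta>': "\<beta> \<in> {0..9}" and \<beta>0: "\<beta> > 0" and \<beta>9: "\<beta>
      \<le> 9" using \<beta> by auto
  obtain a b :: complex where ab: "a\<^sup>2 + b\<^sup>2 = -1" "a\<^sup>2 * b\<^sup>2
      = complex_of_real (\<beta> / 4)"
    "\<And>r. r \<in> {a, - a, b, - b} \<Longrightarrow> r ^ 4 + r\<^sup>2 + complex_of_real (\<beta> / 4) = 0"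
    using characteristic_roots by blast
  have "\<exists>r\<in>{a, - a, b, - b}. exp ((2 * pi) *\<^sub>R r) = -1"
  proof (rule ccontr)
    assume no: "\<not> ?thesis"
    have "v = 0"
      by (rule eigenspace_fold_strip[OF \<beta>' Top_characteristic[OF \<beta>9 ab(1,2)] K]) (use no in auto)
    then show False using v by simp
  qed
  then show \<beta>eq: "\<beta> = 3 / 4" using unit_root_minus_one[OF ab(3) \<beta>0] by blast
  define c where "c = \<i> / 2"
  define d where "d = \<i> * complex_of_real (sqrt 3 / 2)"
  have "complex_of_real ((sqrt 3 / 2)\<^sup>2) = complex_of_real (3 / 4)"
    by (simp only: power_divide) simp
  then have d2: "d\<^sup>2 = - (3 / 4)" unfolding d_def power_mult_distrib by simp
  have c2: "c\<^sup>2 = - (1 / 4)" by (simp add: c_def power_divide)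
  have cd: "c\<^sup>2 + d\<^sup>2 = -1" "c\<^sup>2 * d\<^sup>2 = complex_of_real (\<beta> / 4)"
    unfolding c2 d2 \<beta>eq by simp_all
  define u where "u = Top \<beta> (- c) (Top \<beta> c v)"
  have Ku: "complex_flow \<beta> 0 u (2 * pi) = (-1) *s u"
    unfolding u_def by (intro eigenspace_invariant[OF \<beta>'] K)
  have fu: "fold (Top \<beta>) [d, - d] u = 0"
    using Top_characteristic[OF \<beta>9 cd, of v] by (simp add: u_def)
  have "exp ((2 * pi) *\<^sub>R r) \<noteq> -1" if "r \<in> set [d, - d]" for r
  proof
    assume "exp ((2 * pi) *\<^sub>R r) = -1"
    have r2: "r\<^sup>2 = - (3 / 4)" using that d2 by auto
    have "r ^ 4 = r\<^sup>2 * r\<^sup>2" by (simp flip: power_add)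
    then have "r ^ 4 + r\<^sup>2 + complex_of_real (\<beta> / 4) = 0" unfolding r2 \<beta>eq by simp
    from unit_root_minus_one(2)[OF this \<beta>0 \<open>exp ((2 * pi) *\<^sub>R r) = -1\<close>]
    have "r\<^sup>2 = (\<i> / 2)\<^sup>2" by (elim disjE) (simp_all only: power2_minus)
    then show False using r2 by (simp add: power_divide)
  qed
  from eigenspace_fold_strip[OF \<beta>' fu Ku this] have "u = 0" by simp
  moreover have "u = complex_matrix (Xmat \<beta>) *v (complex_matrix (Xmat \<beta>) *v v) - c\<^sup>2 *s v"
    by (simp add: u_def Top_def matrix_vector_mult_diff_distrib vec.scale vec.scale_right_diff_distrib
        power2_eq_square)
  ultimately have "complex_matrix (Xmat \<beta>) *v (complex_matrix (Xmat \<beta>) *v v) = c\<^sup>2 *s v"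
    by (metis right_minus_eq)
  then show "complex_matrix (Xmat \<beta>) *v (complex_matrix (Xmat \<beta>) *v v) = - (1 / 4) *s v"
    unfolding c2 .
qed

lemma bounded_bilinear_complex_flow:
  "bounded_bilinear (\<lambda>(M :: real ^ 'n ^ 'n) v. complex_matrix M *v v)"
proof -
  have "bilinear (\<lambda>(M :: real ^ 'n ^ 'n) v. complex_matrix M *v v)"
    unfolding bilinear_def
    by (auto intro!: linearI simp: matrix_vector_mult_def vec_eq_iff sum.distrib algebra_simps scaleR_sum_right)
      (simp_all add: scaleR_conv_of_real mult_ac)
  then show ?thesis by (simp add: bilinear_conv_bounded_bilinear)
qed

lemma complex_flow_minus_one_eigenvector:
  fixes v :: "complex ^ 4"
  assumes \<beta>: "\<beta> \<in> {0..9}"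
    and X2: "complex_matrix (Xmat \<beta>) *v (complex_matrix (Xmat \<beta>) *v v)
        = - (1 / 4) *s v" and t: "t \<in> {0..2 * pi}"
  shows "complex_flow \<beta> 0 v t = cos (t / 2) *\<^sub>R v
      + (2 * sin (t / 2)) *\<^sub>R (complex_matrix (Xmat \<beta>) *v v)"
proof (rule linear_ode_unique[OF bounded_bilinear_complex_flow, where X
    = "\<lambda>t. Xmat \<beta>" and T = "2 * pi"
      and x = "complex_flow \<beta> 0 v"
      and y = "\<lambda>t. cos (t / 2) *\<^sub>R v + (2 * sin (t / 2)) *\<^sub>R (complex_matrix (Xmat
          \<beta>) *v v)"])
  have 0: "0 \<in> {-1<..<1 :: real}" by simp
  fix t assume t: "t \<in> {0..2 * pi}"
  have "(gamma \<beta> 0 has_vector_derivative Xmat \<beta> ** gamma \<beta> 0 t) (at t within {0..2 * pi})"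
    using gamma_deriv[OF \<beta> 0 t] unfolding Bmat_circular[of \<beta> t] .
  from bounded_bilinear.has_vector_derivative[OF bounded_bilinear_complex_flow this has_vector_derivative_const]
  show "(complex_flow \<beta> 0 v has_vector_derivative complex_matrix (Xmat \<beta>) *v complex_flow
      \<beta> 0 v t) (at t within {0..2 * pi})"
    by (simp add: complex_matrix_mult matrix_vector_mul_assoc)
  have "((\<lambda>t. cos (t / 2) *\<^sub>R v + (2 * sin (t / 2)) *\<^sub>R (complex_matrix (Xmat
      \<beta>) *v v)) has_vector_derivative
      (- sin (t / 2) / 2) *\<^sub>R v + cos (t / 2) *\<^sub>R (complex_matrix (Xmat \<beta>) *v v))
          (at t within {0..2 * pi})"
    by (auto intro!: derivative_eq_intros has_vector_derivative_scaleR[THEN has_vector_derivative_eq_rhs])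
  moreover have "complex_matrix (Xmat \<beta>) *v (cos (t / 2) *\<^sub>R v
      + (2 * sin (t / 2)) *\<^sub>R (complex_matrix (Xmat \<beta>) *v v))
     = (- sin (t / 2) / 2) *\<^sub>R v + cos (t / 2) *\<^sub>R (complex_matrix (Xmat \<beta>) *v v)"
  proof -
    interpret bounded_bilinear "\<lambda>(M :: real ^ 4 ^ 4) v. complex_matrix M *v v"
        by (rule bounded_bilinear_complex_flow)
    show ?thesis
      unfolding add_right scaleR_right X2 by (simp add: vec_eq_iff) (simp add: scaleR_conv_of_real)
  qed
  ultimately show "((\<lambda>t. cos (t / 2) *\<^sub>R v
      + (2 * sin (t / 2)) *\<^sub>R (complex_matrix (Xmat \<beta>) *v v)) has_vector_derivative
      complex_matrix (Xmat \<beta>) *v (cos (t / 2) *\<^sub>R v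
          + (2 * sin (t / 2)) *\<^sub>R (complex_matrix (Xmat \<beta>) *v v))) (at t within {0..2 * pi})"
    by simp
qed (use t gamma_0[OF \<beta>, of 0] in \<open>auto simp: complex_matrix_mat\<close>)

text \<open>Everything common to both systems cancels and only differences of the potential
  coefficients survive. One solution will be unperturbed, with e = 0, and the other will belong to a
  small e, so these differences are the perturbation itself.\<close>

lemma symplectic_pairing_deriv:
  fixes p1 p2 q1 q2 P1 P2 Q1 Q2 :: "real \<Rightarrow> 'a::real_inner"
  assumes sol: "sol_on \<beta>0 e0 p1 p2 q1 q2" and Sol: "sol_on \<beta> e P1 P2 Q1 Q2"
      and t: "t \<in> {0..2 * pi}"
  shows "((\<lambda>t. p1 t \<bullet> Q1 t + p2 t \<bullet> Q2 t - q1 t \<bullet> P1 t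
      - q2 t \<bullet> P2 t) has_real_derivative
    ((3 + sqrt (9 - \<beta>0)) / (2 * (1 + e0 * cos t)) - (3 + sqrt (9 - \<beta>)) / (2 * (1
        + e * cos t))) * (q1 t \<bullet> Q1 t)
    + ((3 - sqrt (9 - \<beta>0)) / (2 * (1 + e0 * cos t)) - (3 - sqrt (9 - \<beta>)) / (2 * (1
        + e * cos t))) * (q2 t \<bullet> Q2 t))
    (at t within {0..2 * pi})"
proof -
  note d = sol_onD[OF sol t] and D = sol_onD[OF Sol t]
  note dd = bounded_bilinear.has_vector_derivative[OF bounded_bilinear_inner]
  from has_vector_derivative_diff[OF has_vector_derivative_diff[OF has_vector_derivative_add[OF dd[OF
      d(1) D(3)] dd[OF d(2) D(4)]]
      dd[OF d(3) D(1)]] dd[OF d(4) D(2)]]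
  show ?thesis
    unfolding has_real_derivative_iff_has_vector_derivative
    by (rule has_vector_derivative_eq_rhs) (simp add: inner_simps inner_commute algebra_simps)
qed

text \<open>The solutions of frequency 1/2 at \<beta> = 3/4, which change sign over 2 pi. The number
  k is the ratio of the amplitudes of q2 and q1; the factors of p1 and p2 follow from p1 = q1' - q2
  and p2 = q2' + q1.\<close>

lemma sol_on_circular_resonance:
  fixes A B :: complex
  assumes k: "k\<^sup>2 = 7 / 2 * k - 1" "sqrt (9 - 3 / 4) = 2 * k - 7 / 2"
  shows "sol_on (3 / 4) 0
    (\<lambda>t. (k - 1 / 2) *\<^sub>R (cos (t / 2) *\<^sub>R B + sin (t / 2) *\<^sub>R A))
    (\<lambda>t. (1 - k / 2) *\<^sub>R (cos (t / 2) *\<^sub>R A - sin (t / 2) *\<^sub>R B))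
    (\<lambda>t. cos (t / 2) *\<^sub>R A - sin (t / 2) *\<^sub>R B) (\<lambda>t.
        - k *\<^sub>R (cos (t / 2) *\<^sub>R B + sin (t / 2) *\<^sub>R A))"
proof -
  have d: "((\<lambda>t. a *\<^sub>R (cos (t / 2) *\<^sub>R C + sin (t / 2) *\<^sub>R D)) has_vector_derivative
      (a / 2) *\<^sub>R (cos (t / 2) *\<^sub>R D - sin (t / 2) *\<^sub>R C))
          (at t within S)" for a t S and C D :: complex
    by (auto intro!: derivative_eq_intros has_vector_derivative_scaleR[THEN has_vector_derivative_eq_rhs]
        simp: algebra_simps)
  show ?thesis
    unfolding sol_on_def k(2)
  proof (intro ballI conjI)
    fix t :: real
    let ?c = "cos (t / 2)" and ?s = "sin (t / 2)"
    have "(1 - k / 2) *\<^sub>R (?c *\<^sub>R A - ?s *\<^sub>R B) - (1 - (3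
        + (2 * k - 7 / 2)) / (2 * (1 + 0 * cos t))) *\<^sub>R (?c *\<^sub>R A - ?s *\<^sub>R B)
      = ((k - 1 / 2) / 2) *\<^sub>R (?c *\<^sub>R A - ?s *\<^sub>R B)"
      unfolding scaleR_left_diff_distrib[symmetric]
          by (rule arg_cong[of _ _ "\<lambda>x. x *\<^sub>R _"]) (simp add: field_simps)
    then show "((\<lambda>t. (k - 1 / 2) *\<^sub>R (cos (t / 2) *\<^sub>R B
        + sin (t / 2) *\<^sub>R A)) has_vector_derivative
      (1 - k / 2) *\<^sub>R (?c *\<^sub>R A - ?s *\<^sub>R B) - (1 - (3 + (2 * k - 7 / 2)) / (2 * (1
          + 0 * cos t))) *\<^sub>R (?c *\<^sub>R A - ?s *\<^sub>R B))
      (at t within {0..2 * pi})"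
      using d[of "k - 1 / 2" B A t] by simp
    have "- ((k - 1 / 2) *\<^sub>R (?c *\<^sub>R B
        + ?s *\<^sub>R A)) - (1 - (3 - (2 * k - 7 / 2)) / (2 * (1
        + 0 * cos t))) *\<^sub>R (- k *\<^sub>R (?c *\<^sub>R B + ?s *\<^sub>R A))
      = (- (k - 1 / 2) - (1 - (3 - (2 * k - 7 / 2)) / 2) * (- k)) *\<^sub>R (?c *\<^sub>R B + ?s *\<^sub>R A)"
    proof -
      have "- (x *\<^sub>R u) - y *\<^sub>R (- k *\<^sub>R u)
          = (- x - y * - k) *\<^sub>R u" for x y :: real and u :: complex
        by (simp add: algebra_simps)
      then show ?thesis by (simp only: mult_zero_left add_0_right mult_1_right)
    qed
    also have "- (k - 1 / 2) - (1 - (3 - (2 * k - 7 / 2)) / 2) * (- k) = - ((1 - k / 2) / 2)"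
      using k(1) by (simp add: field_simps power2_eq_square)
    finally have eq: "- ((k - 1 / 2) *\<^sub>R (?c *\<^sub>R B
        + ?s *\<^sub>R A)) - (1 - (3 - (2 * k - 7 / 2)) / (2 * (1
        + 0 * cos t))) *\<^sub>R (- k *\<^sub>R (?c *\<^sub>R B + ?s *\<^sub>R A))
      = ((1 - k / 2) / 2) *\<^sub>R (?c *\<^sub>R (- B) - ?s *\<^sub>R A)" by (simp add: algebra_simps)
    show "((\<lambda>t. (1 - k / 2) *\<^sub>R (cos (t / 2) *\<^sub>R A
        - sin (t / 2) *\<^sub>R B)) has_vector_derivative
      - ((k - 1 / 2) *\<^sub>R (?c *\<^sub>R B + ?s *\<^sub>R A)) - (1 - (3 - (2 * k
          - 7 / 2)) / (2 * (1 + 0 * cos t))) *\<^sub>R (- k *\<^sub>R (?c *\<^sub>R B + ?s *\<^sub>R A)))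
      (at t within {0..2 * pi})"
      unfolding eq using d[of "1 - k / 2" A "- B" t] by simp
    show "((\<lambda>t. cos (t / 2) *\<^sub>R A - sin (t / 2) *\<^sub>R B) has_vector_derivative
      (k - 1 / 2) *\<^sub>R (?c *\<^sub>R B + ?s *\<^sub>R A) + - k *\<^sub>R (?c *\<^sub>R B
          + ?s *\<^sub>R A)) (at t within {0..2 * pi})"
      using d[of 1 A "- B" t] by (simp add: algebra_simps)
    show "((\<lambda>t. - k *\<^sub>R (cos (t / 2) *\<^sub>R B + sin (t / 2) *\<^sub>R A)) has_vector_derivative
      (1 - k / 2) *\<^sub>R (?c *\<^sub>R A - ?s *\<^sub>R B) - (?c *\<^sub>R A - ?s *\<^sub>R B))
          (at t within {0..2 * pi})"
      using d[of "- k" B A t] by (simp add: algebra_simps)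
  qed
qed

lemma integral_cos_affine_cos:
  fixes a b :: real
  shows "((\<lambda>t. cos t * (a + b * cos t)) has_integral b * pi) {0..2 * pi}"
proof -
  have "((\<lambda>t. cos t * (a + b * cos t)) has_integral
      (a * sin (2 * pi) + b * ((2 * pi) + sin (2 * pi) * cos (2 * pi)) / 2) - (a * sin 0 + b * (0
          + sin 0 * cos 0) / 2)) {0..2 * pi}"
  proof (rule fundamental_theorem_of_calculus)
    fix t :: real
    have "((\<lambda>t. a * sin t + b * (t + sin t * cos t) / 2) has_real_derivative
        a * cos t + b * (1 + (sin t * - sin t + cos t * cos t)) / 2) (at t within {0..2 * pi})"
      by (auto intro!: derivative_eq_intros)
    moreover have eq: "sin t * - sin t = cos t * cos t - 1"
      using sin_cos_squared_add[of t] by (simp add: power2_eq_square)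
    have "a * cos t + b * (1 + (sin t * - sin t + cos t * cos t)) / 2 = cos t * (a + b * cos t)"
      unfolding eq by (simp add: algebra_simps)
    ultimately show "((\<lambda>t. a * sin t + b * (t + sin t * cos t) / 2)
        has_vector_derivative cos t * (a + b * cos t)) (at t within {0..2 * pi})"
      by (simp only: has_real_derivative_iff_has_vector_derivative)
  qed simp
  then show ?thesis by simp
qed

lemma continuous_on_complex_flow:
  "continuous_on ((params \<times> UNIV) \<times> {0..2 * pi}) (\<lambda>x. complex_flow (fst (fst (fst
      x))) (snd (fst (fst x))) (snd (fst x)) (snd x))"
proof -
  have "continuous_on ((params \<times> (UNIV :: (complex ^ 4) set)) \<times> {0..2 * pi}) (\<lambda>x.
      (\<lambda>(p, t). gamma (fst p) (snd p) t) (fst (fst x), snd x))"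
    by (intro continuous_on_compose2[OF continuous_on_gamma] continuous_intros) auto
  then have "continuous_on ((params \<times> (UNIV :: (complex ^ 4) set)) \<times> {0..2 * pi})
      (\<lambda>x. gamma (fst (fst (fst x))) (snd (fst (fst x))) (snd x))"
    by simp
  then show ?thesis
    by (intro bounded_bilinear.continuous_on[OF bounded_bilinear_complex_flow] continuous_on_snd
        continuous_on_fst continuous_on_id)
qed

text \<open>To first order in \<open>e\<close> the two eigenvectors of \<open>-1\<close> at \<open>(3/4,
    0)\<close> are perturbed by the form
  \<open>\<integral> cos t ((3 + s) q\<^sub>1\<^sup>2
      + (3 - s) q\<^sub>2\<^sup>2)\<close>, which is nondegenerate on the eigenspace, so that the
  degeneracy curves have nonzero slope at \<open>e = 0\<close>.\<close>

lemma minus_one_curve_not_stationary: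
  fixes b :: "real \<Rightarrow> real"
  assumes b: "\<And>e. e \<in> {-1<..<1} \<Longrightarrow> b e \<in> {0<..<9}
      \<and> -1 \<in> cspectrum (gamma (b e) e (2 * pi))"
    and db: "(b has_real_derivative 0) (at 0)"
  shows False
proof -
  \<comment> \<open>The shift by two keeps \<open>e n\<close> inside (0, 1) already for n =
    0.\<close>
  define e :: "nat \<Rightarrow> real" where "e n = inverse (real (Suc (Suc n)))" for n
  have e: "e n \<in> {-1<..<1}" "e n \<noteq> 0" for n by (auto simp: e_def field_simps)
  have bn: "b (e n) \<in> {0..9}" for n using b[OF e(1)[of n]] by auto
  have e_lim: "e \<longlonglongrightarrow> 0" unfolding e_def[abs_def]
    using LIMSEQ_Suc[OF LIMSEQ_inverse_real_of_nat] by simp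
  have "\<exists>v. norm v = 1 \<and> complex_flow (b (e n)) (e n) v (2 * pi) = (-1) *s v" for n
  proof -
    obtain w where w: "w \<noteq> 0" "complex_flow (b (e n)) (e n) w (2 * pi) = (-1) *s w"
      using b[OF e(1)[of n]] by (auto simp: cspectrum_def)
    interpret bounded_bilinear "\<lambda>(M :: real ^ 4 ^ 4) v. complex_matrix M *v v"
        by (rule bounded_bilinear_complex_flow)
    have "complex_flow (b (e n)) (e n) ((1 / norm w) *\<^sub>R w) (2 * pi) = (-1) *s ((1 / norm w) *\<^sub>R w)"
      unfolding scaleR_right w(2) by (simp add: vec_eq_iff)
    then show ?thesis using w(1) by (intro exI[of _ "(1 / norm w) *\<^sub>R w"]) simp
  qed
  then obtain v where v: "\<And>n. norm (v n) = 1" "\<And>n. complex_flow (b (e n)) (e n) (v n) (2 * pi)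
      = (-1) *s v n"
    by metis
  have "seq_compact (sphere (0 :: complex ^ 4) 1)"
      using compact_sphere by (simp add: compact_eq_seq_compact_metric)
  then obtain v0 r where r: "strict_mono (r :: nat \<Rightarrow> nat)"
      and v0: "v0 \<in> sphere 0 1" "(v \<circ> r) \<longlonglongrightarrow> v0"
    using v(1) by (force simp: seq_compact_def)
  have v0nz: "v0 \<noteq> 0" using v0 by auto
  have er: "(\<lambda>n. e (r n)) \<longlonglongrightarrow> 0"
      using LIMSEQ_subseq_LIMSEQ[OF e_lim r] by (simp add: o_def)
  have vr: "(\<lambda>n. v (r n)) \<longlonglongrightarrow> v0" using v0 by (simp add: o_def)
  have "isCont b 0" using db by (rule DERIV_isCont)
  then have br: "(\<lambda>n. b (e (r n))) \<longlonglongrightarrow> b 0"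
      using er by (rule isCont_tendsto_compose)
  have b0: "b 0 \<in> {0<..<9}" "-1 \<in> cspectrum (gamma (b 0) 0 (2 * pi))" using b[of 0] by auto
  then have b0': "b 0 \<in> {0..9}" "b 0 \<in> {0<..9}" by auto
  have lim_in: "f x0 = 0"
    if f: "continuous_on U f" and x: "\<And>n. x n \<in> U" "x \<longlonglongrightarrow> x0" "x0 \<in> U"
        "\<And>n. f (x n) = 0"
    for f :: "'p::topological_space \<Rightarrow> 'q::{t2_space, zero}" and U
        and x :: "nat \<Rightarrow> 'p" and x0
  proof -
    have "(\<lambda>n. f (x n)) \<longlonglongrightarrow> f x0"
      using continuous_on_tendsto_compose[OF f x(2,3)] x(1) by simp
    then show ?thesis using x(4) LIMSEQ_unique[of "\<lambda>n. 0" "f x0" 0] by simp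
  qed
  have K0: "complex_flow (b 0) 0 v0 (2 * pi) = (-1) *s v0"
  proof -
    let ?f = "\<lambda>x. complex_flow (fst (fst x)) (snd (fst x)) (snd x) (2 * pi) + snd x"
    have "continuous_on (params \<times> UNIV) (\<lambda>x. complex_flow (fst (fst (fst (x, 2 * pi))))
        (snd (fst (fst (x, 2 * pi)))) (snd (fst (x, 2 * pi :: real))) (snd (x, 2 * pi)))"
      by (rule continuous_on_compose2[OF continuous_on_complex_flow]) (auto intro!: continuous_intros)
    then have "continuous_on (params \<times> UNIV) ?f"
        by (intro continuous_on_add) (simp_all add: continuous_on_snd continuous_on_id)
    then have "?f ((b 0, 0), v0) = 0"
    proof (rule lim_in)
      show "(\<lambda>n. ((b (e (r n)), e (r n)), v (r n))) \<longlonglongrightarrow> ((b 0, 0), v0)"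
        by (intro tendsto_Pair br er vr)
      show "?f ((b (e (r n)), e (r n)), v (r n)) = 0" for n
        using v(2)[of "r n"] by (simp add: vec_eq_iff)
    qed (use bn e b0' in auto)
    then have *: "complex_flow (b 0) 0 v0 (2 * pi) + v0 = 0" by simp
    then show ?thesis unfolding add_eq_0_iff2 by (simp add: vec_eq_iff)
  qed
  have b0eq: "b 0 = 3 / 4" and X2: "complex_matrix (Xmat (3 / 4)) *v (complex_matrix (Xmat (3 / 4)) *v
      v0) = - (1 / 4) *s v0"
    using minus_one_eigenvector_circular[OF b0'(2) K0 v0nz] by (simp_all only:)
  define s0 where "s0 = sqrt (9 - 3 / 4)"
  define k where "k = 7 / 4 + s0 / 2"
  have s0: "s0 > 0" "s0\<^sup>2 = 33 / 4" by (simp_all add: s0_def)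
  have "k\<^sup>2 = 7 / 2 * k - 1"
    using s0(2) by (simp add: k_def power2_eq_square field_simps)
  moreover have "sqrt (9 - 3 / 4) = 2 * k - 7 / 2"
    unfolding s0_def[symmetric] by (simp add: k_def)
  ultimately have k: "k\<^sup>2 = 7 / 2 * k - 1" "sqrt (9 - 3 / 4) = 2 * k - 7 / 2" .
  have s0k: "s0 = 2 * k - 7 / 2" by (simp add: k_def)
  have k0: "k > 7 / 4" using s0 by (simp add: k_def)
  \<comment> \<open>\<open>A\<close> and \<open>B\<close> are q1 (0) and 2 q1' (0) for the limit
    eigenvector, so that its orbit has q1 = cos (t / 2) A + sin (t / 2) B.\<close>
  define A where "A = v0 $ 3"
  define B where "B = 2 * (v0 $ 1 + v0 $ 4)"
  define kc where "kc = complex_of_real k"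
  have c: "complex_of_real ((1 + sqrt (9 - 3 / 4)) / 2)
      = kc - 5 / 4" "complex_of_real ((1 - sqrt (9 - 3 / 4)) / 2) = 9 / 4 - kc"
    unfolding k(2) by (simp_all add: kc_def field_simps)
  have kc2: "kc * kc = 7 / 2 * kc - 1"
    using arg_cong[OF k(1), of complex_of_real] by (simp add: kc_def power2_eq_square)
  have comp: "(complex_matrix (Xmat (3 / 4)) *v (complex_matrix (Xmat (3 / 4)) *v v0)) $ i
      = - (1 / 4) * v0 $ i" for i
    using X2 by simp
  have q2: "2 * (v0 $ 2 - v0 $ 3) = - kc * A"
    using comp[of 3] unfolding Xmat_vec c A_def by (simp add: algebra_simps)
  have v04: "v0 $ 4 = kc * B"
  proof -
    have "2 * v0 $ 1 = (3 / 2 - kc) * v0 $ 4"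
      using comp[of 4] unfolding Xmat_vec c by (simp add: algebra_simps)
    then have "B = (7 / 2 - kc) * v0 $ 4" by (simp add: B_def algebra_simps)
    then have "kc * B = kc * ((7 / 2 - kc) * v0 $ 4)" by (simp only:)
    then have "kc * B = (7 / 2 * kc - kc * kc) * v0 $ 4" by (simp add: algebra_simps)
    then show ?thesis by (simp add: kc2)
  qed
  \<comment> \<open>The test solution is the orbit of the limit eigenvector with B replaced by -B.
    Pairing the orbit with itself, the perturbation would give a multiple of |A|^2 - |B|^2, which
    can vanish; the pairing with this solution gives a multiple of |A|^2 + |B|^2.\<close>
  define q1 where "q1 t = cos (t / 2) *\<^sub>R A - sin (t / 2) *\<^sub>R B" for t
  define q2' where "q2' t = - k *\<^sub>R (cos (t / 2) *\<^sub>R B + sin (t / 2) *\<^sub>R A)" for t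
  define p1 where "p1 t = (k - 1 / 2) *\<^sub>R (cos (t / 2) *\<^sub>R B + sin (t / 2) *\<^sub>R A)" for t
  define p2 where "p2 t = (1 - k / 2) *\<^sub>R (cos (t / 2) *\<^sub>R A - sin (t / 2) *\<^sub>R B)" for t
  have sol: "sol_on (3 / 4) 0 p1 p2 q1 q2'"
    unfolding p1_def p2_def q1_def q2'_def by (rule sol_on_circular_resonance[OF k])
  have anti: "p1 (2 * pi) = - p1 0" "p2 (2 * pi) = - p2 0" "q1 (2 * pi) = - q1 0" "q2' (2 * pi) = - q2' 0"
    by (simp_all add: p1_def p2_def q1_def q2'_def)
  \<comment> \<open>The derivative of the pairing divided by e. The difference quotient \<eta> of s
    along the curve is treated as a separate parameter, so that the integrand is jointly continuous
    up to e = 0 and the limit can be taken under the integral.\<close>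
  define F where "F = (\<lambda>((\<eta>, p), w) t.
      ((- \<eta> + (3 + s0) * cos t) / (2 * (1 + snd p * cos t))) * (q1 t \<bullet> complex_flow (fst p)
          (snd p) w t $ 3)
      + ((\<eta> + (3 - s0) * cos t) / (2 * (1 + snd p * cos t))) * (q2' t \<bullet> complex_flow (fst p)
          (snd p) w t $ 4))"
  define \<eta> where "\<eta> n = (sqrt (9 - b (e n)) - s0) / e n" for n
  let ?U = "(UNIV \<times> params) \<times> UNIV :: ((real \<times> real \<times> real) \<times> (complex
      ^ 4)) set"
  have F_zero: "integral (cbox 0 (2 * pi)) (F ((\<eta> n, b (e n), e n), v n)) = 0" for n
  proof -
    define Z where "Z = complex_flow (b (e n)) (e n) (v n)"
    have Sol: "sol_on (b (e n)) (e n) (\<lambda>t. Z t $ 1) (\<lambda>t. Z t $ 2) (\<lambda>t. Z t $ 3)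
        (\<lambda>t. Z t $ 4)"
      unfolding Z_def by (rule complex_flow_sol_on[OF bn e(1)])
    have Z: "Z 0 = v n" "Z (2 * pi) = (-1) *s v n"
      using v(2) by (simp_all add: Z_def gamma_0[OF bn e(1)] complex_matrix_mat)
    let ?P = "\<lambda>t. p1 t \<bullet> Z t $ 3 + p2 t \<bullet> Z t $ 4 - q1 t \<bullet> Z t $ 1
        - q2' t \<bullet> Z t $ 2"
    have "((\<lambda>t. e n * F ((\<eta> n, b (e n), e n), v n) t)
        has_integral (?P (2 * pi) - ?P 0)) {0..2 * pi}"
    proof (rule fundamental_theorem_of_calculus)
      fix t assume t: "t \<in> {0..2 * pi}"
      have \<rho>: "1 + e n * cos t > 0" by (rule one_plus_e_cos_pos[OF e(1)])
      have coef: "(3 + s0) / (2 * (1 + 0 * cos t)) - (3 + s) / (2 * (1 + e n * cos t))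
          = e n * ((- ((s - s0) / e n) + (3 + s0) * cos t) / (2 * (1 + e n * cos t)))"
        "(3 - s0) / (2 * (1 + 0 * cos t)) - (3 - s) / (2 * (1 + e n * cos t))
            = e n * (((s - s0) / e n + (3 - s0) * cos t) / (2 * (1 + e n * cos t)))" for s
      proof -
        define R where "R = 1 + e n * cos t"
        have R: "R > 0" "e n * cos t = R - 1" using \<rho> by (simp_all add: R_def)
        have *: "e n * ((d / e n + x * cos t) / (2 * R)) = (d + x * (R - 1)) / (2 * R)" for d x
          unfolding R(2)[symmetric] using e(2)[of n] by (simp add: distrib_left mult_ac)
        show "(3 + s0) / (2 * (1 + 0 * cos t)) - (3 + s) / (2 * (1 + e n * cos t))
            = e n * ((- ((s - s0) / e n) + (3 + s0) * cos t) / (2 * (1 + e n * cos t)))"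
          unfolding R_def[symmetric] minus_divide_left * using R(1) by (simp add: field_simps)
        show "(3 - s0) / (2 * (1 + 0 * cos t)) - (3 - s) / (2 * (1 + e n * cos t))
            = e n * (((s - s0) / e n + (3 - s0) * cos t) / (2 * (1 + e n * cos t)))"
          unfolding R_def[symmetric] * using R(1) by (simp add: field_simps)
      qed
      have F_unfold: "F ((\<eta> n, b (e n), e n), v n) t =
          (- ((sqrt (9 - b (e n)) - s0) / e n) + (3 + s0) * cos t) / (2 * (1
              + e n * cos t)) * (q1 t \<bullet> Z t $ 3)
          + ((sqrt (9 - b (e n)) - s0) / e n + (3 - s0) * cos t) / (2 * (1
              + e n * cos t)) * (q2' t \<bullet> Z t $ 4)"
        by (simp only: F_def \<eta>_def Z_def prod.case fst_conv snd_conv)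
      show "(?P has_vector_derivative e n * F ((\<eta> n, b (e n), e n), v n) t) (at t within {0..2 * pi})"
        using symplectic_pairing_deriv[OF sol Sol t]
        unfolding has_real_derivative_iff_has_vector_derivative s0_def[symmetric] coef
        unfolding F_unfold unfolding distrib_left mult.assoc .
    qed simp
    moreover have "?P (2 * pi) - ?P 0 = 0"
      unfolding anti Z by simp
    ultimately have "((\<lambda>t. e n * F ((\<eta> n, b (e n), e n), v n) t)
        has_integral 0) {0..2 * pi}" by simp
    from has_integral_mult_right[OF this, of "1 / e n"]
    have "(F ((\<eta> n, b (e n), e n), v n) has_integral 0) {0..2 * pi}" using e(2)[of n] by simp
    then show ?thesis by (simp add: integral_unique)
  qed
  have Fc: "continuous_on (?U \<times> cbox 0 (2 * pi)) (\<lambda>(x, t). F x t)"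
  proof -
    let ?V = "?U \<times> {0..2 * pi}"
    have q: "continuous_on ?V (\<lambda>x. q1 (snd x))" "continuous_on ?V (\<lambda>x. q2' (snd x))"
      unfolding q1_def q2'_def by (auto intro!: continuous_intros)
    have fl: "continuous_on ?V (\<lambda>x. complex_flow (fst (snd (fst (fst x)))) (snd (snd (fst (fst
        x)))) (snd (fst x)) (snd x) $ i)" for i
    proof -
      have "continuous_on ?V (\<lambda>x. complex_flow (fst (fst (fst ((snd (fst (fst x)), snd (fst x)),
          snd x)))) (snd (fst (fst ((snd (fst (fst x)), snd (fst x)), snd x)))) (snd (fst ((snd (fst (fst
          x)), snd (fst x)), snd x))) (snd ((snd (fst (fst x)), snd (fst x)), snd x)))"
        by (rule continuous_on_compose2[OF continuous_on_complex_flow]) (auto intro!: continuous_intros)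
      then show ?thesis by (intro continuous_on_component) simp
    qed
    have \<rho>: "\<forall>x\<in>?V. 2 * (1 + snd (snd (fst (fst x))) * cos (snd x)) \<noteq> 0"
    proof
      fix x assume "x \<in> ?V"
      then show "2 * (1 + snd (snd (fst (fst x))) * cos (snd x)) \<noteq> 0"
        using one_plus_e_cos_pos[of "snd (snd (fst (fst x)))" "snd x"] by (auto simp: mem_Times_iff)
    qed
    have "continuous_on ?V (\<lambda>x. ((- fst (fst (fst x)) + (3 + s0) * cos (snd x)) / (2 * (1
        + snd (snd (fst (fst x))) * cos (snd x)))) * (q1 (snd x) \<bullet> complex_flow (fst (snd (fst
        (fst x)))) (snd (snd (fst (fst x)))) (snd (fst x)) (snd x) $ 3)
      + ((fst (fst (fst x)) + (3 - s0) * cos (snd x)) / (2 * (1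
          + snd (snd (fst (fst x))) * cos (snd x)))) * (q2' (snd x) \<bullet> complex_flow (fst (snd (fst
          (fst x)))) (snd (snd (fst (fst x)))) (snd (fst x)) (snd x) $ 4))"
      by (intro continuous_on_add continuous_on_mult continuous_on_divide continuous_on_inner q fl \<rho>
          continuous_on_minus continuous_on_const continuous_on_cos continuous_on_fst continuous_on_snd
              continuous_on_id)
    then show ?thesis by (simp add: F_def split_beta)
  qed
  \<comment> \<open>Stationarity of b enters here: as b 0 = 3/4 < 9, the square root is
    differentiable at that point and the quotient tends to 0.\<close>
  have \<eta>_lim: "(\<lambda>n. \<eta> (r n)) \<longlonglongrightarrow> 0"
  proof -
    have "((\<lambda>x. sqrt (9 - b x)) has_real_derivative - 0 * (inverse (sqrt (9 - b 0)) / 2)) (at 0)"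
      using b0 by (auto intro!: derivative_eq_intros db)
    then have "((\<lambda>x. (sqrt (9 - b x) - sqrt (9 - b 0)) / (x - 0)) \<longlongrightarrow> 0) (at 0)"
      by (simp add: has_field_derivative_iff)
    then have *: "((\<lambda>x. (sqrt (9 - b x) - s0) / x) \<longlongrightarrow> 0)
        (at 0)" unfolding b0eq by (simp add: s0_def)
    have "filterlim (\<lambda>n. e (r n)) (at 0) sequentially"
      using er e(2) by (simp add: filterlim_at)
    from filterlim_compose[OF * this] show ?thesis by (simp add: \<eta>_def)
  qed
  have "integral (cbox 0 (2 * pi)) (F ((0, b 0, 0), v0)) = 0"
    using integral_continuous_on_param[OF Fc]
  proof (rule lim_in)
    show "(\<lambda>n. ((\<eta> (r n), b (e (r n)), e (r n)), v (r n))) \<longlonglongrightarrow> ((0, b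
        0, 0), v0)"
      by (intro tendsto_Pair br er vr \<eta>_lim)
  qed (use bn e b0' F_zero in auto)
  then have I0: "integral {0..2 * pi} (F ((0, b 0, 0), v0)) = 0" by simp
  define N where "N = A \<bullet> A + B \<bullet> B"
  define D where "D = A \<bullet> A - B \<bullet> B"
  have F_eq: "F ((0, b 0, 0), v0) t = cos t * (((3 + s0) - k\<^sup>2 * (s0 - 3)) * D / 4 + ((3
      + s0) - k\<^sup>2 * (3 - s0)) * N / 4 * cos t)"
    if t: "t \<in> {0..2 * pi}" for t
  proof -
    have Z: "complex_flow (b 0) 0 v0 t $ 3 = cos (t / 2) *\<^sub>R A + sin (t / 2) *\<^sub>R B"
      "complex_flow (b 0) 0 v0 t $ 4 = k *\<^sub>R (cos (t / 2) *\<^sub>R B - sin (t / 2) *\<^sub>R A)"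
    proof -
      note flow = complex_flow_minus_one_eigenvector[OF _ X2 t]
      have "complex_flow (b 0) 0 v0 t $ 3 = cos (t / 2) *\<^sub>R v0 $ 3
          + (2 * sin (t / 2)) *\<^sub>R (v0 $ 1 + v0 $ 4)"
        unfolding b0eq by (subst flow) (simp_all add: Xmat_vec)
      then show "complex_flow (b 0) 0 v0 t $ 3 = cos (t / 2) *\<^sub>R A + sin (t / 2) *\<^sub>R B"
        by (simp add: A_def B_def scaleR_conv_of_real algebra_simps)
      have "complex_flow (b 0) 0 v0 t $ 4 = cos (t / 2) *\<^sub>R v0 $ 4
          + (2 * sin (t / 2)) *\<^sub>R (v0 $ 2 - v0 $ 3)"
        unfolding b0eq by (subst flow) (simp_all add: Xmat_vec)
      then have "complex_flow (b 0) 0 v0 t $ 4 = cos (t / 2) *\<^sub>R v0 $ 4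
          + sin (t / 2) *\<^sub>R (2 * (v0 $ 2 - v0 $ 3))"
        by (simp add: scaleR_conv_of_real algebra_simps)
      then show "complex_flow (b 0) 0 v0 t $ 4 = k *\<^sub>R (cos (t / 2) *\<^sub>R B
          - sin (t / 2) *\<^sub>R A)"
        unfolding q2 v04 by (simp add: kc_def scaleR_conv_of_real algebra_simps)
    qed
    have c2: "(cos (t / 2))\<^sup>2 = (1 + cos t) / 2" "(sin (t / 2))\<^sup>2 = (1 - cos t) / 2"
      using cos_double_cos[of "t / 2"] by (simp_all add: sin_squared_eq)
    have "q1 t \<bullet> (cos (t / 2) *\<^sub>R A + sin (t / 2) *\<^sub>R B)
        = (cos (t / 2))\<^sup>2 * (A \<bullet> A) - (sin (t / 2))\<^sup>2 * (B \<bullet> B)"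
      by (simp add: q1_def inner_simps inner_commute power2_eq_square algebra_simps)
    then have i1: "q1 t \<bullet> (cos (t / 2) *\<^sub>R A + sin (t / 2) *\<^sub>R B) = (D + N * cos t) / 2"
      unfolding c2 by (simp add: N_def D_def field_simps)
    have "q2' t \<bullet> (k *\<^sub>R (cos (t / 2) *\<^sub>R B - sin (t / 2) *\<^sub>R A))
        = k\<^sup>2 * ((sin (t / 2))\<^sup>2 * (A \<bullet> A) - (cos (t / 2))\<^sup>2 * (B \<bullet> B))"
      by (simp add: q2'_def inner_simps inner_commute power2_eq_square algebra_simps)
    then have i2: "q2' t \<bullet> (k *\<^sub>R (cos (t / 2) *\<^sub>R B - sin (t / 2) *\<^sub>R A))
        = k\<^sup>2 * ((D - N * cos t) / 2)"
      unfolding c2 by (simp add: N_def D_def field_simps)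
    have "F ((0, b 0, 0), v0) t = (3 + s0) * cos t / 2 * (q1 t \<bullet> complex_flow (b 0) 0 v0 t $ 3)
        + (3 - s0) * cos t / 2 * (q2' t \<bullet> complex_flow (b 0) 0 v0 t $ 4)"
      by (simp add: F_def)
    then show ?thesis
      unfolding Z i1 i2 by (simp add: field_simps)
  qed
  have "(F ((0, b 0, 0), v0) has_integral ((3 + s0) - k\<^sup>2 * (3 - s0)) * N / 4 * pi) {0..2 * pi}"
    by (rule has_integral_eq[OF _ integral_cos_affine_cos[of "((3 + s0) - k\<^sup>2 * (s0 - 3)) * D / 4"]])
       (use F_eq in simp)
  then have "((3 + s0) - k\<^sup>2 * (3 - s0)) * N / 4 * pi = 0" using I0 by (simp add: integral_unique)
  \<comment> \<open>With s0 = 2 k - 7/2 and the quadratic equation for k the coefficient becomes 7 k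
    / 4 - 1, which is positive because k > 7/4.\<close>
  moreover have "(3 + s0) - k\<^sup>2 * (3 - s0) = 7 / 4 * k - 1"
  proof -
    have "(3 + s0) - k\<^sup>2 * (3 - s0) = 2 * k - 1 / 2 - (7 / 2 * k - 1) * (13 / 2 - 2 * k)"
      unfolding k(1) s0k by (simp add: algebra_simps)
    also have "\<dots> = 7 * k\<^sup>2 - 91 / 4 * k + 6" by (simp add: algebra_simps power2_eq_square)
    finally show ?thesis unfolding k(1) by simp
  qed
  ultimately have "N = 0" using k0 by simp
  then have "A = 0" "B = 0"
    unfolding N_def by (simp_all add: add_nonneg_eq_0_iff)
  then have v3: "v0 $ 3 = 0" and v4: "v0 $ 4 = 0" using v04 by (simp_all add: A_def)
  have "v0 $ 1 = 0" using \<open>B = 0\<close> by (simp add: B_def v4)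
  moreover have "v0 $ 2 = 0" using q2 \<open>A = 0\<close> by (simp add: v3)
  moreover note v3 v4
  ultimately show False using v0nz by (simp add: vec_eq_iff forall_4)
qed

section \<open>The boundary of the hyperbolic region\<close>

lemma zero_in_unit_spectrum:
  "e \<in> {-1<..<1} \<Longrightarrow> cspectrum (gamma 0 e (2 * pi)) \<inter> sphere 0 1 \<noteq> {}"
  using one_in_cspectrum_0 by force

lemma real_analytic_on_differentiable:
  assumes "real_analytic_on f S" "x \<in> S"
  shows "\<exists>D. (f has_real_derivative D) (at x)"
proof -
  obtain F where F: "(\<lambda>h. f (x + h)) has_fps_expansion F"
    using assms unfolding real_analytic_on_def by blast
  have "(eval_fps F has_real_derivative eval_fps (fps_deriv F) 0) (at 0)"
    by (rule has_field_derivative_eval_fps) (use F in \<open>auto simp: has_fps_expansion_def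
        zero_ereal_def\<close>)
  moreover have "\<forall>\<^sub>F h in nhds 0. eval_fps F h = f (x + h)"
    using F by (simp add: has_fps_expansion_def)
  ultimately have "((\<lambda>h. f (x + h)) has_real_derivative eval_fps (fps_deriv F) 0) (at 0)"
    by (simp only: DERIV_cong_ev[OF refl _ refl])
  then have "(f has_real_derivative eval_fps (fps_deriv F) 0) (at (0 + x))"
    unfolding DERIV_shift by (simp only: add.commute)
  then show ?thesis by auto
qed

section \<open>Limits of unit eigenvalues\<close>

lemma unit_spectrum_tendsto:
  assumes \<omega>: "\<omega> \<longlonglongrightarrow> \<omega>0"
      and e: "e \<longlonglongrightarrow> e0" "\<And>n. e n \<in> {-1<..<1}" "e0 \<in> {-1<..<1}"
    and \<beta>: "\<beta> \<longlonglongrightarrow> b" "\<And>n. \<beta> n \<in> {0..9}"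
    and spec: "\<And>n. \<omega> n \<in> cspectrum (gamma (\<beta> n) (e n) (2 * pi))"
  shows "\<omega>0 \<in> cspectrum (gamma b e0 (2 * pi))"
proof -
  let ?f = "\<lambda>x. char_det (fst (fst x)) (snd (fst x)) (snd x)"
  have b: "b \<in> {0..9}" using closed_sequentially[OF closed_atLeastAtMost \<beta>(2,1)] .
  have "(\<lambda>n. ?f ((\<beta> n, e n), \<omega> n)) \<longlonglongrightarrow> ?f ((b, e0), \<omega>0)"
  proof (rule continuous_on_tendsto_compose[OF continuous_on_char_det])
    show "(\<lambda>n. ((\<beta> n, e n), \<omega> n)) \<longlonglongrightarrow> ((b, e0), \<omega>0)"
      by (intro tendsto_Pair \<omega> e \<beta>)
  qed (use b \<beta> e in \<open>auto intro!: always_eventually\<close>)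
  moreover have "?f ((\<beta> n, e n), \<omega> n) = 0" for n
    using spec[of n] by (simp add: mem_cspectrum_iff_det)
  ultimately have "?f ((b, e0), \<omega>0) = 0" by (simp add: LIMSEQ_const_iff)
  then show ?thesis by (simp add: mem_cspectrum_iff_det)
qed

lemma unit_spectrum_limit:
  assumes \<omega>: "\<omega> \<longlonglongrightarrow> \<omega>0" and e: "e \<in> {-1<..<1}"
      and \<beta>: "\<And>n. \<beta> n \<in> {c..d}" "{c..d} \<subseteq> {0..9}"
    and spec: "\<And>n. \<omega> n \<in> cspectrum (gamma (\<beta> n) e (2 * pi))"
  shows "\<exists>b\<in>{c..d}. \<omega>0 \<in> cspectrum (gamma b e (2 * pi))"
proof -
  have "seq_compact {c..d}" by (simp add: compact_eq_seq_compact_metric[symmetric])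
  then obtain b r where b: "b \<in> {c..d}" and r: "strict_mono (r :: nat \<Rightarrow> nat)"
      and lim: "(\<beta> \<circ> r) \<longlonglongrightarrow> b"
    using \<beta>(1) by (metis seq_compactE)
  have "\<beta> n \<in> {0..9}" for n using \<beta>(1)[of n] \<beta>(2) by blast
  then have "\<omega>0 \<in> cspectrum (gamma b e (2 * pi))"
    by (intro unit_spectrum_tendsto[OF LIMSEQ_subseq_LIMSEQ[OF \<omega> r] tendsto_const e e lim]) (use
        spec in auto)
  then show ?thesis using b by blast
qed

text \<open>The complement of the hyperbolic parameters: one unit eigenvalue is enough, the others
  may lie off the circle.\<close>

definition elliptic :: "real \<Rightarrow> real set" where
  "elliptic e = {\<beta>\<in>{0..9}. cspectrum (gamma \<beta> e (2 * pi)) \<inter> sphere 0 1 \<noteq> {}}"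

text \<open>The eigenvalues on the circle have a convergent subsequence by compactness, and its
  limit is an eigenvalue by joint continuity of the determinant. With constant e this gives
  closedness of the set, with varying e the upper semicontinuity of \<open>beta_k\<close>.\<close>

lemma elliptic_tendsto:
  assumes e: "e \<longlonglongrightarrow> e0" "\<And>n. e n \<in> {-1<..<1}" "e0 \<in> {-1<..<1}"
    and \<beta>: "\<beta> \<longlonglongrightarrow> b" "\<And>n. \<beta> n \<in> elliptic (e n)"
  shows "b \<in> elliptic e0"
proof -
  have \<beta>9: "\<beta> n \<in> {0..9}" for n using \<beta>(2)[of n] by (simp add: elliptic_def)
  have "\<exists>\<omega>. \<omega> \<in> cspectrum (gamma (\<beta> n) (e n) (2 * pi))
      \<and> \<omega> \<in> sphere 0 1" for n
    using \<beta>(2)[of n] by (auto simp: elliptic_def)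
  then obtain \<omega> where \<omega>: "\<And>n. \<omega> n \<in> cspectrum (gamma (\<beta> n) (e n) (2 *
      pi))" "\<And>n. \<omega> n \<in> sphere 0 1"
    by metis
  have "seq_compact (sphere (0 :: complex) 1)" using compact_sphere by (simp add: compact_eq_seq_compact_metric)
  then obtain \<omega>0 r where \<omega>0: "\<omega>0 \<in> sphere 0 1"
      and r: "strict_mono (r :: nat \<Rightarrow> nat)"
      and lim: "(\<omega> \<circ> r) \<longlonglongrightarrow> \<omega>0"
    using \<omega>(2) by (metis seq_compactE)
  have "\<omega>0 \<in> cspectrum (gamma b e0 (2 * pi))"
    by (rule unit_spectrum_tendsto[OF lim LIMSEQ_subseq_LIMSEQ[OF e(1) r] _ e(3) LIMSEQ_subseq_LIMSEQ[OF
        \<beta>(1) r]])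
       (use e \<beta>9 \<omega> in auto)
  moreover have "b \<in> {0..9}" using closed_sequentially[OF closed_atLeastAtMost \<beta>9 \<beta>(1)] .
  ultimately show ?thesis using \<omega>0 by (auto simp: elliptic_def)
qed

section \<open>Symmetry of the degeneracy curves\<close>

locale degeneracy_data =
  fixes b1 b2 :: "real \<Rightarrow> complex \<Rightarrow> real"
  assumes curves: "degeneracy_curves b1 b2"
begin

lemma curve:
  assumes "cmod \<omega> = 1" "\<omega> \<noteq> 1" "b \<in> {b1, b2}"
  shows "real_analytic_on (\<lambda>e. b e \<omega>) {-1<..<1}" "(\<lambda>e. b e \<omega>) \<in>
      {-1<..<1} \<rightarrow> {0<..<9}"
proof -
  have "\<omega> \<in> sphere 0 1 - {1}" using assms by simp
  from bspec[OF bspec[OF curves[unfolded degeneracy_curves_def, THEN conjunct1] this] assms(3)]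
  show "real_analytic_on (\<lambda>e. b e \<omega>) {-1<..<1}" "(\<lambda>e. b e \<omega>) \<in>
      {-1<..<1} \<rightarrow> {0<..<9}"
    by simp_all
qed

lemma analytic:
  assumes "cmod \<omega> = 1" "\<omega> \<noteq> 1"
  shows "real_analytic_on (\<lambda>e. b1 e \<omega>) {-1<..<1}" "real_analytic_on (\<lambda>e. b2 e
      \<omega>) {-1<..<1}"
  using curve(1)[OF assms] by simp_all

lemma range:
  assumes "cmod \<omega> = 1" "\<omega> \<noteq> 1" "e \<in> {-1<..<1}"
  shows "b1 e \<omega> \<in> {0<..<9}" "b2 e \<omega> \<in> {0<..<9}"
  by (rule funcset_mem[OF curve(2)[OF assms(1,2)] assms(3)], simp)+

lemma eigen_dim_eq:
  assumes "cmod \<omega> = 1" "\<omega> \<noteq> 1" "e \<in> {-1<..<1}" "\<beta> \<in> {0..9}"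
  shows "eigen_dim (gamma \<beta> e (2 * pi)) \<omega> = of_bool (\<beta>
      = b1 e \<omega>) + of_bool (\<beta> = b2 e \<omega>)"
proof -
  have "\<omega> \<in> sphere 0 1 - {1}" using assms by simp
  from bspec[OF bspec[OF bspec[OF curves[unfolded degeneracy_curves_def, THEN conjunct2, THEN conjunct1]
      this] assms(3)] assms(4)]
  show ?thesis .
qed

lemma mem_cspectrum_iff:
  assumes "cmod \<omega> = 1" "\<omega> \<noteq> 1" "e \<in> {-1<..<1}" "\<beta> \<in> {0..9}"
  shows "\<omega> \<in> cspectrum (gamma \<beta> e (2 * pi))
      \<longleftrightarrow> \<beta> = b1 e \<omega> \<or> \<beta> = b2 e \<omega>"
  unfolding mem_cspectrum_iff_eigen_dim eigen_dim_eq[OF assms] by auto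

lemma b1_in_cspectrum:
  assumes "cmod \<omega> = 1" "\<omega> \<noteq> 1" "e \<in> {-1<..<1}"
  shows "\<omega> \<in> cspectrum (gamma (b1 e \<omega>) e (2 * pi))"
  using mem_cspectrum_iff[OF assms, of "b1 e \<omega>"] range[OF assms] by simp

lemma b2_in_cspectrum:
  assumes "cmod \<omega> = 1" "\<omega> \<noteq> 1" "e \<in> {-1<..<1}"
  shows "\<omega> \<in> cspectrum (gamma (b2 e \<omega>) e (2 * pi))"
  using mem_cspectrum_iff[OF assms, of "b2 e \<omega>"] range[OF assms] by simp

lemma at_one:
  assumes "e \<in> {-1<..<1}"
  shows "b1 e 1 = 0" "b2 e 1 = 0"
  using bspec[OF curves[unfolded degeneracy_curves_def, THEN conjunct2, THEN conjunct2] assms] by simp_all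

text \<open>The kernel dimensions at e and -e agree, so the two curves take the same values with the
  same multiplicities; evaluating the count at the curve values recovers the unordered pair.\<close>

lemma reflected_pair:
  assumes "cmod \<omega> = 1" "\<omega> \<noteq> 1" "e \<in> {-1<..<1}"
  shows "b1 (- e) \<omega> = b1 e \<omega> \<and> b2 (- e) \<omega>
      = b2 e \<omega> \<or> b1 (- e) \<omega> = b2 e \<omega> \<and> b2 (- e) \<omega> = b1 e \<omega>"
proof -
  have e': "- e \<in> {-1<..<1}" using assms by auto
  have eq: "of_bool (\<beta> = b1 (- e) \<omega>) + of_bool (\<beta> = b2 (- e) \<omega>)
      = (of_bool (\<beta> = b1 e \<omega>) + of_bool (\<beta> = b2 e \<omega>) :: nat)"
    if "\<beta> \<in> {0..9}" for \<beta>
    using eigen_dim_gamma_minus[OF that assms(3), of \<omega>]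
    unfolding eigen_dim_eq[OF assms that] eigen_dim_eq[OF assms(1,2) e' that] .
  have "b1 e \<omega> \<in> {0..9}" "b2 e \<omega> \<in> {0..9}" "b1 (- e) \<omega> \<in> {0..9}" "b2 (-
      e) \<omega> \<in> {0..9}"
    using range[OF assms] range[OF assms(1,2) e'] by auto
  note eqs = this[THEN eq]
  show ?thesis
  proof (cases "b1 e \<omega> = b1 (- e) \<omega>")
    case True
    moreover have "b2 e \<omega> = b2 (- e) \<omega>"
      using eqs(2) True by (cases "b2 e \<omega> = b2 (- e) \<omega>") simp_all
    ultimately show ?thesis by simp
  next
    case False
    then have "b1 e \<omega> = b2 (- e) \<omega>" using eqs(1) by (cases "b1 e \<omega>
        = b2 (- e) \<omega>") simp_all
    moreover from this have "b2 e \<omega> = b1 (- e) \<omega>"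
      using eqs(2) False by (cases "b2 e \<omega> = b1 (- e) \<omega>") simp_all
    ultimately show ?thesis by simp
  qed
qed

text \<open>At each e one of the factors b1 (e) - b1 (-e) and b2 (e) - b1 (-e) vanishes, but which
  one might depend on e. Both are analytic, so one of them vanishes identically.\<close>

lemma even_or_swapped:
  assumes "cmod \<omega> = 1" "\<omega> \<noteq> 1"
  shows "(\<forall>e\<in>{-1<..<1}. b1 (- e) \<omega> = b1 e \<omega> \<and> b2 (- e) \<omega>
      = b2 e \<omega>) \<or>
    (\<forall>e\<in>{-1<..<1}. b1 (- e) \<omega> = b2 e \<omega> \<and> b2 (- e) \<omega> = b1 e \<omega>)"
proof -
  have "(\<forall>e\<in>{-1<..<1}. b1 e \<omega> - b1 (- e) \<omega>
      = 0) \<or> (\<forall>e\<in>{-1<..<1}. b2 e \<omega> - b1 (- e) \<omega> = 0)"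
  proof (rule real_analytic_on_mult_eq_0)
    have m: "real_analytic_on (\<lambda>e. b1 (- e) \<omega>) {-1<..<1}"
      by (rule real_analytic_on_mirror[OF analytic(1)[OF assms]])
    show "real_analytic_on (\<lambda>e. b1 e \<omega>
        - b1 (- e) \<omega>) {-1<..<1}" "real_analytic_on (\<lambda>e. b2 e \<omega>
        - b1 (- e) \<omega>) {-1<..<1}"
      by (intro real_analytic_on_diff analytic[OF assms] m)+
    show "(b1 e \<omega> - b1 (- e) \<omega>) * (b2 e \<omega> - b1 (- e) \<omega>)
        = 0" if "e \<in> {-1<..<1}" for e
      using reflected_pair[OF assms that] by auto
  qed
  then show ?thesis
  proof (elim disjE)
    assume *: "\<forall>e\<in>{-1<..<1}. b1 e \<omega> - b1 (- e) \<omega> = 0"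
    have "b1 (- e) \<omega> = b1 e \<omega> \<and> b2 (- e) \<omega>
        = b2 e \<omega>" if "e \<in> {-1<..<1}" for e
      using bspec[OF * that] reflected_pair[OF assms that] by auto
    then show ?thesis by blast
  next
    assume *: "\<forall>e\<in>{-1<..<1}. b2 e \<omega> - b1 (- e) \<omega> = 0"
    have "b1 (- e) \<omega> = b2 e \<omega> \<and> b2 (- e) \<omega>
        = b1 e \<omega>" if "e \<in> {-1<..<1}" for e
      using bspec[OF * that] reflected_pair[OF assms that] by auto
    then show ?thesis by blast
  qed
qed

lemma even_nonreal:
  assumes "cmod \<omega> = 1" "\<omega> \<noteq> 1" "\<omega> \<noteq> -1" "e \<in> {-1<..<1}"
  shows "b1 (- e) \<omega> = b1 e \<omega> \<and> b2 (- e) \<omega> = b2 e \<omega>"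
proof -
  have 0: "0 \<in> {-1<..<1 :: real}" by simp
  have "b1 0 \<omega> \<noteq> b2 0 \<omega>"
  proof
    assume eq: "b1 0 \<omega> = b2 0 \<omega>"
    have "b1 0 \<omega> \<in> {0<..9}" "b1 0 \<omega> \<in> {0..9}" using range[OF assms(1,2) 0] by auto
    then have "eigen_dim (gamma (b1 0 \<omega>) 0 (2 * pi)) \<omega> \<le> 1"
      by (intro eigen_dim_circular assms)
    moreover have "eigen_dim (gamma (b1 0 \<omega>) 0 (2 * pi)) \<omega> = 2"
      using eigen_dim_eq[OF assms(1,2) 0 \<open>b1 0 \<omega> \<in> {0..9}\<close>] eq by simp
    ultimately show False by simp
  qed
  moreover have "b1 0 \<omega> = b2 0 \<omega>" if "\<forall>e\<in>{-1<..<1}. b1 (- e) \<omega>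
      = b2 e \<omega> \<and> b2 (- e) \<omega> = b1 e \<omega>"
    using conjunct1[OF bspec[OF that 0]] by simp
  ultimately show ?thesis using even_or_swapped[OF assms(1,2)] assms(4) by blast
qed

lemma swapped_minus_one:
  assumes "e \<in> {-1<..<1}"
  shows "b1 e (-1) = b2 (- e) (-1)"
proof -
  have w: "cmod (-1) = 1" "(-1 :: complex) \<noteq> 1" by simp_all
  have "\<not> (\<forall>e\<in>{-1<..<1}. b1 (- e) (-1) = b1 e (-1))"
  proof
    assume even: "\<forall>e\<in>{-1<..<1}. b1 (- e) (-1) = b1 e (-1)"
    have "0 \<in> {-1<..<1 :: real}" by simp
    then obtain D where D: "((\<lambda>e. b1 e (-1)) has_real_derivative D) (at 0)"
      using real_analytic_on_differentiable[OF analytic(1)[OF w]] by blast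
    then have D': "((\<lambda>e. b1 (- e) (-1)) has_real_derivative - D) (at 0)"
      using DERIV_mirror[where f = "\<lambda>e. b1 e (-1)" and x = 0 and y = D] by simp
    have "\<forall>\<^sub>F e in nhds 0. e \<in> {-1<..<1 :: real}" by (intro eventually_nhds_in_open) auto
    then have "\<forall>\<^sub>F e in nhds 0. b1 (- e) (-1) = b1 e (-1)"
      by eventually_elim (use even in auto)
    from DERIV_cong_ev[OF refl this refl] D'
    have "((\<lambda>e. b1 e (-1)) has_real_derivative - D) (at 0)" by (rule iffD1)
    from DERIV_unique[OF D this] have "D = 0" by simp
    show False
    proof (rule minus_one_curve_not_stationary)
      show "((\<lambda>e. b1 e (-1)) has_real_derivative 0) (at 0)" using D \<open>D = 0\<close> by simp
      show "b1 e (-1) \<in> {0<..<9} \<and> -1 \<in> cspectrum (gamma (b1 e (-1)) e (2 * pi))" if "e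
          \<in> {-1<..<1}" for e
        using range[OF w that] b1_in_cspectrum[OF w that] by blast
    qed
  qed
  then show ?thesis
    using even_or_swapped[OF w] assms by auto
qed

section \<open>The set of non-hyperbolic parameters and its upper end\<close>

lemma ellipticE:
  assumes e: "e \<in> {-1<..<1}" and \<beta>: "\<beta> \<in> elliptic e" "\<beta> > 0"
  obtains \<omega> where "cmod \<omega> = 1" "\<omega> \<noteq> 1" "\<omega> \<in> cspectrum (gamma
      \<beta> e (2 * pi))"
proof -
  obtain \<omega> where "\<omega> \<in> cspectrum (gamma \<beta> e (2 * pi))" "cmod \<omega> = 1"
    using \<beta>(1) by (auto simp: elliptic_def)
  moreover have "1 \<notin> cspectrum (gamma \<beta> e (2 * pi))"
    using \<beta> by (intro one_not_in_cspectrum e) (auto simp: elliptic_def)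
  ultimately show thesis using that by metis
qed

text \<open>Moving \<open>\<omega>\<close> along the punctured circle towards 1, a degenerate parameter
    above a hyperbolic
  one cannot disappear, and its limit would be a positive parameter with eigenvalue 1.\<close>

lemma hyperbolic_above:
  assumes e: "e \<in> {-1<..<1}" and \<beta>: "\<beta> \<in> elliptic e"
      and h: "h \<in> {0..9}" "h \<notin> elliptic e"
  shows "\<beta> < h"
proof (rule ccontr)
  assume "\<not> \<beta> < h"
  then have \<beta>h: "\<beta> > h" using \<beta> h by (cases "\<beta> = h") auto
  have "0 \<in> elliptic e" using zero_in_unit_spectrum[OF e] by (simp add: elliptic_def)
  then have h0: "h > 0" using h by (cases "h = 0") auto
  have not_h: "b \<noteq> h" if "\<omega> \<in> cspectrum (gamma b e (2 * pi))" "cmod \<omega>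
      = 1" for b \<omega>
    using that h by (auto simp: elliptic_def)
  define J where "J = {0<..<2 * pi}"
  \<comment> \<open>The angles whose multiplier has a degenerate parameter above h. This set will be
    open and closed in the connected interval \<open>J\<close>, hence all of \<open>J\<close> once
    it is nonempty.\<close>
  define P where "P = {\<phi>\<in>J. \<exists>b\<in>{h<..9}. cis \<phi> \<in> cspectrum (gamma b e (2 * pi))}"
  have cis1: "cis \<phi> \<noteq> 1" if "\<phi> \<in> J" for \<phi>
  proof
    assume "cis \<phi> = 1"
    then have "cis (2 * pi * (\<phi> / (2 * pi))) = cis (2 * pi * 0)" by simp
    then have "\<phi> / (2 * pi) \<in> \<int>" unfolding cis_2pi_eq_iff by simp
    then obtain z :: int where z: "\<phi> / (2 * pi) = of_int z" by (elim Ints_cases)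
    have "0 < \<phi> / (2 * pi)" "\<phi> / (2 * pi) < 1" using that by (auto simp: J_def)
    then show False unfolding z by simp
  qed
  have cl: "\<exists>b\<in>{c..d}. cis \<phi> \<in> cspectrum (gamma b e (2 * pi))"
    if "x \<longlonglongrightarrow> \<phi>" "\<And>n. \<exists>b\<in>{c..d}. cis (x n) \<in> cspectrum
        (gamma b e (2 * pi))" "{c..d} \<subseteq> {0..9}"
    for x :: "nat \<Rightarrow> real" and \<phi> c d
  proof -
    note spec = that(2)
    obtain b where b: "\<And>n. b n \<in> {c..d}" "\<And>n. cis (x n) \<in> cspectrum (gamma (b n) e (2 * pi))"
      using spec by metis
    have "(\<lambda>n. cis (x n)) \<longlonglongrightarrow> cis \<phi>"
      using that(1) isCont_tendsto_compose[of \<phi> cis] by (simp add: cis_conv_exp tendsto_intros)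
    from unit_spectrum_limit[OF this e b(1) that(3) b(2)] show ?thesis .
  qed
  have sub: "{h..9} \<subseteq> {0..9}" "{0..h} \<subseteq> {0..9}" using h by auto
  have P_closed: "\<phi> \<in> P" if "x \<longlonglongrightarrow> \<phi>" "\<And>n. x n \<in> P" "\<phi>
      \<in> J" for x \<phi>
  proof -
    \<comment> \<open>Compactness yields a limit parameter only in the closed interval; its lower
      end h is excluded because h is hyperbolic.\<close>
    have "\<exists>b\<in>{h..9}. cis \<phi> \<in> cspectrum (gamma b e (2 * pi))"
      by (rule cl[OF that(1) _ sub(1)]) (use that(2) in \<open>fastforce simp: P_def\<close>)
    then obtain b where "b \<in> {h..9}" "cis \<phi> \<in> cspectrum (gamma b e (2 * pi))" by blast
    moreover from this have "b \<noteq> h" using not_h by simp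
    ultimately show ?thesis using that(3) by (force simp: P_def)
  qed
  have P_open: "\<phi> \<notin> P" if x: "x \<longlonglongrightarrow> \<phi>" "\<And>n. x n \<in> J
      - P" for x \<phi>
  proof
    assume "\<phi> \<in> P"
    then obtain b where \<phi>: "\<phi> \<in> J" and b: "b \<in> {h<..9}" "cis \<phi> \<in> cspectrum
        (gamma b e (2 * pi))"
      by (auto simp: P_def)
    have \<omega>: "cmod (cis \<phi>) = 1" "cis \<phi> \<noteq> 1" using cis1[OF \<phi>] by simp_all
    have bb: "b = b1 e (cis \<phi>) \<or> b = b2 e (cis \<phi>)"
      using mem_cspectrum_iff[OF \<omega> e, of b] b h0 by auto
    then have b9: "b \<in> {0<..<9}" using range[OF \<omega> e] by auto
    show False
    \<comment> \<open>If the two curves meet at \<phi>, the zero need not be simple. But then b is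
      the only degenerate parameter of cis \<phi>, whereas the values of \<open>b1\<close> at the
      angles \<open>x n\<close>, all at most h, accumulate at another one. If the curves differ
      there, the kernel is a line and persistence applies.\<close>
    proof (cases "b1 e (cis \<phi>) = b2 e (cis \<phi>)")
      case True
      have "\<exists>b\<in>{0..h}. cis \<phi> \<in> cspectrum (gamma b e (2 * pi))"
      proof (rule cl[OF x(1) _ sub(2)])
        fix n
        have xn: "x n \<in> J" "x n \<notin> P" using x(2)[of n] by auto
        have \<omega>n: "cmod (cis (x n)) = 1" "cis (x n) \<noteq> 1" using cis1[OF xn(1)] by simp_all
        have "b1 e (cis (x n)) \<notin> {h<..9}"
          using xn b1_in_cspectrum[OF \<omega>n e] by (auto simp: P_def)
        then have "b1 e (cis (x n)) \<in> {0..h}" using range[OF \<omega>n e] by auto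
        then show "\<exists>b\<in>{0..h}. cis (x n) \<in> cspectrum (gamma b e (2 * pi))"
          using b1_in_cspectrum[OF \<omega>n e] by blast
      qed
      then obtain b' where b': "b' \<in> {0..h}" "cis \<phi> \<in> cspectrum (gamma b' e (2 * pi))" by blast
      then have "b' = b" using mem_cspectrum_iff[OF \<omega> e, of b'] bb True h by auto
      then show False using b b' by auto
    next
      case False
      have dim: "eigen_dim (gamma b e (2 * pi)) (cis \<phi>) = 1"
        using eigen_dim_eq[OF \<omega> e, of b] bb False b9 by auto
      define T where "T = {\<omega>. \<exists>\<beta>\<in>{0..9}. \<bar>\<beta> - b\<bar> < b - h
          \<and> \<omega> \<in> cspectrum (gamma \<beta> e (2 * pi))}"
      have "\<forall>\<^sub>F \<omega> in at (cis \<phi>) within sphere 0 1. \<omega> \<in> T"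
        using degenerate_parameter_persists[OF b9 e \<omega>(1) dim, of "b - h"] b by (simp add: T_def)
      then obtain U where U: "open U" "cis \<phi> \<in> U" "\<And>\<omega>. \<omega> \<in> U
          \<Longrightarrow> \<omega> \<noteq> cis \<phi> \<Longrightarrow> cmod \<omega>
          = 1 \<Longrightarrow> \<omega> \<in> T"
        unfolding eventually_at_topological by auto
      have "(\<lambda>n. cis (x n)) \<longlonglongrightarrow> cis \<phi>"
        using x(1) isCont_tendsto_compose[of \<phi> cis] by (simp add: cis_conv_exp tendsto_intros)
      then have "\<forall>\<^sub>F n in sequentially. cis (x n) \<in> U"
          using U by (simp add: topological_tendstoD)
      then obtain n where n: "cis (x n) \<in> U" by (meson eventually_happens sequentially_bot)
      have xn: "x n \<in> J" "x n \<notin> P" using x(2)[of n] by auto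
      have "\<exists>\<beta>\<in>{h<..9}. cis (x n) \<in> cspectrum (gamma \<beta> e (2 * pi))"
      proof (cases "cis (x n) = cis \<phi>")
        case True
        then show ?thesis using b by auto
      next
        case False
        then have "cis (x n) \<in> T" using U(3)[OF n] by simp
        then show ?thesis by (force simp: T_def abs_if split: if_splits)
      qed
      then show False using xn by (simp add: P_def)
    qed
  qed
  \<comment> \<open>As \<open>J\<close> is itself open, sequences inside \<open>J\<close> suffice to
    test openness of its subsets.\<close>
  have open_J: "open Q"
    if Q: "\<And>x \<phi>. x \<longlonglongrightarrow> \<phi> \<Longrightarrow> (\<And>n. x n \<in> J
        - Q) \<Longrightarrow> \<phi> \<in> J \<Longrightarrow> \<phi> \<notin> Q" "Q \<subseteq> J" for Q
    unfolding open_closed closed_sequential_limits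
  proof (intro allI impI; elim conjE)
    fix x \<phi> assume x: "\<forall>n. x n \<in> - Q" "x \<longlonglongrightarrow> \<phi>"
    show "\<phi> \<in> - Q"
    proof (cases "\<phi> \<in> J")
      case True
      then have "\<forall>\<^sub>F n in sequentially. x n \<in> J"
          using x(2) by (intro topological_tendstoD) (auto simp: J_def)
      then obtain N where "\<And>n. n \<ge> N \<Longrightarrow> x n \<in> J"
          by (auto simp: eventually_sequentially)
      then show ?thesis
        using Q(1)[of "\<lambda>n. x (n + N)" \<phi>] x LIMSEQ_ignore_initial_segment[OF x(2), of N] True
            by auto
    qed (use Q(2) in auto)
  qed
  have "open P" by (rule open_J) (use P_open in \<open>auto simp: P_def\<close>)
  moreover have "open (J - P)"
  proof (rule open_J)
    show "\<phi> \<notin> J - P" if "x \<longlonglongrightarrow> \<phi>" "\<And>n. x n \<in> J - (J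
        - P)" "\<phi> \<in> J" for x \<phi>
      using P_closed[OF that(1) _ that(3)] that(2) by auto
  qed auto
  moreover have "connected J" by (simp add: J_def)
  ultimately have "P \<inter> J = {} \<or> (J - P) \<inter> J = {}"
    by (intro connectedD) auto
  moreover have "P \<inter> J \<noteq> {}"
  proof -
    obtain \<omega> where \<omega>: "cmod \<omega>
        = 1" "\<omega> \<noteq> 1" "\<omega> \<in> cspectrum (gamma \<beta> e (2 * pi))"
      using ellipticE[OF e \<beta>] \<beta>h h0 by force
    have "\<omega> = cis (Arg2pi \<omega>)"
      using Arg2pi_eq[of \<omega>] unfolding \<omega>(1) cis_conv_exp of_real_1 mult_1 .
    then have \<phi>: "cis (Arg2pi \<omega>) = \<omega>" "0 \<le> Arg2pi \<omega>" "Arg2pi \<omega> < 2 * pi"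
      using Arg2pi_ge_0 Arg2pi_lt_2pi by simp_all
    then have "Arg2pi \<omega> \<noteq> 0" using \<omega>(2) by auto
    then have "Arg2pi \<omega> \<in> P \<inter> J"
        using \<phi> \<omega>(3) \<beta>h \<beta> by (auto simp: P_def J_def elliptic_def)
    then show ?thesis by blast
  qed
  ultimately have PJ: "J \<subseteq> P" by blast
  have "\<exists>b\<in>{h..9}. cis 0 \<in> cspectrum (gamma b e (2 * pi))"
  proof (rule cl[OF _ _ sub(1)])
    show "(\<lambda>n. inverse (real (Suc n))) \<longlonglongrightarrow> 0" by (rule LIMSEQ_inverse_real_of_nat)
    fix n
    have "inverse (real (Suc n)) \<le> 1" by (simp add: field_simps)
    also have "1 < 2 * pi" using pi_gt3 by simp
    finally have "inverse (real (Suc n)) \<in> J" by (simp add: J_def)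
    then show "\<exists>b\<in>{h..9}. cis (inverse (real (Suc n))) \<in> cspectrum (gamma b e (2 * pi))"
      using PJ by (fastforce simp: P_def)
  qed
  then obtain b where "b \<in> {h..9}" "1 \<in> cspectrum (gamma b e (2 * pi))" by auto
  then show False using one_not_in_cspectrum[OF _ e, of b] h0 by auto
qed

text \<open>By \<open>hyperbolic_above\<close> every parameter below an elliptic one is elliptic, so
  the condition on the whole interval [0, \<beta>'] in \<open>beta_k\<close> says no more than that
  \<beta>' itself is elliptic.\<close>

lemma beta_k_eq:
  assumes e: "e \<in> {-1<..<1}"
  shows "beta_k e = Sup (elliptic e)"
proof -
  have "{\<beta>'\<in>{0..9}. \<forall>\<beta>\<in>{0..\<beta>'}. cspectrum (gamma \<beta> e (2 * pi))
      \<inter> sphere 0 1 \<noteq> {}} = elliptic e"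
  proof (intro equalityI subsetI)
    fix \<beta>' assume "\<beta>' \<in> elliptic e"
    moreover from this have "\<beta> \<in> elliptic e" if "\<beta> \<in> {0..\<beta>'}" for \<beta>
      using hyperbolic_above[OF e, of \<beta>' \<beta>] that by (force simp: elliptic_def)
    ultimately show "\<beta>' \<in> {\<beta>'\<in>{0..9}. \<forall>\<beta>\<in>{0..\<beta>'}. cspectrum
        (gamma \<beta> e (2 * pi)) \<inter> sphere 0 1 \<noteq> {}}"
      by (simp add: elliptic_def)
  qed (auto simp: elliptic_def)
  then show ?thesis by (simp only: beta_k_def)
qed

lemma beta_k_elliptic:
  assumes e: "e \<in> {-1<..<1}"
  shows "beta_k e \<in> elliptic e" and "\<And>\<beta>. \<beta> \<in> elliptic e \<Longrightarrow>
      \<beta> \<le> beta_k e"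
proof -
  have bdd: "bdd_above (elliptic e)" by (rule bdd_aboveI[of _ 9]) (simp add: elliptic_def)
  have "closed (elliptic e)"
    unfolding closed_sequential_limits
    using elliptic_tendsto[OF tendsto_const e e] by blast
  moreover have "0 \<in> elliptic e" using zero_in_unit_spectrum[OF e] by (simp add: elliptic_def)
  ultimately show "beta_k e \<in> elliptic e"
    unfolding beta_k_eq[OF e] by (intro closed_contains_Sup bdd) auto
  show "\<beta> \<le> beta_k e" if "\<beta> \<in> elliptic e" for \<beta>
    unfolding beta_k_eq[OF e] by (rule cSup_upper[OF that bdd])
qed

lemma continuous_on_beta_k: "continuous_on {-1<..<1} beta_k"
proof (rule continuous_on_sequentiallyI)
  fix u a assume u: "\<forall>n. u n \<in> {-1<..<1 :: real}" and a: "a \<in> {-1<..<1}"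
      and lim: "u \<longlonglongrightarrow> a"
  note el = beta_k_elliptic[OF a]
  show "(\<lambda>n. beta_k (u n)) \<longlonglongrightarrow> beta_k a"
  proof (rule order_tendstoI)
    fix y assume y: "y < beta_k a"
    show "\<forall>\<^sub>F n in sequentially. y < beta_k (u n)"
    proof (cases "beta_k a > 0")
      case True
      \<comment> \<open>Freeze a unit eigenvalue at a: its degeneracy curve through
        \<open>beta_k a\<close> consists of elliptic parameters, so it is a continuous lower bound
        for \<open>beta_k\<close>.\<close>
      obtain \<omega> where \<omega>: "cmod \<omega>
          = 1" "\<omega> \<noteq> 1" "\<omega> \<in> cspectrum (gamma (beta_k a) a (2 * pi))"
        using ellipticE[OF a el(1) True] .
      have mem: "b1 e \<omega> \<in> elliptic e" "b2 e \<omega> \<in> elliptic e" if "e \<in> {-1<..<1}" for e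
        using b1_in_cspectrum[OF \<omega>(1,2) that] b2_in_cspectrum[OF \<omega>(1,2) that] range[OF
            \<omega>(1,2) that] \<omega>(1)
        by (auto simp: elliptic_def)
      have "beta_k a = b1 a \<omega> \<or> beta_k a = b2 a \<omega>"
        using mem_cspectrum_iff[OF \<omega>(1,2) a] \<omega>(3) el(1) by (simp add: elliptic_def)
      then obtain c where c: "beta_k a = c a" "isCont c a" "\<And>e. e \<in> {-1<..<1} \<Longrightarrow>
          c e \<in> elliptic e"
      proof (elim disjE)
        assume "beta_k a = b1 a \<omega>"
        then show thesis by (rule that[OF _ real_analytic_on_isCont[OF analytic(1)[OF \<omega>(1,2)] a] mem(1)])
      next
        assume "beta_k a = b2 a \<omega>"
        then show thesis by (rule that[OF _ real_analytic_on_isCont[OF analytic(2)[OF \<omega>(1,2)] a] mem(2)])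
      qed
      have "(\<lambda>n. c (u n)) \<longlonglongrightarrow> c a" by (rule isCont_tendsto_compose[OF c(2) lim])
      then have "\<forall>\<^sub>F n in sequentially. y < c (u n)" using y c(1) by (intro order_tendstoD) auto
      then show ?thesis
      proof eventually_elim
        case (elim n)
        then show ?case using beta_k_elliptic(2)[OF u[rule_format] c(3)[OF u[rule_format]], of n] by simp
      qed
    next
      case False
      \<comment> \<open>At \<open>beta_k a = 0\<close> the unit eigenvalue may be 1, which has no
        curve to follow; here nonnegativity of \<open>beta_k\<close> is enough.\<close>
      have "0 \<le> beta_k (u n)" for n using beta_k_elliptic(1)[OF u[rule_format]] by (simp add: elliptic_def)
      then show ?thesis using y False by (intro always_eventually allI) (meson less_le_trans not_less
          order_less_le_trans le_less_trans)
    qed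
  next
    fix y assume y: "beta_k a < y"
    show "\<forall>\<^sub>F n in sequentially. beta_k (u n) < y"
    proof (rule ccontr)
      assume "\<not> ?thesis"
      then obtain r :: "nat \<Rightarrow> nat" where r: "strict_mono r" "\<And>n. \<not> beta_k (u (r n)) < y"
        using not_eventually_sequentiallyD by blast
      have "beta_k (u (r n)) \<in> {y..9}" for n
        using r(2)[of n] beta_k_elliptic(1)[OF u[rule_format]] by (auto simp: elliptic_def)
      moreover have "seq_compact {y..9}" by (simp add: compact_eq_seq_compact_metric[symmetric])
      ultimately obtain b r' where b: "b \<in> {y..9}" and r': "strict_mono (r' :: nat \<Rightarrow> nat)"
        and lim': "((\<lambda>n. beta_k (u (r n))) \<circ> r') \<longlonglongrightarrow> b"
        by (metis seq_compactE)
      have "(u \<circ> (r \<circ> r')) \<longlonglongrightarrow> a"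
        by (rule LIMSEQ_subseq_LIMSEQ[OF lim strict_mono_o[OF r(1) r']])
      then have "b \<in> elliptic a"
        by (rule elliptic_tendsto[OF _ _ a lim']) (use u beta_k_elliptic(1) in auto)
      then show False using el(2)[of b] b y by auto
    qed
  qed
qed

end

theorem theorem1p6:
  fixes \<beta>1 \<beta>2 :: "real \<Rightarrow> complex \<Rightarrow> real"
  assumes "degeneracy_curves \<beta>1 \<beta>2"
  shows "(\<forall>e\<in>{-1<..<1}. \<beta>1 e (-1) = \<beta>2 (-e) (-1)) \<and>
         (\<forall>\<omega>\<in>sphere 0 1 - {-1}. \<forall>e\<in>{-1<..<1}.
            \<beta>1 (-e) \<omega> = \<beta>1 e \<omega> \<and> \<beta>2 (-e) \<omega>
                = \<beta>2 e \<omega>) \<and>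
         (\<forall>e\<in>{-1<..<1}. beta_k (-e) = beta_k e) \<and>
         (\<exists>c :: real \<Rightarrow> real \<times> real.
            continuous_on {-1<..<1} c \<and>
            c \<in> {-1<..<1} \<rightarrow> {0..9} \<times> {-1<..<1} \<and>
            (\<forall>e\<in>{0..<1}. c e = Gamma_k e) \<and>
            (\<forall>e\<in>{-1<..<1}. c (-e) = (fst (c e), - snd (c e))))"
proof -
  interpret degeneracy_data \<beta>1 \<beta>2 by unfold_locales (rule assms)
  have "\<beta>1 (- e) \<omega> = \<beta>1 e \<omega> \<and> \<beta>2 (- e) \<omega> = \<beta>2 e \<omega>"
    if "\<omega> \<in> sphere 0 1 - {-1}" "e \<in> {-1<..<1}" for \<omega> e
  proof (cases "\<omega> = 1")
    case True
    then show ?thesis using at_one[of e] at_one[of "- e"] that by simp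
  next
    case False
    then show ?thesis using even_nonreal[of \<omega> e] that by simp
  qed
  \<comment> \<open>The formula of \<open>Gamma_k\<close> is already meaningful for negative e and
    serves as the extension; its symmetry is the evenness of \<open>beta_k\<close>.\<close>
  moreover have "continuous_on {-1<..<1} Gamma_k"
    unfolding Gamma_k_def[abs_def] by (intro continuous_on_Pair continuous_on_beta_k continuous_on_id)
  moreover have "Gamma_k \<in> {-1<..<1} \<rightarrow> {0..9} \<times> {-1<..<1}"
    using beta_k_elliptic(1) by (auto simp: Gamma_k_def elliptic_def)
  moreover have "Gamma_k (- e) = (fst (Gamma_k e), - snd (Gamma_k e))" if "e \<in> {-1<..<1}" for e
    by (simp add: Gamma_k_def beta_k_even[OF that])
  ultimately show ?thesis using swapped_minus_one beta_k_even by blast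
qed

end
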